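(* Let $\mathcal{E}$ be an ensemble of matchgate circuits on $n$ qubits of depth $d$. Then: 1. If the state ensemble $\{U|0^n\rangle\}_{U\sim\mathcal{E}}$ (with second moment $\Phi_{\mathcal{E}}(|0^n\rangle\langle0^n|^{\otimes2})$) is an additive-error $\epsilon$-approximate matchgate state $2$-design with $\epsilon<1/(2n-1)$, then $d=\Omega(n)$. 2. If it is a relative-error $\epsilon$-approximate matchgate state $2$-design with $\epsilon<1/(4n-2)$, then $d=\Omega(n)$.
   Context: Majorana operators on $n$ qubits (Jordan–Wigner): $\gamma_{2i-1}=Z_1\cdots Z_{i-1}X_i$, $\gamma_{2i}=Z_1\cdots Z_{i-1}Y_i$, $i=1,\dots,n$. The matchgate group $\mathrm{M}(n)$ on $n$ qubits (in a line) is generated by the two-qubit unitaries $e^{i\theta P_jQ_{j+1}}$ with $P,Q\in\{X,Y\}$, $\theta\in\mathbb{R}$, together with single-qubit $X$ gates. Up to phases, its elements are the unitaries $U(O)$, $O\in\mathrm{O}(2n)$, with $U(O)\gamma_iU(O)^\dagger=\sum_{j=1}^{2n}O_{ij}\gamma_j$; uniformly random matchgates are $U(O)$ with $O$ Haar-random in $\mathrm{O}(2n)$. A matchgate circuit of depth $d$ consists of $d$ layers of nearest-neighbour two-qubit matchgates (on disjoint pairs of neighbouring qubits on the line). $\Phi_{\mathcal{E}}(A)=\mathbb{E}_{U\sim\mathcal{E}}U^{\otimes2}A\,U^{\dagger,\otimes2}$. Let $\sigma=\mathbb{E}_{O\sim\mathrm{O}(2n)}(U(O)|0^n\rangle\langle0^n|U(O)^\dagger)^{\otimes2}$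 and $\tau=\Phi_{\mathcal{E}}(|0^n\rangle\langle0^n|^{\otimes2})$. The state ensemble is an additive-error $\epsilon$-approximate matchgate state $2$-design if $\|\sigma-\tau\|_1\le\epsilon$ (trace norm), and a relative-error one if $(1-\epsilon)\sigma\preceq\tau\preceq(1+\epsilon)\sigma$ (positive-semidefinite order). *)

theory Defs
  imports
    "HOL-Probability.Probability_Measure"
    "Jordan_Normal_Form.Schur_Decomposition"
begin

section \<open>Linear algebra\<close>

definition kron :: "'a::semiring_1 mat \<Rightarrow> 'a mat \<Rightarrow> 'a mat" where
  "kron A B = mat (dim_row A * dim_row B) (dim_col A * dim_col B)
     (\<lambda>(i, j). A $$ (i div dim_row B, j div dim_col B) * B $$ (i mod dim_row B, j mod dim_col B))"

definition kron_list :: "'a::semiring_1 mat list \<Rightarrow> 'a mat" where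
  "kron_list As = foldr kron As (1\<^sub>m 1)"

definition mat_exp :: "complex mat \<Rightarrow> complex mat" where
  "mat_exp A = mat (dim_row A) (dim_col A) (\<lambda>ij. \<Sum>k. (A ^\<^sub>m k) $$ ij / fact k)"

definition unitary :: "nat \<Rightarrow> complex mat \<Rightarrow> bool" where
  "unitary N U \<longleftrightarrow> U \<in> carrier_mat N N \<and> U * mat_adjoint U = 1\<^sub>m N \<and> mat_adjoint U * U = 1\<^sub>m N"

definition psd :: "nat \<Rightarrow> complex mat \<Rightarrow> bool" where
  "psd N A \<longleftrightarrow> A \<in> carrier_mat N N \<and> mat_adjoint A = A \<and>
     (\<forall>v \<in> carrier_vec N. 0 \<le> Re (scalar_prod (A *\<^sub>v v) (conjugate v)))"

definition loewner_le :: "nat \<Rightarrow> complex mat \<Rightarrow> complex mat \<Rightarrow> bool" where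
  "loewner_le N A B \<longleftrightarrow> A \<in> carrier_mat N N \<and> B \<in> carrier_mat N N \<and> psd N (B - A)"

text \<open>The trace norm is the sum of the singular values, i.e. of the square roots of the
  eigenvalues of \<open>A\<^sup>\<dagger>A\<close>, counted with multiplicity; these eigenvalues are nonnegative reals.\<close>

definition trace_norm :: "complex mat \<Rightarrow> real" where
  "trace_norm A = (\<Sum>x \<in># proots (char_poly (mat_adjoint A * A)). sqrt (Re x))"

section \<open>Random matrices\<close>

text \<open>The Borel \<open>\<sigma>\<close>-algebra on the space of matrices of a fixed format, identified with the
  finite product of the spaces of their entries.\<close>

definition mat_borel :: "nat \<Rightarrow> nat \<Rightarrow> 'a::topological_space mat measure" where
  "mat_borel r c = vimage_algebra (carrier_mat r c) (\<lambda>A. \<lambda>ij \<in> {..<r} \<times> {..<c}. A $$ ij)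
     (\<Pi>\<^sub>M ij \<in> {..<r} \<times> {..<c}. borel)"

definition mat_expectation :: "nat \<Rightarrow> 'w measure \<Rightarrow> ('w \<Rightarrow> complex mat) \<Rightarrow> complex mat" where
  "mat_expectation N M F = mat N N (\<lambda>ij. \<integral>w. F w $$ ij \<partial>M)"

definition orthogonal_group :: "nat \<Rightarrow> real mat set" where
  "orthogonal_group m = {R \<in> carrier_mat m m. R * transpose_mat R = 1\<^sub>m m}"

text \<open>Haar measure on \<open>O(m)\<close>, characterised as the unique left-invariant Borel probability
  measure.\<close>

definition haar_orthogonal :: "nat \<Rightarrow> real mat measure \<Rightarrow> bool" where
  "haar_orthogonal m \<mu> \<longleftrightarrow> prob_space \<mu> \<and>
     space \<mu> = orthogonal_group m \<and>
     sets \<mu> = sets (restrict_space (mat_borel m m) (orthogonal_group m)) \<and>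
     (\<forall>Q \<in> orthogonal_group m. distr \<mu> \<mu> (\<lambda>R. Q * R) = \<mu>)"

section \<open>Matchgates\<close>

text \<open>Qubits and Majorana operators are indexed from 0, and qubit 0 is the leftmost tensor factor.\<close>

definition pauli_X :: "complex mat" where
  "pauli_X = mat_of_rows_list 2 [[0, 1], [1, 0]]"

definition pauli_Y :: "complex mat" where
  "pauli_Y = mat_of_rows_list 2 [[0, - \<i>], [\<i>, 0]]"

definition pauli_Z :: "complex mat" where
  "pauli_Z = mat_of_rows_list 2 [[1, 0], [0, - 1]]"

definition on_qubit :: "nat \<Rightarrow> nat \<Rightarrow> complex mat \<Rightarrow> complex mat" where
  "on_qubit n j A = kron_list (map (\<lambda>i. if i = j then A else 1\<^sub>m 2) [0..<n])"

text \<open>With 1-based indices, \<open>majorana n (2i - 2)\<close> is \<open>\<gamma>\<^sub>2\<^sub>i\<^sub>-\<^sub>1 = Z\<^sub>1 \<cdots> Z\<^sub>i\<^sub>-\<^sub>1 X\<^sub>i\<close> and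
  \<open>majorana n (2i - 1)\<close> is \<open>\<gamma>\<^sub>2\<^sub>i = Z\<^sub>1 \<cdots> Z\<^sub>i\<^sub>-\<^sub>1 Y\<^sub>i\<close>.\<close>

definition majorana :: "nat \<Rightarrow> nat \<Rightarrow> complex mat" where
  "majorana n k = kron_list (map (\<lambda>i.
     if i < k div 2 then pauli_Z
     else if i = k div 2 then (if even k then pauli_X else pauli_Y)
     else 1\<^sub>m 2) [0..<n])"

text \<open>The generators are closed under inverses, so the monoid they generate is a group.\<close>

inductive_set matchgate_group :: "nat \<Rightarrow> complex mat set" for n :: nat where
  one: "1\<^sub>m (2 ^ n) \<in> matchgate_group n"
| rotation: "mat_exp ((\<i> * complex_of_real \<theta>) \<cdot>\<^sub>m (on_qubit n j P * on_qubit n (Suc j) Q)) * U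
      \<in> matchgate_group n"
    if "U \<in> matchgate_group n" "Suc j < n" "P \<in> {pauli_X, pauli_Y}" "Q \<in> {pauli_X, pauli_Y}"
    for \<theta> :: real
| flip: "on_qubit n j pauli_X * U \<in> matchgate_group n"
    if "U \<in> matchgate_group n" "j < n"

text \<open>A layer is a tensor product of idle qubits and of two-qubit matchgates acting on pairs of
  neighbouring qubits; the pairs are thereby disjoint.\<close>

inductive matchgate_layer :: "nat \<Rightarrow> complex mat \<Rightarrow> bool" where
  empty: "matchgate_layer 0 (1\<^sub>m 1)"
| idle: "matchgate_layer (n + 1) (kron (1\<^sub>m 2) L)" if "matchgate_layer n L"
| gate: "matchgate_layer (n + 2) (kron G L)" if "G \<in> matchgate_group 2" "matchgate_layer n L"

inductive matchgate_circuit :: "nat \<Rightarrow> nat \<Rightarrow> complex mat \<Rightarrow> bool" for n :: nat where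
  zero: "matchgate_circuit n 0 (1\<^sub>m (2 ^ n))"
| layer: "matchgate_circuit n (Suc d) (L * U)" if "matchgate_layer n L" "matchgate_circuit n d U"

definition matchgate_ensemble :: "nat \<Rightarrow> nat \<Rightarrow> complex mat measure \<Rightarrow> bool" where
  "matchgate_ensemble n d E \<longleftrightarrow> prob_space E \<and>
     sets E = sets (mat_borel (2 ^ n) (2 ^ n)) \<and>
     (AE U in E. matchgate_circuit n d U)"

text \<open>\<open>U(O)\<close> is determined only up to a phase, which cancels in \<open>U(O) A U(O)\<^sup>\<dagger>\<close>.\<close>

definition majorana_unitary :: "nat \<Rightarrow> real mat \<Rightarrow> complex mat" where
  "majorana_unitary n R = (SOME U. unitary (2 ^ n) U \<and>
     (\<forall>i < 2 * n. U * majorana n i * mat_adjoint U =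
        mat (2 ^ n) (2 ^ n) (\<lambda>rc. \<Sum>j < 2 * n. complex_of_real (R $$ (i, j)) * majorana n j $$ rc)))"

section \<open>Second moments and approximate state designs\<close>

definition zero_state :: "nat \<Rightarrow> complex mat" where
  "zero_state n = mat (2 ^ n) (2 ^ n) (\<lambda>(r, c). if r = 0 \<and> c = 0 then 1 else 0)"

definition twirl :: "nat \<Rightarrow> complex mat measure \<Rightarrow> complex mat \<Rightarrow> complex mat" where
  "twirl n E A = mat_expectation (2 ^ n * 2 ^ n) E
     (\<lambda>U. kron U U * A * kron (mat_adjoint U) (mat_adjoint U))"

definition haar_state_moment :: "nat \<Rightarrow> real mat measure \<Rightarrow> complex mat" where
  "haar_state_moment n \<mu> = mat_expectation (2 ^ n * 2 ^ n) \<mu>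
     (\<lambda>R. let \<psi> = majorana_unitary n R * zero_state n * mat_adjoint (majorana_unitary n R)
          in kron \<psi> \<psi>)"

definition ensemble_state_moment :: "nat \<Rightarrow> complex mat measure \<Rightarrow> complex mat" where
  "ensemble_state_moment n E = twirl n E (kron (zero_state n) (zero_state n))"

text \<open>The measure \<open>\<mu>\<close> is meant to be the Haar measure on \<open>O(2n)\<close>.\<close>

definition additive_state_design ::
  "nat \<Rightarrow> real mat measure \<Rightarrow> real \<Rightarrow> complex mat measure \<Rightarrow> bool" where
  "additive_state_design n \<mu> \<epsilon> E \<longleftrightarrow>
     trace_norm (haar_state_moment n \<mu> - ensemble_state_moment n E) \<le> \<epsilon>"

definition relative_state_design ::
  "nat \<Rightarrow> real mat measure \<Rightarrow> real \<Rightarrow> complex mat measure \<Rightarrow> bool" where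
  "relative_state_design n \<mu> \<epsilon> E \<longleftrightarrow>
     loewner_le (2 ^ n * 2 ^ n) (complex_of_real (1 - \<epsilon>) \<cdot>\<^sub>m haar_state_moment n \<mu>)
       (ensemble_state_moment n E) \<and>
     loewner_le (2 ^ n * 2 ^ n) (ensemble_state_moment n E)
       (complex_of_real (1 + \<epsilon>) \<cdot>\<^sub>m haar_state_moment n \<mu>)"

end

theory Submission
  imports Defs
begin

text \<open>Both parts test the second moments against one observable \<open>C \<otimes> C\<close>, where
  \<open>C = - \<i> \<gamma>\<^sub>1 \<gamma>\<^sub>2\<^sub>n\<close> correlates the two ends of the line and is a self-adjoint unitary.
  In the Heisenberg picture each layer spreads a Majorana operator by at most one qubit in each
  direction, so for \<open>2d + 1 < n\<close> the expectation of \<open>C\<close> in \<open>U|0\<^sup>n\<rangle>\<close> vanishes and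
  \<open>tr((C \<otimes> C)\<tau>) = 0\<close>. For Haar-random \<open>O\<close> this expectation is an entry of a random
  antisymmetric orthogonal matrix of size \<open>2n\<close>, whose off-diagonal entries have equal second moments,
  so \<open>tr((C \<otimes> C)\<sigma>) = 1/(2n - 1)\<close>. An additive or a relative error below that value
  is impossible, by duality for the trace norm, respectively by positivity of
  \<open>1 \<plusminus> C \<otimes> C\<close>.\<close>

section \<open>Adjoints and Kronecker products\<close>

text \<open>Several obstacles shape the details. A Majorana operator drags a string of
  \<open>pauli_Z\<close> factors across every qubit to its left, so locality is not visible qubit by
  qubit; the light cone survives because a two-qubit matchgate preserves the string on its two
  qubits up to a scalar. The state \<sigma> is built from \<open>majorana_unitary n R\<close>, which
  is picked by a choice operator. Its existence is proved by composing unitaries of reflections. Its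
  measurability in \<open>R\<close> cannot be expected, but the states it produces have entries
  polynomial in those of \<open>R\<close>, and this is enough. The trace norm is given by roots of a
  characteristic polynomial, and unitary triangularization turns these roots into column norms. The
  value 1/(2n-1) has this origin: the Haar expectation of the observable is a sum of n two-by-two
  minors on two orthonormal columns; the squares of all such minors add up to 2 over the 2n(2n-1)
  ordered pairs of distinct rows, so each has mean 1/(n(2n-1)), and the n minors in question are
  uncorrelated.\<close>

lemma mat_adjoint_altdef:
  "mat_adjoint A = mat (dim_col A) (dim_row A) (\<lambda>(i, j). conjugate (A $$ (j, i)))"
  by (rule eq_matI) (auto simp: mat_adjoint_def mat_of_rows_def)

lemma dim_mat_adjoint [simp]:
  "dim_row (mat_adjoint A) = dim_col A" "dim_col (mat_adjoint A) = dim_row A"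
  by (simp_all add: mat_adjoint_altdef)

lemma index_mat_adjoint [simp]:
  "i < dim_col A \<Longrightarrow> j < dim_row A \<Longrightarrow> mat_adjoint A $$ (i, j) = conjugate (A $$ (j, i))"
  by (simp add: mat_adjoint_altdef)

lemma mat_adjoint_carrier [simp]: "A \<in> carrier_mat n m \<Longrightarrow> mat_adjoint A \<in> carrier_mat m n"
  by (intro carrier_matI) auto

lemma mat_adjoint_mult:
  fixes A B :: "complex mat"
  assumes "A \<in> carrier_mat n m" "B \<in> carrier_mat m k"
  shows "mat_adjoint (A * B) = mat_adjoint B * mat_adjoint A"
  using assms by (intro eq_matI) (auto simp: scalar_prod_def mult.commute intro!: sum.cong)

lemma mat_adjoint_mat_adjoint [simp]: "mat_adjoint (mat_adjoint A) = (A :: complex mat)"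
  by (rule eq_matI) auto

lemma mat_adjoint_one [simp]: "mat_adjoint (1\<^sub>m n) = (1\<^sub>m n :: complex mat)"
  by (rule eq_matI) auto

lemma mat_adjoint_smult: "mat_adjoint (c \<cdot>\<^sub>m A) = cnj c \<cdot>\<^sub>m mat_adjoint (A :: complex mat)"
  by (rule eq_matI) auto

lemma mat_adjoint_add:
  assumes "A \<in> carrier_mat n m" "B \<in> carrier_mat n m"
  shows "mat_adjoint (A + B) = mat_adjoint A + mat_adjoint (B :: complex mat)"
  using assms by (intro eq_matI) auto

lemma index_mult_sum:
  assumes "A \<in> carrier_mat n m" "B \<in> carrier_mat m k" "i < n" "j < k"
  shows "(A * B) $$ (i, j) = (\<Sum>l<m. A $$ (i, l) * B $$ (l, j))"
  using assms by (simp add: scalar_prod_def lessThan_atLeast0)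

section \<open>Kronecker products: indices, mixed products, associativity, bilinearity\<close>

lemma dim_kron [simp]:
  "dim_row (kron A B) = dim_row A * dim_row B" "dim_col (kron A B) = dim_col A * dim_col B"
  by (simp_all add: kron_def)

lemma index_kron [simp]:
  "i < dim_row A * dim_row B \<Longrightarrow> j < dim_col A * dim_col B \<Longrightarrow> kron A B $$ (i, j) =
     A $$ (i div dim_row B, j div dim_col B) * B $$ (i mod dim_row B, j mod dim_col B)"
  by (simp add: kron_def)

lemma kron_carrier:
  "A \<in> carrier_mat a b \<Longrightarrow> B \<in> carrier_mat c d \<Longrightarrow> kron A B \<in> carrier_mat (a * c) (b * d)"
  by (intro carrier_matI) auto

lemma mult_bound_split:
  fixes i m n :: nat
  assumes "i < m * n"
  shows "i div n < m" "i mod n < n"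
proof -
  have "n > 0" using assms by (cases n) auto
  then show "i div n < m" "i mod n < n" using assms by (auto simp: less_mult_imp_div_less)
qed

lemma sum_lessThan_mult:
  fixes f :: "nat \<Rightarrow> 'a::comm_monoid_add"
  shows "sum f {..<a * b} = (\<Sum>i<a. \<Sum>j<b. f (i * b + j))"
proof -
  have "sum f {m * b..<m * b + b} = (\<Sum>j<b. f (m * b + j))" for m
    using sum.shift_bounds_nat_ivl[of f 0 "m * b" b] by (simp add: add.commute lessThan_atLeast0)
  then show ?thesis using sum.nat_group[of f b a] by simp
qed

text \<open>The mixed-product rule. A summation index below \<open>b * e\<close> is uniquely of the
  form \<open>k * e + l\<close>, and in these digits the sum factors into a product of two
  sums.\<close>

lemma kron_mult:
  fixes A B C D :: "'a::comm_semiring_1 mat"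
  assumes "A \<in> carrier_mat a b" "C \<in> carrier_mat b c" "B \<in> carrier_mat d e" "D \<in> carrier_mat e f"
  shows "kron A B * kron C D = kron (A * C) (B * D)"
proof (rule eq_matI)
  fix i j assume "i < dim_row (kron (A * C) (B * D))" "j < dim_col (kron (A * C) (B * D))"
  then have ij: "i < a * d" "j < c * f" using assms by auto
  note s = mult_bound_split[OF ij(1)] mult_bound_split[OF ij(2)]
  have "(kron A B * kron C D) $$ (i, j) = (\<Sum>k<b * e. kron A B $$ (i, k) * kron C D $$ (k, j))"
    using assms ij by (simp add: scalar_prod_def lessThan_atLeast0)
  also have "\<dots> = (\<Sum>k<b. \<Sum>l<e. (A $$ (i div d, k) * C $$ (k, j div f)) * (B $$ (i mod d, l) * D $$ (l, j mod f)))"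
  proof (unfold sum_lessThan_mult, intro sum.cong refl)
    fix k l assume "k \<in> {..<b}" "l \<in> {..<e}"
    then have kl: "k < b" "l < e" by auto
    have "k * e + l < Suc k * e" using kl by simp
    also have "\<dots> \<le> b * e" using kl by (intro mult_le_mono1) simp
    finally have "k * e + l < b * e" .
    moreover have "(k * e + l) div e = k" "(k * e + l) mod e = l" using kl by auto
    ultimately show "kron A B $$ (i, k * e + l) * kron C D $$ (k * e + l, j) =
       (A $$ (i div d, k) * C $$ (k, j div f)) * (B $$ (i mod d, l) * D $$ (l, j mod f))"
      using assms ij by (simp add: mult_ac)
  qed
  also have "\<dots> = (\<Sum>k<b. A $$ (i div d, k) * C $$ (k, j div f)) * (\<Sum>l<e. B $$ (i mod d, l) * D $$ (l, j mod f))"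
    by (simp add: sum_product)
  also have "\<dots> = kron (A * C) (B * D) $$ (i, j)"
    using assms ij s by (simp add: scalar_prod_def lessThan_atLeast0)
  finally show "(kron A B * kron C D) $$ (i, j) = kron (A * C) (B * D) $$ (i, j)" .
qed (use assms in auto)

text \<open>With premises on dimensions only, this form can be used as a rewrite rule: no carrier
  sizes have to be guessed.\<close>

lemma kron_mult_dim:
  "dim_col A = dim_row C \<Longrightarrow> dim_col B = dim_row D \<Longrightarrow>
    kron A B * kron C D = kron (A * C) (B * D :: 'a::comm_semiring_1 mat)"
  by (rule kron_mult[OF carrier_matI carrier_matI carrier_matI carrier_matI]) simp_all

text \<open>Both bracketings read the same three mixed-radix digits of an index;
  \<open>split\<close> below relates the two ways of extracting them, also when the last factor is
  empty.\<close>

lemma kron_assoc: "kron (kron A B) C = kron A (kron B (C :: 'a::comm_semiring_1 mat))"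
proof (rule eq_matI)
  fix i j assume "i < dim_row (kron A (kron B C))" "j < dim_col (kron A (kron B C))"
  then have i: "i < dim_row A * (dim_row B * dim_row C)" and j: "j < dim_col A * (dim_col B * dim_col C)"
    by auto
  then have i': "i < dim_row A * dim_row B * dim_row C" and j': "j < dim_col A * dim_col B * dim_col C"
    by (simp_all only: mult.assoc)
  have split: "p mod (q * r) div r = p div r mod q" "p mod (q * r) mod r = p mod r" "p div (q * r) = p div r div q"
    for p q r :: nat
    using mod_mult2_eq[of p r q] div_mult2_eq[of p r q] by (cases "r = 0"; simp add: mult.commute)+
  show "kron (kron A B) C $$ (i, j) = kron A (kron B C) $$ (i, j)"
    using mult_bound_split[OF i] mult_bound_split[OF j] mult_bound_split(1)[OF i'] mult_bound_split(1)[OF j'] i j i' j'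
    by (simp add: split mult.assoc)
qed (simp_all add: mult.assoc)

lemma kron_one_left [simp]: "kron (1\<^sub>m (Suc 0)) A = A"
  by (rule eq_matI) auto

lemma kron_one_right [simp]: "kron A (1\<^sub>m (Suc 0)) = (A :: 'a::comm_semiring_1 mat)"
  by (rule eq_matI) auto

lemma kron_one_one: "kron (1\<^sub>m a) (1\<^sub>m b) = (1\<^sub>m (a * b) :: 'a::comm_semiring_1 mat)"
proof (rule eq_matI)
  fix i j assume "i < dim_row (1\<^sub>m (a * b) :: 'a mat)" "j < dim_col (1\<^sub>m (a * b) :: 'a mat)"
  then have i: "i < a * b" and j: "j < a * b" by auto
  have "i = j" if "i div b = j div b" "i mod b = j mod b"
    using that div_mult_mod_eq[of i b] div_mult_mod_eq[of j b] by metis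
  then show "kron (1\<^sub>m a) (1\<^sub>m b) $$ (i, j) = (1\<^sub>m (a * b) :: 'a mat) $$ (i, j)"
    using i j mult_bound_split[OF i] mult_bound_split[OF j] by auto
qed auto

lemma mult_add_bound: "i < a \<Longrightarrow> j < b \<Longrightarrow> i * b + j < a * (b :: nat)"
  by (metis add.commute add_less_cancel_right le_less_trans less_le_trans mult.commute
      mult_Suc_right mult_le_mono2 Suc_leI order_refl)

text \<open>Meant for use with \<open>index_kron_split\<close>: once an index is presented by its
  two digits, entries of Kronecker products can be evaluated without \<open>div\<close> and
  \<open>mod\<close>.\<close>

lemma eq_mat_kronI:
  assumes "dim_row M = a * b" "dim_col M = c * d" "dim_row N = a * b" "dim_col N = c * d"
    and "\<And>i j k l. i < a \<Longrightarrow> j < b \<Longrightarrow> k < c \<Longrightarrow> l < d \<Longrightarrow>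
      M $$ (i * b + j, k * d + l) = N $$ (i * b + j, k * d + l)"
  shows "M = N"
proof (rule eq_matI)
  fix i j assume "i < dim_row N" "j < dim_col N"
  then have i: "i < a * b" and j: "j < c * d" using assms by auto
  show "M $$ (i, j) = N $$ (i, j)"
    using assms(5)[OF mult_bound_split[OF i] mult_bound_split[OF j]] by simp
qed (use assms in simp_all)

lemma index_kron_split:
  assumes "A \<in> carrier_mat a c" "B \<in> carrier_mat b d" "i < a" "j < b" "k < c" "l < d"
  shows "kron A B $$ (i * b + j, k * d + l) = A $$ (i, k) * B $$ (j, l)"
proof -
  have "(i * b + j) div b = i" "(i * b + j) mod b = j" "(k * d + l) div d = k" "(k * d + l) mod d = l"
    using assms by auto
  then show ?thesis using assms mult_add_bound[of i a j b] mult_add_bound[of k c l d] by simp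
qed

lemma kron_smult_left: "kron (c \<cdot>\<^sub>m A) B = c \<cdot>\<^sub>m kron A (B :: 'a::comm_semiring_1 mat)"
  by (rule eq_mat_kronI[of _ "dim_row A" "dim_row B" "dim_col A" "dim_col B"])
    (simp_all add: index_kron_split[OF carrier_matI carrier_matI] mult_add_bound mult.assoc)

lemma kron_smult_right: "kron A (c \<cdot>\<^sub>m B) = c \<cdot>\<^sub>m kron A (B :: 'a::comm_semiring_1 mat)"
  by (rule eq_mat_kronI[of _ "dim_row A" "dim_row B" "dim_col A" "dim_col B"])
    (simp_all add: index_kron_split[OF carrier_matI carrier_matI] mult_add_bound mult_ac)

lemma kron_add_left:
  assumes "A \<in> carrier_mat a b" "A' \<in> carrier_mat a b" "B \<in> carrier_mat c d"
  shows "kron (A + A') B = kron A B + kron A' (B :: 'a::comm_semiring_1 mat)"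
  by (rule eq_mat_kronI[of _ a c b d])
    (use assms in \<open>simp_all add: index_kron_split[of A a b B c d] index_kron_split[of A' a b B c d]
        index_kron_split[of "A + A'" a b B c d] mult_add_bound distrib_right del: index_kron\<close>)

lemma kron_add_right:
  assumes "A \<in> carrier_mat a b" "B \<in> carrier_mat c d" "B' \<in> carrier_mat c d"
  shows "kron A (B + B') = kron A B + kron A (B' :: 'a::comm_semiring_1 mat)"
  by (rule eq_mat_kronI[of _ a c b d])
    (use assms in \<open>simp_all add: index_kron_split[of A a b B c d] index_kron_split[of A a b B' c d]
        index_kron_split[of A a b "B + B'" c d] mult_add_bound distrib_left del: index_kron\<close>)

lemma kron_zero_right [simp]:
  "kron A (0\<^sub>m a b) = 0\<^sub>m (dim_row A * a) (dim_col A * b)" for A :: "'a::comm_semiring_1 mat"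
  by (rule eq_mat_kronI[of _ "dim_row A" a "dim_col A" b])
    (simp_all add: index_kron_split[OF carrier_matI carrier_matI] mult_add_bound)

lemma kron_zero_left [simp]:
  "kron (0\<^sub>m a b) B = 0\<^sub>m (a * dim_row B) (b * dim_col B)" for B :: "'a::comm_semiring_1 mat"
  by (rule eq_mat_kronI[of _ a "dim_row B" b "dim_col B"])
    (simp_all add: index_kron_split[OF carrier_matI carrier_matI] mult_add_bound)

lemma mat_adjoint_kron: "mat_adjoint (kron A B) = kron (mat_adjoint A) (mat_adjoint (B :: complex mat))"
  by (rule eq_mat_kronI[of _ "dim_col A" "dim_col B" "dim_row A" "dim_row B"])
    (simp_all add: index_kron_split[OF carrier_matI carrier_matI] mult_add_bound del: index_kron)

lemma mult_square_carrier [simp]: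
  "A \<in> carrier_mat n n \<Longrightarrow> B \<in> carrier_mat n n \<Longrightarrow> A * B \<in> carrier_mat n n"
  by simp

section \<open>Unitary matrices\<close>

lemma unitary_carrier: "unitary N U \<Longrightarrow> U \<in> carrier_mat N N"
  by (simp add: unitary_def)

lemma unitary_one: "unitary N (1\<^sub>m N)"
  by (simp add: unitary_def)

lemma unitary_mat_adjoint: "unitary N U \<Longrightarrow> unitary N (mat_adjoint U)"
  by (simp add: unitary_def)

lemma unitary_mult:
  assumes "unitary N U" "unitary N V"
  shows "unitary N (U * V)"
proof -
  have c: "U \<in> carrier_mat N N" "V \<in> carrier_mat N N" using assms by (auto simp: unitary_def)
  have "U * V * (mat_adjoint V * mat_adjoint U) = U * (V * mat_adjoint V) * mat_adjoint U"
    using c by (simp add: assoc_mult_mat[of _ N N _ N _ N])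
  moreover have "mat_adjoint V * mat_adjoint U * (U * V) = mat_adjoint V * (mat_adjoint U * U) * V"
    using c by (simp add: assoc_mult_mat[of _ N N _ N _ N])
  ultimately show ?thesis
    using assms c by (simp add: unitary_def mat_adjoint_mult[OF c])
qed

lemma unitary_kron:
  assumes "unitary M U" "unitary N V"
  shows "unitary (M * N) (kron U V)"
proof -
  have c: "U \<in> carrier_mat M M" "V \<in> carrier_mat N N" using assms by (auto simp: unitary_def)
  then show ?thesis using assms
    by (auto simp: unitary_def mat_adjoint_kron kron_mult[of _ M M _ M _ N N _ N] kron_one_one
        intro!: kron_carrier)
qed

lemma unitary_row_norm:
  assumes "unitary N U" "i < N"
  shows "(\<Sum>j<N. (cmod (U $$ (i, j)))\<^sup>2) = 1"
proof -
  have c: "U \<in> carrier_mat N N" using assms by (auto simp: unitary_def)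
  have "complex_of_real (\<Sum>j<N. (cmod (U $$ (i, j)))\<^sup>2) = (\<Sum>j<N. U $$ (i, j) * cnj (U $$ (i, j)))"
    by (simp add: complex_norm_square del: of_real_power)
  also have "\<dots> = (U * mat_adjoint U) $$ (i, i)"
    using c assms(2) by (simp add: scalar_prod_def lessThan_atLeast0)
  also have "\<dots> = 1" using assms by (simp add: unitary_def)
  finally show ?thesis using of_real_eq_1_iff by blast
qed

text \<open>The source of integrability for all second moments: the entries of the random states are
  products of such entries.\<close>

lemma unitary_entry_bound:
  assumes "unitary N U" "i < N" "j < N"
  shows "cmod (U $$ (i, j)) \<le> 1"
proof -
  have "(cmod (U $$ (i, j)))\<^sup>2 \<le> (\<Sum>j<N. (cmod (U $$ (i, j)))\<^sup>2)"
    using assms by (intro member_le_sum) auto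
  then show ?thesis using unitary_row_norm[OF assms(1,2)] by (simp add: power_le_one_iff abs_square_le_1)
qed


section \<open>Majorana operators\<close>

lemma pauli_carrier [simp]:
  "pauli_X \<in> carrier_mat 2 2" "pauli_Y \<in> carrier_mat 2 2" "pauli_Z \<in> carrier_mat 2 2"
  by (auto simp: pauli_X_def pauli_Y_def pauli_Z_def mat_of_rows_list_def)

lemma dim_pauli [simp]:
  "dim_row pauli_X = 2" "dim_col pauli_X = 2" "dim_row pauli_Y = 2" "dim_col pauli_Y = 2"
  "dim_row pauli_Z = 2" "dim_col pauli_Z = 2"
  by (auto simp: pauli_X_def pauli_Y_def pauli_Z_def mat_of_rows_list_def)

lemma eq_mat2I:
  assumes "A \<in> carrier_mat 2 2" "B \<in> carrier_mat 2 2"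
    and "A $$ (0, 0) = B $$ (0, 0)" "A $$ (0, 1) = B $$ (0, 1)"
    and "A $$ (1, 0) = B $$ (1, 0)" "A $$ (1, 1) = B $$ (1, 1)"
  shows "A = B"
  by (rule eq_matI) (use assms in \<open>auto simp: less_2_cases_iff\<close>)

lemma index_pauli:
  "pauli_X $$ (0, 0) = 0" "pauli_X $$ (0, Suc 0) = 1" "pauli_X $$ (Suc 0, 0) = 1" "pauli_X $$ (Suc 0, Suc 0) = 0"
  "pauli_Y $$ (0, 0) = 0" "pauli_Y $$ (0, Suc 0) = - \<i>" "pauli_Y $$ (Suc 0, 0) = \<i>" "pauli_Y $$ (Suc 0, Suc 0) = 0"
  "pauli_Z $$ (0, 0) = 1" "pauli_Z $$ (0, Suc 0) = 0" "pauli_Z $$ (Suc 0, 0) = 0" "pauli_Z $$ (Suc 0, Suc 0) = - 1"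
  by (auto simp: pauli_X_def pauli_Y_def pauli_Z_def mat_of_rows_list_def)

lemma sum_atLeast0_lessThan_2: "sum f {0..<2::nat} = f 0 + f (Suc 0)"
  by (simp add: numeral_2_eq_2)

lemma pauli_mult:
  "pauli_X * pauli_X = 1\<^sub>m 2" "pauli_Y * pauli_Y = 1\<^sub>m 2" "pauli_Z * pauli_Z = 1\<^sub>m 2"
  "pauli_X * pauli_Y = \<i> \<cdot>\<^sub>m pauli_Z" "pauli_Y * pauli_X = (- \<i>) \<cdot>\<^sub>m pauli_Z"
  "pauli_Y * pauli_Z = \<i> \<cdot>\<^sub>m pauli_X" "pauli_Z * pauli_Y = (- \<i>) \<cdot>\<^sub>m pauli_X"
  "pauli_Z * pauli_X = \<i> \<cdot>\<^sub>m pauli_Y" "pauli_X * pauli_Z = (- \<i>) \<cdot>\<^sub>m pauli_Y"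
  by (rule eq_mat2I; simp add: scalar_prod_def sum_atLeast0_lessThan_2 index_pauli)+

lemma mat_adjoint_pauli [simp]:
  "mat_adjoint pauli_X = pauli_X" "mat_adjoint pauli_Y = pauli_Y" "mat_adjoint pauli_Z = pauli_Z"
  by (rule eq_mat2I; simp add: index_pauli)+

lemma kron_list_Nil [simp]: "kron_list [] = 1\<^sub>m 1"
  by (simp add: kron_list_def)

lemma kron_list_Cons [simp]: "kron_list (A # As) = kron A (kron_list As)"
  by (simp add: kron_list_def)

lemma kron_list_ones: "kron_list (map (\<lambda>_. 1\<^sub>m 2) xs) = (1\<^sub>m (2 ^ length xs) :: complex mat)"
  by (induction xs) (simp_all add: kron_one_one)

lemma map_upt_Suc_shift: "map f [0..<Suc n] = f 0 # map (\<lambda>i. f (Suc i)) [0..<n]"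
  by (simp add: upt_conv_Cons map_Suc_upt[symmetric] del: upt_Suc)

text \<open>Peeling off the leftmost qubit: two Majorana operators live on it alone, and all others
  put \<open>pauli_Z\<close> on it. The algebra of Majorana operators is derived by induction along
  this recursion.\<close>

lemma majorana_Suc_0: "majorana (Suc n) 0 = kron pauli_X (1\<^sub>m (2 ^ n))"
  unfolding majorana_def map_upt_Suc_shift using kron_list_ones[of "[0..<n]"] by simp

lemma majorana_Suc_1: "majorana (Suc n) (Suc 0) = kron pauli_Y (1\<^sub>m (2 ^ n))"
  unfolding majorana_def map_upt_Suc_shift using kron_list_ones[of "[0..<n]"] by simp

lemma majorana_Suc_Suc: "majorana (Suc n) (Suc (Suc k)) = kron pauli_Z (majorana n k)"
proof -
  have "Suc i < Suc (Suc k) div 2 \<longleftrightarrow> i < k div 2" "Suc i = Suc (Suc k) div 2 \<longleftrightarrow> i = k div 2" for i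
    by auto
  then show ?thesis unfolding majorana_def map_upt_Suc_shift by (simp cong: if_cong)
qed

lemmas majorana_rec = majorana_Suc_0 majorana_Suc_1 majorana_Suc_Suc

lemma kron_carrier_2 [simp]:
  "A \<in> carrier_mat 2 2 \<Longrightarrow> B \<in> carrier_mat (2 ^ n) (2 ^ n) \<Longrightarrow> kron A B \<in> carrier_mat (2 * 2 ^ n) (2 * 2 ^ n)"
  by (rule kron_carrier)

lemma majorana_carrier [simp]: "majorana n k \<in> carrier_mat (2 ^ n) (2 ^ n)"
proof (induction n arbitrary: k)
  case 0
  then show ?case by (simp add: majorana_def)
next
  case (Suc n)
  consider "k = 0" | "k = 1" | l where "k = Suc (Suc l)" by (metis One_nat_def old.nat.exhaust)
  then show ?case
    by cases (simp_all add: majorana_rec kron_carrier_2 Suc)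
qed

lemma dim_majorana [simp]: "dim_row (majorana n k) = 2 ^ n" "dim_col (majorana n k) = 2 ^ n"
  using majorana_carrier[of n k] unfolding carrier_mat_def by blast+

lemma mat_adjoint_majorana [simp]: "mat_adjoint (majorana n k) = majorana n k"
proof (induction n arbitrary: k)
  case 0
  then show ?case by (simp add: majorana_def)
next
  case (Suc n)
  consider "k = 0" | "k = 1" | l where "k = Suc (Suc l)" by (metis One_nat_def old.nat.exhaust)
  then show ?case
    using Suc by cases (auto simp: majorana_rec mat_adjoint_kron)
qed

lemma smult_smult_mat: "a \<cdot>\<^sub>m (b \<cdot>\<^sub>m A) = (a * b) \<cdot>\<^sub>m (A :: complex mat)"
  by (rule eq_matI) auto

lemma one_smult_mat [simp]: "1 \<cdot>\<^sub>m A = (A :: complex mat)"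
  by (rule eq_matI) auto

lemma smult_mult_left: "(a \<cdot>\<^sub>m A) * B = a \<cdot>\<^sub>m (A * B)" if "dim_col A = dim_row B" for A B :: "complex mat"
  using that by (intro eq_matI) auto

lemma smult_mult_right: "A * (a \<cdot>\<^sub>m B) = a \<cdot>\<^sub>m (A * B)" if "dim_col A = dim_row B" for A B :: "complex mat"
  using that by (intro eq_matI) auto

lemma majorana_square: "k < 2 * n \<Longrightarrow> majorana n k * majorana n k = 1\<^sub>m (2 ^ n)"
proof (induction n arbitrary: k)
  case 0
  then show ?case by simp
next
  case (Suc n)
  consider "k = 0" | "k = 1" | l where "k = Suc (Suc l)" by (metis One_nat_def old.nat.exhaust)
  then show ?case
    using Suc by cases (auto simp: majorana_rec kron_mult_dim pauli_mult kron_one_one)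
qed

text \<open>If both operators lie beyond the first qubit, their two \<open>pauli_Z\<close> factors
  cancel and the induction hypothesis applies. Otherwise the sign arises on the first qubit, where
  two distinct Pauli matrices meet while the remaining factors commute.\<close>

lemma majorana_anticommute:
  "i < 2 * n \<Longrightarrow> j < 2 * n \<Longrightarrow> i \<noteq> j \<Longrightarrow>
    majorana n i * majorana n j = (- 1) \<cdot>\<^sub>m (majorana n j * majorana n i)"
proof (induction n arbitrary: i j)
  case 0
  then show ?case by simp
next
  case (Suc n)
  have c: "k = 0 \<or> k = 1 \<or> (\<exists>l. k = Suc (Suc l))" for k by (metis One_nat_def old.nat.exhaust)
  show ?case
  proof (cases "\<exists>k l. i = Suc (Suc k) \<and> j = Suc (Suc l)")
    case True
    then obtain k l where kl: "i = Suc (Suc k)" "j = Suc (Suc l)" by blast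
    then show ?thesis
      using Suc.IH[of k l] Suc.prems by (simp add: majorana_rec kron_mult_dim kron_smult_right)
  next
    case False
    then show ?thesis
      using c[of i] c[of j] Suc.prems
      by (auto simp: majorana_rec kron_mult_dim pauli_mult kron_smult_left smult_smult_mat)
  qed
qed

text \<open>The fermion parity operator. It has two uses: for two qubits it is the string that a
  Majorana operator further right draws across a gate, and for \<open>n\<close> qubits it corrects
  the sign of the unitaries implementing reflections.\<close>

definition parity :: "nat \<Rightarrow> complex mat" where
  "parity n = kron_list (map (\<lambda>_. pauli_Z) [0..<n])"

lemma parity_0 [simp]: "parity 0 = 1\<^sub>m 1"
  by (simp add: parity_def)

lemma parity_Suc [simp]: "parity (Suc n) = kron pauli_Z (parity n)"
  unfolding parity_def map_upt_Suc_shift by simp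

lemma parity_carrier [simp]: "parity n \<in> carrier_mat (2 ^ n) (2 ^ n)"
  by (induction n) auto

lemma dim_parity [simp]: "dim_row (parity n) = 2 ^ n" "dim_col (parity n) = 2 ^ n"
  using parity_carrier[of n] unfolding carrier_mat_def by blast+

lemma parity_square: "parity n * parity n = 1\<^sub>m (2 ^ n)"
  by (induction n) (auto simp: kron_mult_dim pauli_mult kron_one_one)

lemma mat_adjoint_parity [simp]: "mat_adjoint (parity n) = parity n"
  by (induction n) (auto simp: mat_adjoint_kron)

lemma parity_anticommute:
  "i < 2 * n \<Longrightarrow> parity n * majorana n i = (- 1) \<cdot>\<^sub>m (majorana n i * parity n)"
proof (induction n arbitrary: i)
  case 0
  then show ?case by simp
next
  case (Suc n)
  have "i = 0 \<or> i = 1 \<or> (\<exists>l. i = Suc (Suc l))" by (metis One_nat_def old.nat.exhaust)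
  then show ?case
    using Suc
    by (auto simp: majorana_rec kron_mult_dim pauli_mult kron_smult_left kron_smult_right smult_smult_mat)
qed

text \<open>The two-point function of the state \<open>|0...0>\<close>. Majorana operators on
  different qubits leave an off-diagonal Pauli matrix on the earlier of the two, hence expectation
  zero; on a common qubit only XY = iZ and YX = -iZ contribute besides the squares.\<close>

lemma majorana_mult_00:
  "i < 2 * n \<Longrightarrow> j < 2 * n \<Longrightarrow> (majorana n i * majorana n j) $$ (0, 0) =
     (if i = j then 1 else if i div 2 = j div 2 then (if even i then \<i> else - \<i>) else 0)"
proof (induction n arbitrary: i j)
  case 0
  then show ?case by simp
next
  case (Suc n)
  have c: "k = 0 \<or> k = 1 \<or> (\<exists>l. k = Suc (Suc l))" for k by (metis One_nat_def old.nat.exhaust)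
  \<comment> \<open>Index 0 has both digits 0, so the expectation in the product state factors over
    the first qubit and the rest.\<close>
  have p: "(kron A B * kron C D) $$ (0, 0) = (A * C) $$ (0, 0) * (B * D) $$ (0, 0)"
    if "A \<in> carrier_mat 2 2" "C \<in> carrier_mat 2 2"
      "B \<in> carrier_mat (2 ^ n) (2 ^ n)" "D \<in> carrier_mat (2 ^ n) (2 ^ n)"
    for A B C D :: "complex mat"
    using that by (subst kron_mult_dim) (auto simp: kron_def simp del: index_mult_mat(1))
  show ?case
  proof (cases "\<exists>k l. i = Suc (Suc k) \<and> j = Suc (Suc l)")
    case True
    then obtain k l where kl: "i = Suc (Suc k)" "j = Suc (Suc l)" by blast
    then show ?thesis
      using Suc.IH[of k l] Suc.prems by (simp add: p majorana_rec pauli_mult del: index_mult_mat(1))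
  next
    case False
    then show ?thesis
      using c[of i] c[of j] Suc.prems
      by (auto simp: p majorana_rec pauli_mult index_pauli simp del: index_mult_mat(1))
  qed
qed


section \<open>Light cones\<close>

text \<open>Linear combinations are built one term at a time, so that facts about generators extend
  to the span by rule induction, without indexed sums of matrices.\<close>

inductive_set mat_span :: "nat \<Rightarrow> complex mat set \<Rightarrow> complex mat set" for N S where
  zero: "0\<^sub>m N N \<in> mat_span N S"
| step: "c \<cdot>\<^sub>m A + B \<in> mat_span N S" if "A \<in> S" "B \<in> mat_span N S"

lemma mat_span_carrier:
  assumes "A \<in> mat_span N S" "S \<subseteq> carrier_mat N N"
  shows "A \<in> carrier_mat N N"
  using assms by (induction) auto

lemma mat_span_linear_image:
  assumes "A \<in> mat_span N S" "S \<subseteq> carrier_mat N N" "f (0\<^sub>m N N) \<in> mat_span M T"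
    and "\<And>c A B. A \<in> S \<Longrightarrow> B \<in> carrier_mat N N \<Longrightarrow> f B \<in> mat_span M T \<Longrightarrow> f (c \<cdot>\<^sub>m A + B) \<in> mat_span M T"
  shows "f A \<in> mat_span M T"
  using assms(1)
proof induction
  case (step A B c)
  then show ?case using assms(4)[of A B c] mat_span_carrier[OF _ assms(2)] by blast
qed (use assms in auto)

lemma mat_span_add:
  assumes "A \<in> mat_span N S" "B \<in> mat_span N S" "S \<subseteq> carrier_mat N N"
  shows "A + B \<in> mat_span N S"
  using assms(1)
proof induction
  case zero
  then show ?case using assms mat_span_carrier[OF assms(2,3)] by simp
next
  case (step A C c)
  have "c \<cdot>\<^sub>m A + C + B = c \<cdot>\<^sub>m A + (C + B)"
    using step assms mat_span_carrier[OF _ assms(3)] by (intro assoc_add_mat[of _ N N]) auto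
  then show ?case using mat_span.step[OF step(1,3)] by simp
qed

lemma mat_span_smult:
  assumes "A \<in> mat_span N S" "S \<subseteq> carrier_mat N N"
  shows "a \<cdot>\<^sub>m A \<in> mat_span N S"
  using assms(1)
proof induction
  case zero
  then show ?case by (simp add: mat_span.zero)
next
  case (step A C c)
  have "a \<cdot>\<^sub>m (c \<cdot>\<^sub>m A + C) = (a * c) \<cdot>\<^sub>m A + a \<cdot>\<^sub>m C"
    using step assms mat_span_carrier[OF _ assms(2)]
    by (subst add_smult_distrib_left_mat[of _ N N]) (auto simp: smult_smult_mat)
  then show ?case using mat_span.step[OF step(1,3)] by simp
qed

lemma mat_span_base:
  assumes "A \<in> S" "S \<subseteq> carrier_mat N N"
  shows "A \<in> mat_span N S"
proof -
  have "A = 1 \<cdot>\<^sub>m A + 0\<^sub>m N N" using assms by auto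
  then show ?thesis using mat_span.step[OF assms(1) mat_span.zero] by metis
qed

text \<open>Applied with \<open>f\<close> a conjugation or a Kronecker product with a fixed factor,
  the operations from which the Heisenberg evolution through a layer is composed.\<close>

lemma mat_span_linear:
  assumes A: "A \<in> mat_span N S" and S: "S \<subseteq> carrier_mat N N" and T: "T \<subseteq> carrier_mat M M"
    and f0: "f (0\<^sub>m N N) = 0\<^sub>m M M"
    and f: "\<And>c A B. A \<in> carrier_mat N N \<Longrightarrow> B \<in> carrier_mat N N \<Longrightarrow> f (c \<cdot>\<^sub>m A + B) = c \<cdot>\<^sub>m f A + f B"
    and ST: "\<And>A. A \<in> S \<Longrightarrow> f A \<in> mat_span M T"
  shows "f A \<in> mat_span M T"
  using A S
proof (rule mat_span_linear_image)
  show "f (0\<^sub>m N N) \<in> mat_span M T" unfolding f0 by (rule mat_span.zero)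
  show "f (c \<cdot>\<^sub>m A + B) \<in> mat_span M T" if "A \<in> S" "B \<in> carrier_mat N N" "f B \<in> mat_span M T" for c A B
    using that S T ST by (subst f) (auto intro!: mat_span_add mat_span_smult)
qed

lemma mat_span_conj:
  assumes A: "A \<in> mat_span N S" and S: "S \<subseteq> carrier_mat N N" and T: "T \<subseteq> carrier_mat N N"
    and V: "V \<in> carrier_mat N N" and W: "W \<in> carrier_mat N N"
    and ST: "\<And>A. A \<in> S \<Longrightarrow> V * A * W \<in> mat_span N T"
  shows "V * A * W \<in> mat_span N T"
proof (rule mat_span_linear[where f = "\<lambda>A. V * A * W", OF A S T])
  fix c :: complex and A B :: "complex mat" assume AB: "A \<in> carrier_mat N N" "B \<in> carrier_mat N N"
  then show "V * (c \<cdot>\<^sub>m A + B) * W = c \<cdot>\<^sub>m (V * A * W) + V * B * W"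
    using V W by (simp add: mult_add_distrib_mat[of _ N N _ N] add_mult_distrib_mat[of _ N N _ _ N]
        smult_mult_right smult_mult_left)
qed (use V W ST in auto)

lemma mat_span_kron_left:
  assumes A: "A \<in> mat_span N S" and S: "S \<subseteq> carrier_mat N N" and T: "T \<subseteq> carrier_mat (M * N) (M * N)"
    and K: "K \<in> carrier_mat M M"
    and ST: "\<And>A. A \<in> S \<Longrightarrow> kron K A \<in> mat_span (M * N) T"
  shows "kron K A \<in> mat_span (M * N) T"
proof (rule mat_span_linear[where f = "\<lambda>A. kron K A", OF A S T])
  fix c :: complex and A B :: "complex mat" assume AB: "A \<in> carrier_mat N N" "B \<in> carrier_mat N N"
  then show "kron K (c \<cdot>\<^sub>m A + B) = c \<cdot>\<^sub>m kron K A + kron K B"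
    using K by (simp add: kron_add_right[of _ M M _ N N] kron_smult_right)
qed (use K ST in auto)

lemma mat_span_kron_right:
  assumes A: "A \<in> mat_span N S" and S: "S \<subseteq> carrier_mat N N" and T: "T \<subseteq> carrier_mat (N * M) (N * M)"
    and K: "K \<in> carrier_mat M M"
    and ST: "\<And>A. A \<in> S \<Longrightarrow> kron A K \<in> mat_span (N * M) T"
  shows "kron A K \<in> mat_span (N * M) T"
proof (rule mat_span_linear[where f = "\<lambda>A. kron A K", OF A S T])
  fix c :: complex and A B :: "complex mat" assume AB: "A \<in> carrier_mat N N" "B \<in> carrier_mat N N"
  then show "kron (c \<cdot>\<^sub>m A + B) K = c \<cdot>\<^sub>m kron A K + kron B K"
    using K by (simp add: kron_add_left[of _ N N _ _ M M] kron_smult_left)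
qed (use K ST in auto)

lemma mat_span_mono:
  assumes "A \<in> mat_span N S" "S \<subseteq> T"
  shows "A \<in> mat_span N T"
  using assms(1) by induction (use assms(2) in \<open>auto intro: mat_span.intros\<close>)

text \<open>Heisenberg order: the left factor, which acts last on states, acts first on
  observables.\<close>

lemma conj_mult:
  fixes A B C :: "complex mat"
  assumes "A \<in> carrier_mat N N" "B \<in> carrier_mat N N" "C \<in> carrier_mat N N"
  shows "mat_adjoint (A * B) * C * (A * B) = mat_adjoint B * (mat_adjoint A * C * A) * B"
  using assms by (simp add: mat_adjoint_mult[of _ N N _ N] assoc_mult_mat[of _ N N _ N _ N])

subsection \<open>Two-qubit matchgates\<close>

lemma involution_pow:
  fixes W :: "complex mat"
  assumes "W \<in> carrier_mat N N" "W * W = 1\<^sub>m N"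
  shows "(z \<cdot>\<^sub>m W) ^\<^sub>m k = z ^ k \<cdot>\<^sub>m (if even k then 1\<^sub>m N else W)"
proof (induction k)
  case 0
  then show ?case using assms by simp
next
  case (Suc k)
  then show ?case using assms
    by (auto simp: smult_mult_left smult_mult_right smult_smult_mat mult.commute)
qed

text \<open>Euler's formula for an involution: even powers of \<open>W\<close> are the identity and
  odd ones are \<open>W\<close>, so the exponential series separates into cosine and sine.\<close>

lemma mat_exp_involution:
  assumes W: "W \<in> carrier_mat N N" "W * W = 1\<^sub>m N"
  shows "mat_exp ((\<i> * complex_of_real \<theta>) \<cdot>\<^sub>m W) =
    complex_of_real (cos \<theta>) \<cdot>\<^sub>m 1\<^sub>m N + (\<i> * complex_of_real (sin \<theta>)) \<cdot>\<^sub>m W"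
proof (rule eq_matI)
  fix i j
  assume "i < dim_row (complex_of_real (cos \<theta>) \<cdot>\<^sub>m 1\<^sub>m N + (\<i> * complex_of_real (sin \<theta>)) \<cdot>\<^sub>m W)"
    and "j < dim_col (complex_of_real (cos \<theta>) \<cdot>\<^sub>m 1\<^sub>m N + (\<i> * complex_of_real (sin \<theta>)) \<cdot>\<^sub>m W)"
  then have ij: "i < N" "j < N" using W by auto
  define z where "z = \<i> * complex_of_real \<theta>"
  define a where "a = (1\<^sub>m N :: complex mat) $$ (i, j)"
  define b where "b = W $$ (i, j)"
  \<comment> \<open>Averaging the series of \<open>exp z\<close> and \<open>exp (- z)\<close> with
    these weights gives the coefficient \<open>a\<close> for even and \<open>b\<close> for odd
    powers, which are the entries of the identity and of \<open>W\<close>. Only scalar series are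
    needed this way.\<close>
  have "(\<lambda>k. (a + b) / 2 * (z ^ k /\<^sub>R fact k) + (a - b) / 2 * ((- z) ^ k /\<^sub>R fact k)) sums
      ((a + b) / 2 * exp z + (a - b) / 2 * exp (- z))"
    by (intro sums_add sums_mult exp_converges)
  moreover have "(a + b) / 2 * (z ^ k /\<^sub>R fact k) + (a - b) / 2 * ((- z) ^ k /\<^sub>R fact k) =
      ((z \<cdot>\<^sub>m W) ^\<^sub>m k) $$ (i, j) / fact k" for k
    using ij W unfolding involution_pow[OF W] a_def b_def
    by (auto simp: scaleR_conv_of_real divide_simps power_minus_odd, (simp add: algebra_simps)+)
  ultimately have "(\<lambda>k. ((z \<cdot>\<^sub>m W) ^\<^sub>m k) $$ (i, j) / fact k) sums
      ((a + b) / 2 * exp z + (a - b) / 2 * exp (- z))"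
    by simp
  then have "mat_exp (z \<cdot>\<^sub>m W) $$ (i, j) = (a + b) / 2 * exp z + (a - b) / 2 * exp (- z)"
    using ij W by (simp add: mat_exp_def sums_iff)
  also have "exp z = cos \<theta> + \<i> * sin \<theta>"
    unfolding z_def by (simp add: cis_conv_exp[symmetric] cis.code complex_eq_iff)
  also have "exp (- z) = cos \<theta> - \<i> * sin \<theta>"
    using cis_conv_exp[of "- \<theta>"] unfolding z_def by (simp add: cis.code complex_eq_iff)
  also have "(a + b) / 2 * (cos \<theta> + \<i> * sin \<theta>) + (a - b) / 2 * (cos \<theta> - \<i> * sin \<theta>) =
      cos \<theta> * a + \<i> * sin \<theta> * b"
    by (simp add: field_simps)
  finally show "mat_exp ((\<i> * complex_of_real \<theta>) \<cdot>\<^sub>m W) $$ (i, j) =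
      (complex_of_real (cos \<theta>) \<cdot>\<^sub>m 1\<^sub>m N + (\<i> * complex_of_real (sin \<theta>)) \<cdot>\<^sub>m W) $$ (i, j)"
    using ij W unfolding z_def a_def b_def by simp
qed (use W in \<open>auto simp: mat_exp_def\<close>)

lemma rotation_mult:
  fixes W :: "complex mat"
  assumes W: "W \<in> carrier_mat N N" "W * W = 1\<^sub>m N"
  shows "(a \<cdot>\<^sub>m 1\<^sub>m N + b \<cdot>\<^sub>m W) * (c \<cdot>\<^sub>m 1\<^sub>m N + d \<cdot>\<^sub>m W) = (a * c + b * d) \<cdot>\<^sub>m 1\<^sub>m N + (a * d + b * c) \<cdot>\<^sub>m W"
proof -
  have "(a \<cdot>\<^sub>m 1\<^sub>m N + b \<cdot>\<^sub>m W) * (c \<cdot>\<^sub>m 1\<^sub>m N + d \<cdot>\<^sub>m W) =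
    ((c * a) \<cdot>\<^sub>m 1\<^sub>m N + (c * b) \<cdot>\<^sub>m W) + ((d * a) \<cdot>\<^sub>m W + (d * b) \<cdot>\<^sub>m 1\<^sub>m N)"
    using W by (simp add: mult_add_distrib_mat[of _ N N _ N] add_mult_distrib_mat[of _ N N _ _ N]
        smult_mult_left smult_mult_right smult_smult_mat add_smult_distrib_left_mat[of _ N N])
  also have "\<dots> = (a * c + b * d) \<cdot>\<^sub>m 1\<^sub>m N + (a * d + b * c) \<cdot>\<^sub>m W"
    using W by (intro eq_matI) (auto simp: algebra_simps)
  finally show ?thesis .
qed

text \<open>An operator commuting with \<open>W\<close> commutes with \<open>V\<close>. If
  \<open>B\<close> anticommutes with \<open>W\<close>, moving \<open>B\<close> past the adjoint of
  \<open>V\<close> turns that adjoint into \<open>V\<close>, so the conjugate is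
  \<open>B * (V * V)\<close>, and \<open>V * V\<close> again lies in the span of the identity and
  \<open>W\<close>.\<close>

lemma rotation_conj:
  fixes W B :: "complex mat" and \<theta> :: real
  assumes W: "W \<in> carrier_mat N N" "W * W = 1\<^sub>m N" "mat_adjoint W = W"
  defines "V \<equiv> complex_of_real (cos \<theta>) \<cdot>\<^sub>m 1\<^sub>m N + (\<i> * complex_of_real (sin \<theta>)) \<cdot>\<^sub>m W"
  shows "unitary N V"
    and "B \<in> carrier_mat N N \<Longrightarrow> B * W = W * B \<Longrightarrow> mat_adjoint V * B * V = B"
    and "B \<in> carrier_mat N N \<Longrightarrow> B * W = (- 1) \<cdot>\<^sub>m (W * B) \<Longrightarrow>
      \<exists>a b. mat_adjoint V * B * V = a \<cdot>\<^sub>m B + b \<cdot>\<^sub>m (B * W)"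
proof -
  have V: "V \<in> carrier_mat N N" using W by (auto simp: V_def)
  have adj: "mat_adjoint V = complex_of_real (cos \<theta>) \<cdot>\<^sub>m 1\<^sub>m N + (- \<i> * complex_of_real (sin \<theta>)) \<cdot>\<^sub>m W"
    unfolding V_def using W by (simp add: mat_adjoint_add[of _ N N] mat_adjoint_smult)
  have cs: "complex_of_real (cos \<theta>) * cos \<theta> + complex_of_real (sin \<theta>) * sin \<theta> = 1"
    using sin_cos_squared_add3[of \<theta>] by (metis of_real_1 of_real_add of_real_mult)
  have z: "1 \<cdot>\<^sub>m 1\<^sub>m N + 0 \<cdot>\<^sub>m W = 1\<^sub>m N" using W by (intro eq_matI) auto
  have VV: "V * mat_adjoint V = 1\<^sub>m N" "mat_adjoint V * V = 1\<^sub>m N"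
    unfolding adj unfolding V_def rotation_mult[OF W(1,2)]
    using cs z by (simp_all add: mult.commute mult.left_commute)
  then show u: "unitary N V" using V by (simp add: unitary_def)
  show "mat_adjoint V * B * V = B" if B: "B \<in> carrier_mat N N" "B * W = W * B"
  proof -
    have "V * B = B * V" unfolding V_def using B W
      by (simp add: mult_add_distrib_mat[of _ N N _ N] add_mult_distrib_mat[of _ N N _ _ N]
          smult_mult_left smult_mult_right)
    then have "mat_adjoint V * B * V = mat_adjoint V * V * B"
      using V B by (simp add: assoc_mult_mat[of _ N N _ N _ N])
    then show ?thesis using VV B by simp
  qed
  show "\<exists>a b. mat_adjoint V * B * V = a \<cdot>\<^sub>m B + b \<cdot>\<^sub>m (B * W)"
    if B: "B \<in> carrier_mat N N" "B * W = (- 1) \<cdot>\<^sub>m (W * B)"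
  proof -
    have "mat_adjoint V * B = B * V" unfolding adj unfolding V_def using B W
      by (simp add: mult_add_distrib_mat[of _ N N _ N] add_mult_distrib_mat[of _ N N _ _ N]
          smult_mult_left smult_mult_right smult_smult_mat)
    then have "mat_adjoint V * B * V = B * (V * V)"
      using V B by (simp add: assoc_mult_mat[of _ N N _ N _ N])
    moreover obtain a b where "V * V = a \<cdot>\<^sub>m 1\<^sub>m N + b \<cdot>\<^sub>m W"
      unfolding V_def rotation_mult[OF W(1,2)] by blast
    ultimately have "mat_adjoint V * B * V = a \<cdot>\<^sub>m B + b \<cdot>\<^sub>m (B * W)"
      using B W by (simp add: mult_add_distrib_mat[of _ N N _ N] smult_mult_right)
    then show ?thesis by blast
  qed
qed


lemma on_qubit_2:
  assumes "P \<in> carrier_mat 2 2"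
  shows "on_qubit 2 0 P = kron P (1\<^sub>m 2)" "on_qubit 2 (Suc 0) P = kron (1\<^sub>m 2) P"
  using assms by (simp_all add: on_qubit_def numeral_2_eq_2)

lemma majorana_2:
  "majorana 2 0 = kron pauli_X (1\<^sub>m 2)" "majorana 2 (Suc 0) = kron pauli_Y (1\<^sub>m 2)"
  "majorana 2 2 = kron pauli_Z pauli_X" "majorana 2 3 = kron pauli_Z pauli_Y"
  by (simp_all add: numeral_2_eq_2 numeral_3_eq_3 majorana_rec)

lemma kron_carrier_4 [simp]:
  "A \<in> carrier_mat 2 2 \<Longrightarrow> B \<in> carrier_mat 2 2 \<Longrightarrow> kron A B \<in> carrier_mat 4 4"
  using kron_carrier[of A 2 2 B 2 2] by simp

lemma majorana_2_carrier [simp]: "majorana 2 k \<in> carrier_mat 4 4"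
  using majorana_carrier[of 2 k] by simp

lemma less_4_cases: "k < 4 \<Longrightarrow> k = 0 \<or> k = Suc 0 \<or> k = 2 \<or> k = (3::nat)"
  by auto

text \<open>The bound on \<open>j\<close> is essential: for larger indices the formula for
  \<open>majorana n j\<close> degenerates to the parity operator.\<close>

definition majoranas :: "nat \<Rightarrow> nat set \<Rightarrow> complex mat set" where
  "majoranas n J = majorana n ` {j \<in> J. j < 2 * n}"

lemma majoranas_carrier: "majoranas n J \<subseteq> carrier_mat (2 ^ n) (2 ^ n)"
  by (auto simp: majoranas_def)

lemma majoranas_2_carrier: "majoranas 2 J \<subseteq> carrier_mat 4 4"
  by (auto simp: majoranas_def)

lemma majoranas_2I: "A \<in> {majorana 2 0, majorana 2 (Suc 0), majorana 2 2, majorana 2 3} \<Longrightarrow> A \<in> majoranas 2 UNIV"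
  by (auto simp: majoranas_def)

text \<open>The properties of a gate on which the light cone rests. The clause on
  \<open>parity 2\<close> concerns Majorana operators to the right of the gate, whose string crosses
  it. It allows a scalar because an X gate changes the sign of the parity.\<close>

definition two_qubit_gaussian :: "complex mat \<Rightarrow> bool" where
  "two_qubit_gaussian G \<longleftrightarrow> unitary 4 G \<and> (\<exists>c. mat_adjoint G * parity 2 * G = c \<cdot>\<^sub>m parity 2) \<and>
     (\<forall>k<4. mat_adjoint G * majorana 2 k * G \<in> mat_span 4 (majoranas 2 UNIV))"

lemma parity_2: "parity 2 = kron pauli_Z pauli_Z"
  by (simp add: parity_def numeral_2_eq_2)

lemma two_qubit_gaussian_one: "two_qubit_gaussian (1\<^sub>m 4)"
proof -
  have "mat_adjoint (1\<^sub>m 4) * parity 2 * 1\<^sub>m 4 = 1 \<cdot>\<^sub>m parity 2" by (simp add: parity_2)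
  then show ?thesis
    using less_4_cases
    by (auto simp: two_qubit_gaussian_def unitary_one right_mult_one_mat[of _ 4 4] left_mult_one_mat[of _ 4 4]
        simp del: one_smult_mat intro!: mat_span_base majoranas_2_carrier majoranas_2I)
qed

lemma two_qubit_gaussian_mult:
  assumes A: "two_qubit_gaussian A" and B: "two_qubit_gaussian B"
  shows "two_qubit_gaussian (A * B)"
proof -
  have c: "A \<in> carrier_mat 4 4" "B \<in> carrier_mat 4 4" "parity 2 \<in> carrier_mat 4 4"
    using assms by (auto simp: two_qubit_gaussian_def unitary_def parity_2)
  obtain a b where ab: "mat_adjoint A * parity 2 * A = a \<cdot>\<^sub>m parity 2"
    "mat_adjoint B * parity 2 * B = b \<cdot>\<^sub>m parity 2"
    using assms unfolding two_qubit_gaussian_def by blast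
  have "mat_adjoint (A * B) * parity 2 * (A * B) = (a * b) \<cdot>\<^sub>m parity 2"
    using ab(2) c by (simp add: conj_mult[of _ 4] ab(1) smult_mult_left smult_mult_right smult_smult_mat)
  moreover have "mat_adjoint (A * B) * majorana 2 k * (A * B) \<in> mat_span 4 (majoranas 2 UNIV)" if "k < 4" for k
    unfolding conj_mult[OF c(1,2) majorana_2_carrier]
  proof (rule mat_span_conj[OF _ majoranas_2_carrier majoranas_2_carrier])
    show "mat_adjoint A * majorana 2 k * A \<in> mat_span 4 (majoranas 2 UNIV)"
      using A that by (auto simp: two_qubit_gaussian_def)
    show "mat_adjoint B * C * B \<in> mat_span 4 (majoranas 2 UNIV)" if "C \<in> majoranas 2 UNIV" for C
      using B that by (auto simp: two_qubit_gaussian_def majoranas_def)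
  qed (use c in auto)
  ultimately show ?thesis using assms by (auto simp: two_qubit_gaussian_def intro: unitary_mult)
qed

text \<open>The generator \<open>W\<close> commutes with the parity and is, up to a phase, a product
  of two Majorana operators. The other two commute with \<open>W\<close>; each of its own two
  factors anticommutes with \<open>W\<close> and is sent by it to a multiple of the other
  factor.\<close>

lemma two_qubit_gaussian_rotation:
  assumes PQ: "P \<in> {pauli_X, pauli_Y}" "Q \<in> {pauli_X, pauli_Y}"
  shows "two_qubit_gaussian (mat_exp ((\<i> * complex_of_real \<theta>) \<cdot>\<^sub>m (on_qubit 2 0 P * on_qubit 2 (Suc 0) Q)))"
proof -
  define W where "W = kron P Q"
  have c: "P \<in> carrier_mat 2 2" "Q \<in> carrier_mat 2 2" using PQ by auto
  have W: "W \<in> carrier_mat 4 4" "W * W = 1\<^sub>m 4" "mat_adjoint W = W"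
    using PQ c by (auto simp: W_def kron_mult_dim pauli_mult kron_one_one mat_adjoint_kron)
  have "on_qubit 2 0 P * on_qubit 2 (Suc 0) Q = W"
    using c by (simp add: on_qubit_2 W_def kron_mult_dim)
  then have V: "mat_exp ((\<i> * complex_of_real \<theta>) \<cdot>\<^sub>m (on_qubit 2 0 P * on_qubit 2 (Suc 0) Q)) =
      complex_of_real (cos \<theta>) \<cdot>\<^sub>m 1\<^sub>m 4 + (\<i> * complex_of_real (sin \<theta>)) \<cdot>\<^sub>m W" (is "_ = ?V")
    by (simp add: mat_exp_involution[OF W(1,2)])
  note simps = kron_mult_dim pauli_mult kron_smult_left kron_smult_right smult_smult_mat
  have "mat_adjoint ?V * parity 2 * ?V = 1 \<cdot>\<^sub>m parity 2"
    using PQ unfolding one_smult_mat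
    by (intro rotation_conj(2)[OF W]) (auto simp: parity_2 W_def simps)
  moreover have "mat_adjoint ?V * majorana 2 k * ?V \<in> mat_span 4 (majoranas 2 UNIV)" if k: "k < 4" for k
  proof -
    have base: "majorana 2 k \<in> mat_span 4 (majoranas 2 UNIV)" if "k < 4" for k
      using less_4_cases[OF that] by (intro mat_span_base majoranas_2_carrier majoranas_2I) auto
    have "majorana 2 k * W = W * majorana 2 k \<or> majorana 2 k * W = (- 1) \<cdot>\<^sub>m (W * majorana 2 k) \<and>
        (\<exists>c l. l < 4 \<and> majorana 2 k * W = c \<cdot>\<^sub>m majorana 2 l)"
    proof -
      \<comment> \<open>Supplies the witnesses in the form which the Pauli multiplication table
        produces, a scalar times an explicit Kronecker product.\<close>
      have ex: "\<exists>c l. l < 4 \<and> c' \<cdot>\<^sub>m majorana 2 l' = c \<cdot>\<^sub>m majorana 2 l" if "l' < 4" for c' and l' :: nat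
        using that by blast
      show ?thesis
        using less_4_cases[OF k] PQ
          ex[of 0, unfolded majorana_2] ex[of "Suc 0", unfolded majorana_2]
          ex[of 2, unfolded majorana_2] ex[of 3, unfolded majorana_2]
        by (elim disjE insertE emptyE) (simp_all add: W_def majorana_2 simps)
    qed
    then show ?thesis
    proof (elim disjE conjE exE)
      assume "majorana 2 k * W = W * majorana 2 k"
      then show ?thesis using rotation_conj(2)[OF W, of "majorana 2 k" \<theta>] base[OF k] by simp
    next
      fix c l assume anti: "majorana 2 k * W = (- 1) \<cdot>\<^sub>m (W * majorana 2 k)"
        and l: "l < 4" "majorana 2 k * W = c \<cdot>\<^sub>m majorana 2 l"
      obtain a b where "mat_adjoint ?V * majorana 2 k * ?V = a \<cdot>\<^sub>m majorana 2 k + b \<cdot>\<^sub>m (majorana 2 k * W)"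
        using rotation_conj(3)[OF W majorana_2_carrier anti] by blast
      then show ?thesis
        unfolding l(2) using base[OF k] base[OF l(1)]
        by (auto intro!: mat_span_add mat_span_smult majoranas_2_carrier)
    qed
  qed
  ultimately show ?thesis
    unfolding V two_qubit_gaussian_def using rotation_conj(1)[OF W] by blast
qed

lemma two_qubit_gaussian_flip:
  assumes j: "j < 2"
  shows "two_qubit_gaussian (on_qubit 2 j pauli_X)"
proof -
  define F where "F = on_qubit 2 j pauli_X"
  have F: "F = kron pauli_X (1\<^sub>m 2) \<or> F = kron (1\<^sub>m 2) pauli_X"
    using j by (auto simp: less_2_cases_iff F_def on_qubit_2)
  note simps = kron_mult_dim pauli_mult kron_smult_left kron_smult_right smult_smult_mat mat_adjoint_kron smult_mult_left
  have "unitary 4 F" using F by (auto simp: unitary_def simps kron_one_one)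
  moreover have "mat_adjoint F * parity 2 * F = (- 1) \<cdot>\<^sub>m parity 2"
    using F by (auto simp: simps parity_2)
  moreover have "mat_adjoint F * majorana 2 k * F \<in> mat_span 4 (majoranas 2 UNIV)" if "k < 4" for k
  proof -
    have "mat_adjoint F * majorana 2 k * F = 1 \<cdot>\<^sub>m majorana 2 k \<or> mat_adjoint F * majorana 2 k * F = (- 1) \<cdot>\<^sub>m majorana 2 k"
      using less_4_cases[OF that] F by (elim disjE) (simp_all add: simps majorana_2)
    then obtain c where "mat_adjoint F * majorana 2 k * F = c \<cdot>\<^sub>m majorana 2 k" by blast
    moreover have "majorana 2 k \<in> majoranas 2 UNIV" using that by (auto simp: majoranas_def)
    ultimately show ?thesis by (metis mat_span_smult mat_span_base majoranas_2_carrier)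
  qed
  ultimately show ?thesis unfolding two_qubit_gaussian_def F_def by blast
qed

lemma matchgate_group_2: "G \<in> matchgate_group 2 \<Longrightarrow> two_qubit_gaussian G"
proof (induction rule: matchgate_group.induct)
  case one
  then show ?case using two_qubit_gaussian_one by simp
next
  case (rotation \<theta> U j P Q)
  then have "j = 0" by simp
  then show ?case using rotation two_qubit_gaussian_rotation two_qubit_gaussian_mult by simp
next
  case (flip U j)
  then show ?case using two_qubit_gaussian_flip two_qubit_gaussian_mult by simp
qed

subsection \<open>Layers and circuits\<close>

text \<open>Distance is measured between qubits, not between Majorana indices. It is written with
  two additions because subtraction on naturals truncates.\<close>

definition near :: "nat \<Rightarrow> nat \<Rightarrow> nat set" where
  "near k d = {j. j div 2 \<le> k div 2 + d \<and> k div 2 \<le> j div 2 + d}"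

lemma kron_conj:
  fixes A B K L :: "complex mat"
  assumes "A \<in> carrier_mat M M" "K \<in> carrier_mat M M" "B \<in> carrier_mat N N" "L \<in> carrier_mat N N"
  shows "mat_adjoint (kron K L) * kron A B * kron K L = kron (mat_adjoint K * A * K) (mat_adjoint L * B * L)"
  using assms by (simp add: mat_adjoint_kron kron_mult_dim)

lemma majorana_add_2_shift: "majorana (n + 2) (k + 4) = kron (parity 2) (majorana n k)"
proof -
  have "majorana (Suc (Suc n)) (Suc (Suc (Suc (Suc k)))) = kron pauli_Z (kron pauli_Z (majorana n k))"
    by (simp only: majorana_Suc_Suc)
  then show ?thesis by (simp add: parity_2 kron_assoc numeral_Bit0)
qed

lemma majorana_add_2: "k < 4 \<Longrightarrow> majorana (n + 2) k = kron (majorana 2 k) (1\<^sub>m (2 ^ n))"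
proof -
  have *: "majorana (Suc (Suc n)) 2 = kron pauli_Z (kron pauli_X (1\<^sub>m (2 ^ n)))"
    "majorana (Suc (Suc n)) 3 = kron pauli_Z (kron pauli_Y (1\<^sub>m (2 ^ n)))"
    by (simp_all only: numeral_2_eq_2 numeral_3_eq_3 majorana_rec)
  assume "k < 4"
  then show ?thesis
    using less_4_cases[of k] kron_one_one[of 2 "2 ^ n", where 'a = complex]
    by (auto simp: majorana_2 majorana_rec kron_assoc *)
qed

text \<open>The layer is peeled from the left. A Majorana operator on the leading block stays in
  that block, hence within one qubit of its position. One further right is a string on the block
  tensored with a Majorana operator of the rest: the block multiplies the string by a scalar, and
  the induction hypothesis treats the other factor.\<close>

lemma matchgate_layer_local:
  assumes "matchgate_layer n L"
  shows "unitary (2 ^ n) L \<and>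
    (\<forall>k<2 * n. mat_adjoint L * majorana n k * L \<in> mat_span (2 ^ n) (majoranas n (near k 1)))"
  using assms
proof induction
  case empty
  then show ?case by (auto simp: unitary_def)
next
  case (idle n L)
  have L: "L \<in> carrier_mat (2 ^ n) (2 ^ n)" using idle by (auto simp: unitary_def)
  have "mat_adjoint (kron (1\<^sub>m 2) L) * majorana (Suc n) k * kron (1\<^sub>m 2) L
      \<in> mat_span (2 * 2 ^ n) (majoranas (Suc n) (near k 1))" if k: "k < 2 * Suc n" for k
  proof -
    have LL: "mat_adjoint L * L = 1\<^sub>m (2 ^ n)" using idle by (auto simp: unitary_def)
    consider "k = 0" | "k = 1" | l where "k = Suc (Suc l)" by (metis One_nat_def old.nat.exhaust)
    then show ?thesis
    proof cases
      case 1
      have "majorana (Suc n) k \<in> majoranas (Suc n) (near k 1)"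
        using k by (auto simp: majoranas_def near_def)
      then have "majorana (Suc n) k \<in> mat_span (2 * 2 ^ n) (majoranas (Suc n) (near k 1))"
        using mat_span_base[OF _ majoranas_carrier[of "Suc n"]] by simp
      then show ?thesis
        using L LL 1 by (simp add: majorana_rec kron_conj[of _ 2 _ _ "2 ^ n"])
    next
      case 2
      have "majorana (Suc n) k \<in> majoranas (Suc n) (near k 1)"
        using k by (auto simp: majoranas_def near_def)
      then have "majorana (Suc n) k \<in> mat_span (2 * 2 ^ n) (majoranas (Suc n) (near k 1))"
        using mat_span_base[OF _ majoranas_carrier[of "Suc n"]] by simp
      then show ?thesis
        using L LL 2 by (simp add: majorana_rec kron_conj[of _ 2 _ _ "2 ^ n"])
    next
      case (3 l)
      have "kron pauli_Z (mat_adjoint L * majorana n l * L) \<in> mat_span (2 * 2 ^ n) (majoranas (Suc n) (near k 1))"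
      proof (rule mat_span_kron_left[OF _ majoranas_carrier])
        show "mat_adjoint L * majorana n l * L \<in> mat_span (2 ^ n) (majoranas n (near l 1))"
          using idle k 3 by simp
        show "majoranas (Suc n) (near k 1) \<subseteq> carrier_mat (2 * 2 ^ n) (2 * 2 ^ n)"
          using majoranas_carrier[of "Suc n"] by simp
        fix A assume "A \<in> majoranas n (near l 1)"
        then obtain j where j: "A = majorana n j" "j \<in> near l 1" "j < 2 * n" by (auto simp: majoranas_def)
        then have "kron pauli_Z A = majorana (Suc n) (Suc (Suc j))" "Suc (Suc j) \<in> near k 1" "Suc (Suc j) < 2 * Suc n"
          using 3 by (auto simp: majorana_rec near_def)
        then have "kron pauli_Z A \<in> majoranas (Suc n) (near k 1)" unfolding majoranas_def by blast
        then show "kron pauli_Z A \<in> mat_span (2 * 2 ^ n) (majoranas (Suc n) (near k 1))"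
          using mat_span_base[OF _ majoranas_carrier[of "Suc n"]] by simp
      qed simp
      then show ?thesis
        using L 3 by (simp add: majorana_rec kron_conj[of _ 2 _ _ "2 ^ n"])
    qed
  qed
  then show ?case using idle unitary_kron[OF unitary_one[of 2], of "2 ^ n" L] by simp
next
  case (gate G n L)
  have L: "L \<in> carrier_mat (2 ^ n) (2 ^ n)" "mat_adjoint L * L = 1\<^sub>m (2 ^ n)" using gate by (auto simp: unitary_def)
  have gG: "two_qubit_gaussian G" using gate matchgate_group_2 by blast
  have G: "G \<in> carrier_mat 4 4" "unitary 4 G" using gG by (auto simp: two_qubit_gaussian_def unitary_def)
  have carr: "majoranas (n + 2) J \<subseteq> carrier_mat (4 * 2 ^ n) (4 * 2 ^ n)" for J
    using majoranas_carrier[of "n + 2" J] by (simp add: power_add)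
  have "mat_adjoint (kron G L) * majorana (n + 2) k * kron G L
      \<in> mat_span (4 * 2 ^ n) (majoranas (n + 2) (near k 1))" if k: "k < 2 * (n + 2)" for k
  proof (cases "k < 4")
    case True
    have "kron (mat_adjoint G * majorana 2 k * G) (1\<^sub>m (2 ^ n)) \<in> mat_span (4 * 2 ^ n) (majoranas (n + 2) (near k 1))"
    proof (rule mat_span_kron_right[OF _ majoranas_2_carrier carr])
      show "mat_adjoint G * majorana 2 k * G \<in> mat_span 4 (majoranas 2 UNIV)"
        using gG True by (auto simp: two_qubit_gaussian_def)
      fix A assume "A \<in> majoranas 2 UNIV"
      then obtain j where j: "A = majorana 2 j" "j < 4" by (auto simp: majoranas_def)
      then have "kron A (1\<^sub>m (2 ^ n)) = majorana (n + 2) j" "j \<in> near k 1" "j < 2 * (n + 2)"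
        using True by (auto simp: majorana_add_2[simplified] near_def)
      then have "kron A (1\<^sub>m (2 ^ n)) \<in> majoranas (n + 2) (near k 1)" unfolding majoranas_def by blast
      then show "kron A (1\<^sub>m (2 ^ n)) \<in> mat_span (4 * 2 ^ n) (majoranas (n + 2) (near k 1))"
        using mat_span_base[OF _ carr] by simp
    qed simp
    then show ?thesis
      unfolding majorana_add_2[OF True] using L G by (simp add: kron_conj[of _ 4 _ _ "2 ^ n"])
  next
    case False
    then obtain l where l: "k = l + 4" using le_Suc_ex[of 4 k] by (auto simp: add.commute)
    obtain c where c: "mat_adjoint G * parity 2 * G = c \<cdot>\<^sub>m parity 2"
      using gG by (auto simp: two_qubit_gaussian_def)
    have p: "parity 2 \<in> carrier_mat 4 4" by (simp add: parity_2)
    have "kron (parity 2) (mat_adjoint L * majorana n l * L) \<in> mat_span (4 * 2 ^ n) (majoranas (n + 2) (near k 1))"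
    proof (rule mat_span_kron_left[OF _ majoranas_carrier carr p])
      show "mat_adjoint L * majorana n l * L \<in> mat_span (2 ^ n) (majoranas n (near l 1))"
        using gate k l by simp
      fix A assume "A \<in> majoranas n (near l 1)"
      then obtain j where j: "A = majorana n j" "j \<in> near l 1" "j < 2 * n" by (auto simp: majoranas_def)
      have "kron (parity 2) A = majorana (n + 2) (j + 4)" unfolding majorana_add_2_shift j(1) ..
      moreover have "j + 4 \<in> near k 1" "j + 4 < 2 * (n + 2)"
        \<comment> \<open>Four Majorana indices are two qubits, and a common shift does not change
          distances.\<close>
        using l j div_mult_self3[of 2 2 j] div_mult_self3[of 2 2 l] by (auto simp: near_def add.commute)
      ultimately have "kron (parity 2) A \<in> majoranas (n + 2) (near k 1)" unfolding majoranas_def by blast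
      then show "kron (parity 2) A \<in> mat_span (4 * 2 ^ n) (majoranas (n + 2) (near k 1))"
        using mat_span_base[OF _ carr] by simp
    qed
    then have "c \<cdot>\<^sub>m kron (parity 2) (mat_adjoint L * majorana n l * L) \<in> mat_span (4 * 2 ^ n) (majoranas (n + 2) (near k 1))"
      using mat_span_smult carr by blast
    then show ?thesis
      unfolding l majorana_add_2_shift kron_conj[OF p G(1) majorana_carrier L(1)] c kron_smult_left .
  qed
  then show ?case using G gate unitary_kron[of 4 G "2 ^ n" L] by (simp add: power_add)
qed

text \<open>The outermost layer \<open>L\<close> acts first on the observable and spreads it by one
  qubit; the remaining circuit then spreads each resulting Majorana operator by \<open>d\<close>,
  and the distances add up by the triangle inequality.\<close>

lemma matchgate_circuit_local:
  assumes "matchgate_circuit n d U"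
  shows "unitary (2 ^ n) U \<and>
    (\<forall>k<2 * n. mat_adjoint U * majorana n k * U \<in> mat_span (2 ^ n) (majoranas n (near k d)))"
  using assms
proof induction
  case zero
  have "majorana n k \<in> mat_span (2 ^ n) (majoranas n (near k 0))" if "k < 2 * n" for k
    using that by (intro mat_span_base[OF _ majoranas_carrier]) (auto simp: majoranas_def near_def)
  then show ?case by (simp add: unitary_one right_mult_one_mat[of _ "2 ^ n" "2 ^ n"] left_mult_one_mat[of _ "2 ^ n" "2 ^ n"])
next
  case (layer L d U)
  note L = matchgate_layer_local[OF layer(1)]
  have c: "L \<in> carrier_mat (2 ^ n) (2 ^ n)" "U \<in> carrier_mat (2 ^ n) (2 ^ n)"
    using L layer by (auto simp: unitary_def)
  have "mat_adjoint (L * U) * majorana n k * (L * U) \<in> mat_span (2 ^ n) (majoranas n (near k (Suc d)))"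
    if k: "k < 2 * n" for k
    unfolding conj_mult[OF c majorana_carrier]
  proof (rule mat_span_conj[OF _ majoranas_carrier majoranas_carrier])
    show "mat_adjoint L * majorana n k * L \<in> mat_span (2 ^ n) (majoranas n (near k 1))"
      using L k by blast
    fix A assume "A \<in> majoranas n (near k 1)"
    then obtain j where j: "A = majorana n j" "j \<in> near k 1" "j < 2 * n" by (auto simp: majoranas_def)
    have "mat_adjoint U * A * U \<in> mat_span (2 ^ n) (majoranas n (near j d))"
      using layer j by blast
    moreover have "majoranas n (near j d) \<subseteq> majoranas n (near k (Suc d))"
      using j(2) by (auto simp: majoranas_def near_def)
    ultimately show "mat_adjoint U * A * U \<in> mat_span (2 ^ n) (majoranas n (near k (Suc d)))"
      by (rule mat_span_mono)
  qed (use c in auto)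
  then show ?case using L layer by (auto intro: unitary_mult)
qed

section \<open>Vanishing correlations between the ends of the line\<close>

lemma mat_span_mult_00:
  assumes A: "A \<in> mat_span N S" and B: "B \<in> mat_span N T" and N: "N > 0"
    and S: "S \<subseteq> carrier_mat N N" and T: "T \<subseteq> carrier_mat N N"
    and ST: "\<And>A B. A \<in> S \<Longrightarrow> B \<in> T \<Longrightarrow> (A * B) $$ (0, 0) = 0"
  shows "(A * B) $$ (0, 0) = 0"
proof -
  have 1: "(A * B) $$ (0, 0) = 0" if "A \<in> S" for A
    using B
  proof induction
    case zero
    then show ?case using N S that by auto
  next
    case (step C D c)
    then have "A \<in> carrier_mat N N" "C \<in> carrier_mat N N" using S T that by auto
    with step have "A * (c \<cdot>\<^sub>m C + D) = c \<cdot>\<^sub>m (A * C) + A * D"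
      using S T that mat_span_carrier[OF step(2) T]
      by (subst mult_add_distrib_mat[of _ N N _ N]) (auto simp: smult_mult_right)
    then show ?case using step ST[OF that] N \<open>A \<in> carrier_mat N N\<close> \<open>C \<in> carrier_mat N N\<close> mat_span_carrier[OF step(2) T]
      by (auto simp del: index_mult_mat(1))
  qed
  have Bc: "B \<in> carrier_mat N N" using B T by (rule mat_span_carrier)
  show ?thesis using A
  proof induction
    case zero
    then show ?case using N Bc by auto
  next
    case (step C D c)
    then have "C \<in> carrier_mat N N" using S by auto
    with step have "(c \<cdot>\<^sub>m C + D) * B = c \<cdot>\<^sub>m (C * B) + D * B"
      using S Bc mat_span_carrier[OF step(2) S]
      by (subst add_mult_distrib_mat[of _ N N _ _ N]) (auto simp: smult_mult_left)
    then show ?case using step 1 N \<open>C \<in> carrier_mat N N\<close> Bc mat_span_carrier[OF step(2) S]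
      by (auto simp del: index_mult_mat(1))
  qed
qed

lemma conj_mult_inner:
  assumes "unitary N U" "A \<in> carrier_mat N N" "B \<in> carrier_mat N N"
  shows "mat_adjoint U * (A * B) * U = (mat_adjoint U * A * U) * (mat_adjoint U * B * U)"
proof -
  have U: "U \<in> carrier_mat N N" "U * mat_adjoint U = 1\<^sub>m N" using assms by (auto simp: unitary_def)
  have "(mat_adjoint U * A * U) * (mat_adjoint U * B * U) = mat_adjoint U * A * (U * mat_adjoint U) * B * U"
    using U(1) assms by (simp add: assoc_mult_mat[of _ N N _ N _ N])
  then show ?thesis using U assms by (simp add: assoc_mult_mat[of _ N N _ N _ N])
qed

text \<open>The cone of the first Majorana operator ends at qubit \<open>d\<close>, and that of the
  last begins at qubit \<open>n - 1 - d\<close>. The depth condition separates the two cones, and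
  Majorana operators on different qubits are uncorrelated in \<open>|0...0>\<close>.\<close>

lemma shallow_correlation_zero:
  assumes "matchgate_circuit n d U" "2 * d + 1 < n"
  shows "(mat_adjoint U * (majorana n 0 * majorana n (2 * n - 1)) * U) $$ (0, 0) = 0"
proof -
  note U = matchgate_circuit_local[OF assms(1)]
  have "((mat_adjoint U * majorana n 0 * U) * (mat_adjoint U * majorana n (2 * n - 1) * U)) $$ (0, 0) = 0"
  proof (rule mat_span_mult_00[OF _ _ _ majoranas_carrier majoranas_carrier])
    show "mat_adjoint U * majorana n 0 * U \<in> mat_span (2 ^ n) (majoranas n (near 0 d))"
      "mat_adjoint U * majorana n (2 * n - 1) * U \<in> mat_span (2 ^ n) (majoranas n (near (2 * n - 1) d))"
      using U assms by auto
    fix A B assume "A \<in> majoranas n (near 0 d)" "B \<in> majoranas n (near (2 * n - 1) d)"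
    then obtain i j where ij: "A = majorana n i" "i < 2 * n" "i \<in> near 0 d"
      "B = majorana n j" "j < 2 * n" "j \<in> near (2 * n - 1) d"
      by (auto simp: majoranas_def)
    have "i div 2 \<noteq> j div 2" using ij assms(2) by (auto simp: near_def)
    then show "(A * B) $$ (0, 0) = 0" using ij by (auto simp: majorana_mult_00 simp del: index_mult_mat(1))
  qed simp
  then show ?thesis using U by (simp add: conj_mult_inner[of "2 ^ n"] del: index_mult_mat(1))
qed


section \<open>Unitaries implementing orthogonal transformations\<close>

text \<open>Written exactly like the right-hand side in \<open>majorana_unitary\<close>, so that
  both unfold to the same term.\<close>

definition majorana_sum :: "nat \<Rightarrow> (nat \<Rightarrow> complex) \<Rightarrow> complex mat" where
  "majorana_sum n f = mat (2 ^ n) (2 ^ n) (\<lambda>rc. \<Sum>j < 2 * n. f j * majorana n j $$ rc)"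

lemma majorana_sum_carrier [simp]: "majorana_sum n f \<in> carrier_mat (2 ^ n) (2 ^ n)"
  by (simp add: majorana_sum_def)

lemma dim_majorana_sum [simp]: "dim_row (majorana_sum n f) = 2 ^ n" "dim_col (majorana_sum n f) = 2 ^ n"
  by (simp_all add: majorana_sum_def)

lemma majorana_sum_cong: "(\<And>j. j < 2 * n \<Longrightarrow> f j = g j) \<Longrightarrow> majorana_sum n f = majorana_sum n g"
  by (simp add: majorana_sum_def)

lemma majorana_sum_delta: "i < 2 * n \<Longrightarrow> majorana_sum n (\<lambda>j. if j = i then 1 else 0) = majorana n i"
  by (rule eq_matI) (auto simp: majorana_sum_def if_distrib[of "\<lambda>x. x * _"] sum.delta cong: if_cong)

lemma majorana_sum_mult:
  assumes "V \<in> carrier_mat (2 ^ n) (2 ^ n)" "W \<in> carrier_mat (2 ^ n) (2 ^ n)"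
  shows "V * majorana_sum n f * W =
    mat (2 ^ n) (2 ^ n) (\<lambda>rc. \<Sum>j < 2 * n. f j * (V * majorana n j * W) $$ rc)"
proof (rule eq_matI)
  fix a b
  assume "a < dim_row (mat (2 ^ n) (2 ^ n) (\<lambda>rc. \<Sum>j < 2 * n. f j * (V * majorana n j * W) $$ rc))"
    "b < dim_col (mat (2 ^ n) (2 ^ n) (\<lambda>rc. \<Sum>j < 2 * n. f j * (V * majorana n j * W) $$ rc))"
  then have ab: "a < 2 ^ n" "b < 2 ^ n" by auto
  have entry: "(V * M * W) $$ (a, b) = (\<Sum>c<2 ^ n. \<Sum>d<2 ^ n. V $$ (a, c) * M $$ (c, d) * W $$ (d, b))"
    if "M \<in> carrier_mat (2 ^ n) (2 ^ n)" for M
    using that assms ab by (simp add: scalar_prod_def lessThan_atLeast0 sum_distrib_left mult.assoc)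
  have "(V * majorana_sum n f * W) $$ (a, b) =
      (\<Sum>c<2 ^ n. \<Sum>d<2 ^ n. \<Sum>j<2 * n. f j * (V $$ (a, c) * majorana n j $$ (c, d) * W $$ (d, b)))"
    unfolding entry[OF majorana_sum_carrier]
    by (intro sum.cong refl) (simp add: majorana_sum_def sum_distrib_left sum_distrib_right mult_ac)
  also have "\<dots> = (\<Sum>j<2 * n. \<Sum>c<2 ^ n. \<Sum>d<2 ^ n. f j * (V $$ (a, c) * majorana n j $$ (c, d) * W $$ (d, b)))"
    by (subst sum.swap[of _ "{..<2 ^ n}" "{..<2 * n}", symmetric]) (intro sum.cong refl sum.swap)
  also have "\<dots> = (\<Sum>j<2 * n. f j * (V * majorana n j * W) $$ (a, b))"
    unfolding entry[OF majorana_carrier] by (simp add: sum_distrib_left)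
  finally show "(V * majorana_sum n f * W) $$ (a, b) =
      mat (2 ^ n) (2 ^ n) (\<lambda>rc. \<Sum>j < 2 * n. f j * (V * majorana n j * W) $$ rc) $$ (a, b)"
    using ab by simp
qed (use assms in auto)

lemma majorana_sum_mult_right:
  assumes "W \<in> carrier_mat (2 ^ n) (2 ^ n)"
  shows "majorana_sum n f * W = mat (2 ^ n) (2 ^ n) (\<lambda>rc. \<Sum>j < 2 * n. f j * (majorana n j * W) $$ rc)"
  using majorana_sum_mult[OF one_carrier_mat assms, of f] assms
  by (simp add: left_mult_one_mat[of _ "2 ^ n" "2 ^ n"])

lemma majorana_sum_mult_left:
  assumes "V \<in> carrier_mat (2 ^ n) (2 ^ n)"
  shows "V * majorana_sum n f = mat (2 ^ n) (2 ^ n) (\<lambda>rc. \<Sum>j < 2 * n. f j * (V * majorana n j) $$ rc)"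
  using majorana_sum_mult[OF assms one_carrier_mat, of f] assms
  by (simp add: right_mult_one_mat[of _ "2 ^ n" "2 ^ n"])

lemma majorana_sum_conj:
  assumes "V \<in> carrier_mat (2 ^ n) (2 ^ n)" "W \<in> carrier_mat (2 ^ n) (2 ^ n)"
    and "\<And>j. j < 2 * n \<Longrightarrow> V * majorana n j * W = majorana_sum n (g j)"
  shows "V * majorana_sum n f * W = majorana_sum n (\<lambda>k. \<Sum>j < 2 * n. f j * g j k)"
proof -
  have "V * majorana_sum n f * W = mat (2 ^ n) (2 ^ n) (\<lambda>rc. \<Sum>j < 2 * n. f j * majorana_sum n (g j) $$ rc)"
    unfolding majorana_sum_mult[OF assms(1,2)] using assms(3) by (intro cong_mat) auto
  also have "\<dots> = majorana_sum n (\<lambda>k. \<Sum>j < 2 * n. f j * g j k)"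
  proof (rule eq_matI)
    fix a b
    assume "a < dim_row (majorana_sum n (\<lambda>k. \<Sum>j < 2 * n. f j * g j k))"
      "b < dim_col (majorana_sum n (\<lambda>k. \<Sum>j < 2 * n. f j * g j k))"
    then show "mat (2 ^ n) (2 ^ n) (\<lambda>rc. \<Sum>j < 2 * n. f j * majorana_sum n (g j) $$ rc) $$ (a, b) =
        majorana_sum n (\<lambda>k. \<Sum>j < 2 * n. f j * g j k) $$ (a, b)"
      by (simp add: majorana_sum_def sum_distrib_left sum_distrib_right mult.assoc)
        (rule sum.swap)
  qed auto
  finally show ?thesis .
qed

text \<open>This is the property under the choice operator in
  \<open>majorana_unitary\<close>.\<close>

definition implements :: "nat \<Rightarrow> complex mat \<Rightarrow> real mat \<Rightarrow> bool" where
  "implements n U R \<longleftrightarrow> unitary (2 ^ n) U \<and>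
     (\<forall>i < 2 * n. U * majorana n i * mat_adjoint U = majorana_sum n (\<lambda>j. complex_of_real (R $$ (i, j))))"

text \<open>The order is reversed: the inner conjugation by \<open>V\<close> produces a row of
  \<open>S\<close>, and conjugation by \<open>U\<close> then replaces each Majorana operator in that
  sum by a row of \<open>R\<close>.\<close>

lemma implements_mult:
  assumes U: "implements n U R" and V: "implements n V S"
    and R: "R \<in> carrier_mat (2 * n) (2 * n)" and S: "S \<in> carrier_mat (2 * n) (2 * n)"
  shows "implements n (U * V) (S * R)"
proof -
  have c: "U \<in> carrier_mat (2 ^ n) (2 ^ n)" "V \<in> carrier_mat (2 ^ n) (2 ^ n)"
    using assms by (auto simp: implements_def unitary_def)
  have "(U * V) * majorana n i * mat_adjoint (U * V) = majorana_sum n (\<lambda>j. complex_of_real ((S * R) $$ (i, j)))"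
    if i: "i < 2 * n" for i
  proof -
    have "(U * V) * majorana n i * mat_adjoint (U * V) = U * (V * majorana n i * mat_adjoint V) * mat_adjoint U"
      using c by (simp add: mat_adjoint_mult[OF c] assoc_mult_mat[of _ "2 ^ n" "2 ^ n" _ "2 ^ n" _ "2 ^ n"])
    also have "V * majorana n i * mat_adjoint V = majorana_sum n (\<lambda>j. complex_of_real (S $$ (i, j)))"
      using V i by (simp add: implements_def)
    also have "U * \<dots> * mat_adjoint U =
        majorana_sum n (\<lambda>k. \<Sum>j < 2 * n. complex_of_real (S $$ (i, j)) * complex_of_real (R $$ (j, k)))"
      using U c by (intro majorana_sum_conj) (auto simp: implements_def)
    also have "\<dots> = majorana_sum n (\<lambda>k. complex_of_real ((S * R) $$ (i, k)))"
      using R S i by (intro majorana_sum_cong) (simp add: scalar_prod_def lessThan_atLeast0)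
    finally show ?thesis .
  qed
  then show ?thesis using U V by (auto simp: implements_def intro: unitary_mult)
qed

section \<open>Orthogonal matrices and their implementations\<close>

lemma orthogonal_groupD:
  assumes "R \<in> orthogonal_group m"
  shows "R \<in> carrier_mat m m" "R * transpose_mat R = 1\<^sub>m m" "transpose_mat R * R = 1\<^sub>m m"
  using assms mat_mult_left_right_inverse[of R m "transpose_mat R"] by (auto simp: orthogonal_group_def)

lemma orthogonal_group_row:
  assumes "R \<in> orthogonal_group m" "i < m" "j < m"
  shows "(\<Sum>k<m. R $$ (i, k) * R $$ (j, k)) = (if i = j then 1 else 0)"
proof -
  have "(R * transpose_mat R) $$ (i, j) = (if i = j then 1 else 0)"
    using orthogonal_groupD(2)[OF assms(1)] assms by simp
  then show ?thesis
    using orthogonal_groupD(1)[OF assms(1)] assms by (simp add: scalar_prod_def lessThan_atLeast0)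
qed

lemma orthogonal_group_col:
  assumes "R \<in> orthogonal_group m" "i < m" "j < m"
  shows "(\<Sum>k<m. R $$ (k, i) * R $$ (k, j)) = (if i = j then 1 else 0)"
proof -
  have "(transpose_mat R * R) $$ (i, j) = (if i = j then 1 else 0)"
    using orthogonal_groupD(3)[OF assms(1)] assms by simp
  then show ?thesis
    using orthogonal_groupD(1)[OF assms(1)] assms by (simp add: scalar_prod_def lessThan_atLeast0)
qed

lemma orthogonal_group_mult:
  assumes "R \<in> orthogonal_group m" "S \<in> orthogonal_group m"
  shows "R * S \<in> orthogonal_group m"
proof -
  note R = orthogonal_groupD[OF assms(1)] and S = orthogonal_groupD[OF assms(2)]
  have "R * S * transpose_mat (R * S) = R * (S * transpose_mat S) * transpose_mat R"
    unfolding transpose_mult[OF R(1) S(1)]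
    using R(1) S(1) by (simp add: assoc_mult_mat[of _ m m _ m _ m])
  also have "\<dots> = 1\<^sub>m m" unfolding S(2) right_mult_one_mat[OF R(1)] R(2) ..
  finally show ?thesis using mult_square_carrier[OF R(1) S(1)] unfolding orthogonal_group_def by blast
qed

lemma orthogonal_group_one: "1\<^sub>m m \<in> orthogonal_group m"
  by (simp add: orthogonal_group_def)

lemma implements_one: "implements n (1\<^sub>m (2 ^ n)) (1\<^sub>m (2 * n))"
proof -
  have "majorana_sum n (\<lambda>j. complex_of_real ((1\<^sub>m (2 * n)) $$ (i, j))) = majorana n i" if "i < 2 * n" for i
    using that by (subst majorana_sum_delta[symmetric]) (auto intro!: majorana_sum_cong)
  then show ?thesis
    by (simp add: implements_def unitary_one right_mult_one_mat[of _ "2 ^ n" "2 ^ n"] left_mult_one_mat[of _ "2 ^ n" "2 ^ n"])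
qed

lemma implements_adjoint:
  assumes U: "implements n U R" and R: "R \<in> orthogonal_group (2 * n)"
  shows "implements n (mat_adjoint U) (transpose_mat R)"
proof -
  have c: "U \<in> carrier_mat (2 ^ n) (2 ^ n)" and UU: "mat_adjoint U * U = 1\<^sub>m (2 ^ n)"
    using U by (auto simp: implements_def unitary_def)
  note Rc = orthogonal_groupD(1)[OF R]
  have "mat_adjoint U * majorana n i * U = majorana_sum n (\<lambda>j. complex_of_real (transpose_mat R $$ (i, j)))"
    if i: "i < 2 * n" for i
  proof -
    \<comment> \<open>The candidate for the conjugate. Conjugating it by \<open>U\<close> gives back
      \<open>majorana n i\<close>, by orthonormality of the columns of \<open>R\<close>, and undoing
      the conjugation proves the claim.\<close>
    define S where "S = majorana_sum n (\<lambda>j. complex_of_real (transpose_mat R $$ (i, j)))"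
    have S: "S \<in> carrier_mat (2 ^ n) (2 ^ n)" by (simp add: S_def)
    have "U * S * mat_adjoint U =
        majorana_sum n (\<lambda>k. \<Sum>j < 2 * n. complex_of_real (transpose_mat R $$ (i, j)) * complex_of_real (R $$ (j, k)))"
      unfolding S_def using U c by (intro majorana_sum_conj) (auto simp: implements_def)
    also have "\<dots> = majorana_sum n (\<lambda>j. if j = i then 1 else 0)"
    proof (rule majorana_sum_cong)
      fix k assume k: "k < 2 * n"
      have "(\<Sum>j<2 * n. complex_of_real (transpose_mat R $$ (i, j)) * complex_of_real (R $$ (j, k))) =
          complex_of_real (\<Sum>j<2 * n. R $$ (j, i) * R $$ (j, k))"
        using Rc i by simp
      then show "(\<Sum>j<2 * n. complex_of_real (transpose_mat R $$ (i, j)) * complex_of_real (R $$ (j, k))) =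
          (if k = i then 1 else 0)"
        using orthogonal_group_col[OF R i k] by auto
    qed
    also have "\<dots> = majorana n i" using i by (rule majorana_sum_delta)
    finally have "mat_adjoint U * majorana n i * U = mat_adjoint U * (U * S * mat_adjoint U) * U" by simp
    also have "\<dots> = (mat_adjoint U * U) * S * (mat_adjoint U * U)"
      using c S by (simp add: assoc_mult_mat[of _ "2 ^ n" "2 ^ n" _ "2 ^ n" _ "2 ^ n"])
    also have "\<dots> = S" using S by (simp add: UU)
    finally show ?thesis unfolding S_def .
  qed
  then show ?thesis using U by (auto simp: implements_def unitary_mat_adjoint)
qed

text \<open>The Householder matrix of the mirror orthogonal to \<open>w\<close>; it is a reflection
  when \<open>w\<close> is a unit vector.\<close>

definition reflection :: "nat \<Rightarrow> (nat \<Rightarrow> real) \<Rightarrow> real mat" where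
  "reflection m w = mat m m (\<lambda>(i, j). (if i = j then 1 else 0) - 2 * w i * w j)"

lemma reflection_carrier [simp]: "reflection m w \<in> carrier_mat m m"
  by (simp add: reflection_def)

lemma reflection_mult_index:
  assumes "M \<in> carrier_mat m k" "i < m" "j < k"
  shows "(reflection m w * M) $$ (i, j) = M $$ (i, j) - 2 * w i * (\<Sum>l<m. w l * M $$ (l, j))"
proof -
  have "(reflection m w * M) $$ (i, j) = (\<Sum>l<m. ((if i = l then 1 else 0) - 2 * w i * w l) * M $$ (l, j))"
    using assms by (simp add: reflection_def scalar_prod_def lessThan_atLeast0)
  also have "\<dots> = (\<Sum>l<m. (if i = l then M $$ (l, j) else 0)) - (\<Sum>l<m. 2 * w i * (w l * M $$ (l, j)))"
    unfolding sum_subtractf[symmetric] by (intro sum.cong) (auto simp: algebra_simps)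
  finally show ?thesis using assms by (simp add: sum_distrib_left)
qed

lemma reflection_orthogonal:
  assumes "(\<Sum>i<m. w i * w i) = 1"
  shows "reflection m w \<in> orthogonal_group m"
proof -
  have "reflection m w * transpose_mat (reflection m w) = 1\<^sub>m m"
  proof (rule eq_matI)
    fix i j assume ij: "i < dim_row (1\<^sub>m m :: real mat)" "j < dim_col (1\<^sub>m m :: real mat)"
    have "(\<Sum>l<m. w l * transpose_mat (reflection m w) $$ (l, j)) =
        (\<Sum>l<m. (if j = l then w l else 0)) - (\<Sum>l<m. 2 * w j * (w l * w l))"
      unfolding sum_subtractf[symmetric] using ij by (intro sum.cong) (auto simp: reflection_def algebra_simps)
    also have "\<dots> = - w j" using ij assms by (simp add: sum_distrib_left[symmetric])
    finally show "(reflection m w * transpose_mat (reflection m w)) $$ (i, j) = 1\<^sub>m m $$ (i, j)"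
      using ij by (subst reflection_mult_index[of _ m m]) (auto simp: reflection_def)
  qed (auto simp: reflection_def)
  then show ?thesis by (simp add: orthogonal_group_def)
qed

lemma majorana_sum_anticommutator:
  assumes "i < 2 * n"
  shows "majorana_sum n f * majorana n i = (2 * f i) \<cdot>\<^sub>m 1\<^sub>m (2 ^ n) + (- 1) \<cdot>\<^sub>m (majorana n i * majorana_sum n f)"
proof (rule eq_matI)
  fix a b
  assume "a < dim_row ((2 * f i) \<cdot>\<^sub>m 1\<^sub>m (2 ^ n) + (- 1) \<cdot>\<^sub>m (majorana n i * majorana_sum n f))"
    "b < dim_col ((2 * f i) \<cdot>\<^sub>m 1\<^sub>m (2 ^ n) + (- 1) \<cdot>\<^sub>m (majorana n i * majorana_sum n f))"
  then have ab: "a < 2 ^ n" "b < 2 ^ n" by auto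
  have "f j * (majorana n j * majorana n i) $$ (a, b) =
      (if j = i then 2 * f i * 1\<^sub>m (2 ^ n) $$ (a, b) else 0) - f j * (majorana n i * majorana n j) $$ (a, b)"
    if j: "j < 2 * n" for j
    using majorana_square[OF assms] majorana_anticommute[OF j assms] ab by (auto simp del: index_mult_mat(1))
  then have "(\<Sum>j<2 * n. f j * (majorana n j * majorana n i) $$ (a, b)) =
      2 * f i * 1\<^sub>m (2 ^ n) $$ (a, b) - (\<Sum>j<2 * n. f j * (majorana n i * majorana n j) $$ (a, b))"
    using assms by (simp add: sum_subtractf del: index_mult_mat(1))
  then show "(majorana_sum n f * majorana n i) $$ (a, b) =
      ((2 * f i) \<cdot>\<^sub>m 1\<^sub>m (2 ^ n) + (- 1) \<cdot>\<^sub>m (majorana n i * majorana_sum n f)) $$ (a, b)"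
    using ab by (simp add: majorana_sum_mult_right majorana_sum_mult_left del: index_mult_mat(1))
qed auto

text \<open>Adding up the anticommutators with weights \<open>f i\<close> gives
  \<open>M * M = 2 - M * M\<close>. The normalisation is bilinear, without conjugation, as in a
  Clifford algebra.\<close>

lemma majorana_sum_square:
  assumes "(\<Sum>i<2 * n. f i * f i) = 1"
  shows "majorana_sum n f * majorana_sum n f = 1\<^sub>m (2 ^ n)"
proof (rule eq_matI)
  fix a b assume "a < dim_row (1\<^sub>m (2 ^ n) :: complex mat)" "b < dim_col (1\<^sub>m (2 ^ n) :: complex mat)"
  then have ab: "a < 2 ^ n" "b < 2 ^ n" by auto
  let ?M = "majorana_sum n f"
  have "(?M * ?M) $$ (a, b) = (\<Sum>i<2 * n. f i * (?M * majorana n i) $$ (a, b))"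
    using ab by (subst majorana_sum_mult_left) (auto simp del: index_mult_mat(1))
  also have "\<dots> = (\<Sum>i<2 * n. 2 * (f i * f i) * 1\<^sub>m (2 ^ n) $$ (a, b) - f i * (majorana n i * ?M) $$ (a, b))"
    using ab by (intro sum.cong refl) (simp add: majorana_sum_anticommutator algebra_simps del: index_mult_mat(1))
  also have "\<dots> = 2 * (\<Sum>i<2 * n. f i * f i) * 1\<^sub>m (2 ^ n) $$ (a, b) - (\<Sum>i<2 * n. f i * (majorana n i * ?M) $$ (a, b))"
    by (simp only: sum_subtractf sum_distrib_left sum_distrib_right)
  also have "(\<Sum>i<2 * n. f i * (majorana n i * ?M) $$ (a, b)) = (?M * ?M) $$ (a, b)"
    using ab arg_cong[OF majorana_sum_mult_right[of ?M n f], of "\<lambda>A. A $$ (a, b)"]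
    by (simp del: index_mult_mat(1))
  finally show "(?M * ?M) $$ (a, b) = 1\<^sub>m (2 ^ n) $$ (a, b)" using assms by (simp del: index_mult_mat(1))
qed auto

lemma mat_adjoint_majorana_sum:
  "mat_adjoint (majorana_sum n (\<lambda>j. complex_of_real (w j))) = majorana_sum n (\<lambda>j. complex_of_real (w j))"
proof (rule eq_matI)
  fix a b
  assume "a < dim_row (majorana_sum n (\<lambda>j. complex_of_real (w j)))" "b < dim_col (majorana_sum n (\<lambda>j. complex_of_real (w j)))"
  then have ab: "a < 2 ^ n" "b < 2 ^ n" by auto
  have "cnj (majorana n j $$ (b, a)) = majorana n j $$ (a, b)" for j
    using index_mat_adjoint[of a "majorana n j" b] ab by simp
  then show "mat_adjoint (majorana_sum n (\<lambda>j. complex_of_real (w j))) $$ (a, b) =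
      majorana_sum n (\<lambda>j. complex_of_real (w j)) $$ (a, b)"
    using ab by (simp add: majorana_sum_def)
qed auto

lemma parity_majorana_sum:
  "parity n * majorana_sum n f * parity n = majorana_sum n (\<lambda>j. - f j)"
proof -
  have "parity n * majorana n j * parity n = majorana_sum n (\<lambda>k. if k = j then - 1 else 0)" if "j < 2 * n" for j
  proof -
    have "parity n * majorana n j * parity n = (- 1) \<cdot>\<^sub>m (majorana n j * (parity n * parity n))"
      using parity_anticommute[OF that] by (simp add: smult_mult_left assoc_mult_mat[of _ "2 ^ n" "2 ^ n" _ "2 ^ n" _ "2 ^ n"])
    also have "\<dots> = (- 1) \<cdot>\<^sub>m majorana_sum n (\<lambda>k. if k = j then 1 else 0)"
      using that by (simp add: parity_square majorana_sum_delta)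
    also have "\<dots> = majorana_sum n (\<lambda>k. if k = j then - 1 else 0)"
      by (intro eq_matI) (auto simp: majorana_sum_def sum_negf[symmetric] intro!: sum.cong)
    finally show ?thesis .
  qed
  then have "parity n * majorana_sum n f * parity n = majorana_sum n (\<lambda>k. \<Sum>j < 2 * n. f j * (if k = j then - 1 else 0))"
    by (intro majorana_sum_conj) auto
  also have "\<dots> = majorana_sum n (\<lambda>j. - f j)"
    by (intro majorana_sum_cong) (simp add: if_distrib[of "\<lambda>x. _ * x"] cong: if_cong)
  finally show ?thesis .
qed

text \<open>By the anticommutator, conjugation with \<open>M\<close> sends
  \<open>majorana n i\<close> to \<open>2 w i M - majorana n i\<close>, the negative of the
  reflection. The parity operator anticommutes with every Majorana operator and so restores the
  sign.\<close>

lemma implements_reflection: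
  assumes w: "(\<Sum>i<2 * n. w i * w i) = 1"
  shows "implements n (parity n * majorana_sum n (\<lambda>j. complex_of_real (w j))) (reflection (2 * n) w)"
proof -
  define M where "M = majorana_sum n (\<lambda>j. complex_of_real (w j))"
  have M: "M \<in> carrier_mat (2 ^ n) (2 ^ n)" "mat_adjoint M = M"
    by (simp_all add: M_def mat_adjoint_majorana_sum)
  have "(\<Sum>i<2 * n. complex_of_real (w i) * complex_of_real (w i)) = 1"
    using arg_cong[OF w, of complex_of_real] by simp
  then have MM: "M * M = 1\<^sub>m (2 ^ n)" unfolding M_def by (rule majorana_sum_square)
  have "unitary (2 ^ n) M" "unitary (2 ^ n) (parity n)" using M MM by (auto simp: unitary_def parity_square)
  then have u: "unitary (2 ^ n) (parity n * M)" by (intro unitary_mult)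
  have "parity n * M * majorana n i * mat_adjoint (parity n * M) =
      majorana_sum n (\<lambda>j. complex_of_real (reflection (2 * n) w $$ (i, j)))" if i: "i < 2 * n" for i
  proof -
    note assoc = assoc_mult_mat[of _ "2 ^ n" "2 ^ n" _ "2 ^ n" _ "2 ^ n"]
    have "M * majorana n i * M = (2 * w i) \<cdot>\<^sub>m M + (- 1) \<cdot>\<^sub>m (majorana n i * (M * M))"
      unfolding M_def majorana_sum_anticommutator[OF i]
      by (simp add: add_mult_distrib_mat[of _ "2 ^ n" "2 ^ n" _ _ "2 ^ n"] smult_mult_left assoc)
    also have "\<dots> = majorana_sum n (\<lambda>j. 2 * w i * w j - (if j = i then 1 else 0))"
    proof -
      have "majorana n i * (M * M) = majorana_sum n (\<lambda>j. if j = i then 1 else 0)"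
        using i by (simp add: MM majorana_sum_delta)
      then show ?thesis
        by (intro eq_matI)
          (simp_all add: M_def majorana_sum_def sum_subtractf left_diff_distrib sum_distrib_left mult.assoc
            if_distrib[of complex_of_real] sum_negf cong: if_cong)
    qed
    finally have *: "M * majorana n i * M = majorana_sum n (\<lambda>j. 2 * w i * w j - (if j = i then 1 else 0))" .
    have "parity n * M * majorana n i * mat_adjoint (parity n * M) = parity n * (M * majorana n i * M) * parity n"
      using M by (simp add: mat_adjoint_mult[of _ "2 ^ n" "2 ^ n" _ "2 ^ n"] assoc)
    then show ?thesis
      unfolding * parity_majorana_sum using i
      by (auto simp: reflection_def intro!: majorana_sum_cong)
  qed
  then show ?thesis using u unfolding implements_def M_def by blast
qed

text \<open>As in the Cartan--Dieudonne theorem, reflections successively move the columns of an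
  orthogonal matrix to the standard basis vectors.\<close>

lemma implements_columns:
  assumes R: "R \<in> orthogonal_group (2 * n)" and k: "k \<le> 2 * n"
  shows "\<exists>U S. S \<in> orthogonal_group (2 * n) \<and> implements n U S \<and>
    (\<forall>i<k. \<forall>j<2 * n. (S * R) $$ (j, i) = (if j = i then 1 else 0))"
  using k
proof (induction k)
  case 0
  then show ?case using orthogonal_group_one implements_one by blast
next
  case (Suc k)
  let ?m = "2 * n"
  have k: "k < ?m" using Suc by simp
  obtain U S where S: "S \<in> orthogonal_group ?m" "implements n U S"
    and cols: "\<And>i j. i < k \<Longrightarrow> j < ?m \<Longrightarrow> (S * R) $$ (j, i) = (if j = i then 1 else 0)"
    using Suc by auto
  define M where "M = S * R"
  have M: "M \<in> orthogonal_group ?m" unfolding M_def using S R by (intro orthogonal_group_mult)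
  note Mc = orthogonal_groupD(1)[OF M] and Sc = orthogonal_groupD(1)[OF S(1)] and Rc = orthogonal_groupD(1)[OF R]
  note cols = cols[folded M_def]
  have vv: "(\<Sum>l<?m. M $$ (l, k) * M $$ (l, k)) = 1" using orthogonal_group_col[OF M k k] by simp
  \<comment> \<open>Column \<open>k\<close> is orthogonal to the earlier columns, which are already
    standard basis vectors.\<close>
  have zero: "M $$ (i, k) = 0" if i: "i < k" for i
  proof -
    have "(\<Sum>l<?m. M $$ (l, i) * M $$ (l, k)) = (\<Sum>l<?m. if l = i then M $$ (l, k) else 0)"
      using cols i by (intro sum.cong) auto
    then show ?thesis using orthogonal_group_col[OF M _ k, of i] i k by auto
  qed
  \<comment> \<open>The difference of column \<open>k\<close> and its target is normal to the mirror
    that exchanges these two unit vectors.\<close>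
  define u where "u l = M $$ (l, k) - (if l = k then 1 else 0)" for l
  define q where "q = (\<Sum>l<?m. u l * u l)"
  have uv: "(\<Sum>l<?m. u l * M $$ (l, k)) = 1 - M $$ (k, k)"
  proof -
    have "(\<Sum>l<?m. u l * M $$ (l, k)) = (\<Sum>l<?m. M $$ (l, k) * M $$ (l, k)) - (\<Sum>l<?m. if l = k then M $$ (l, k) else 0)"
      unfolding sum_subtractf[symmetric] u_def by (intro sum.cong) (auto simp: algebra_simps)
    then show ?thesis using vv k by simp
  qed
  have q: "q = 2 * (1 - M $$ (k, k))"
  proof -
    have "q = (\<Sum>l<?m. u l * M $$ (l, k)) - (\<Sum>l<?m. if l = k then u l else 0)"
      unfolding q_def sum_subtractf[symmetric] by (intro sum.cong) (auto simp: u_def algebra_simps)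
    then show ?thesis using uv k by (simp add: u_def)
  qed
  show ?case
  proof (cases "q = 0")
    case True
    then have "u l = 0" if "l < ?m" for l
      using that sum_nonneg_eq_0_iff[of "{..<?m}" "\<lambda>l. u l * u l"] unfolding q_def by auto
    then have "M $$ (j, i) = (if j = i then 1 else 0)" if "i < Suc k" "j < ?m" for i j
      using that cols[of i j] by (cases "i = k") (auto simp: u_def)
    then show ?thesis using S unfolding M_def by blast
  next
    case False
    moreover have "q \<ge> 0" unfolding q_def by (intro sum_nonneg) simp
    ultimately have "q > 0" by simp
    define w where "w l = u l / sqrt q" for l
    \<comment> \<open>Only products of two components enter the reflection, so the square root of
      the normalisation disappears.\<close>
    have ww: "w a * w b = u a * u b / q" for a b
      using \<open>q > 0\<close> by (simp add: w_def)
    have w1: "(\<Sum>l<?m. w l * w l) = 1"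
      unfolding ww sum_divide_distrib[symmetric] using False by (simp add: q_def)
    define T where "T = reflection ?m w"
    have T: "T \<in> orthogonal_group ?m" "T \<in> carrier_mat ?m ?m"
      using reflection_orthogonal[OF w1] by (simp_all add: T_def)
    have TM: "(T * M) $$ (j, i) = M $$ (j, i) - 2 * u j / q * (\<Sum>l<?m. u l * M $$ (l, i))" if "i < ?m" "j < ?m" for i j
    proof -
      have "(T * M) $$ (j, i) = M $$ (j, i) - 2 * w j * (\<Sum>l<?m. w l * M $$ (l, i))"
        unfolding T_def using that Mc by (intro reflection_mult_index)
      also have "2 * w j * (\<Sum>l<?m. w l * M $$ (l, i)) = (\<Sum>l<?m. 2 * (w j * w l) * M $$ (l, i))"
        by (simp add: sum_distrib_left mult.assoc)
      also have "\<dots> = 2 * u j / q * (\<Sum>l<?m. u l * M $$ (l, i))"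
        unfolding ww by (simp add: sum_distrib_left mult.assoc)
      finally show ?thesis .
    qed
    have "(T * M) $$ (j, i) = (if j = i then 1 else 0)" if ij: "i < Suc k" "j < ?m" for i j
    proof (cases "i = k")
      case True
      have "2 * u j / q * (1 - M $$ (k, k)) = u j * (2 * (1 - M $$ (k, k))) / q" by simp
      also have "2 * (1 - M $$ (k, k)) = q" using q by simp
      finally have "2 * u j / q * (1 - M $$ (k, k)) = u j" using \<open>q > 0\<close> by simp
      then show ?thesis using TM[OF k ij(2)] uv True by (simp add: u_def)
    next
      case False
      with ij have i: "i < k" by simp
      \<comment> \<open>The finished columns are orthogonal to \<open>u\<close>, so the new
        reflection leaves them in place.\<close>
      have "(\<Sum>l<?m. u l * M $$ (l, i)) = (\<Sum>l<?m. if l = i then u l else 0)"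
        using cols[OF i] by (intro sum.cong) auto
      also have "\<dots> = 0" using i k zero[OF i] by (simp add: u_def)
      finally show ?thesis using TM[of i j] ij i k cols[OF i, of j] by simp
    qed
    moreover have "T * M = (T * S) * R" unfolding M_def using T Sc Rc by (simp add: assoc_mult_mat[of _ ?m ?m _ ?m _ ?m])
    moreover have "implements n (U * (parity n * majorana_sum n (\<lambda>j. complex_of_real (w j)))) (T * S)"
      using implements_mult[OF S(2) implements_reflection[OF w1] Sc] T unfolding T_def by blast
    ultimately show ?thesis using orthogonal_group_mult[OF T(1) S(1)] by metis
  qed
qed

text \<open>Once all columns are standard, \<open>S * R\<close> is the identity. Hence
  \<open>R\<close> is the transpose of \<open>S\<close> and is implemented by the adjoint of the
  unitary for \<open>S\<close>.\<close>

lemma implements_exists: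
  assumes R: "R \<in> orthogonal_group (2 * n)"
  shows "\<exists>U. implements n U R"
proof -
  obtain U S where S: "S \<in> orthogonal_group (2 * n)" "implements n U S"
    and cols: "\<And>i j. i < 2 * n \<Longrightarrow> j < 2 * n \<Longrightarrow> (S * R) $$ (j, i) = (if j = i then 1 else 0)"
    using implements_columns[OF R order_refl] by blast
  note Sc = orthogonal_groupD[OF S(1)] and Rc = orthogonal_groupD(1)[OF R]
  have "S * R = 1\<^sub>m (2 * n)" using Sc Rc cols by (intro eq_matI) (auto simp del: index_mult_mat(1))
  then have "transpose_mat S * (S * R) = transpose_mat S" using Sc by simp
  also have "transpose_mat S * (S * R) = (transpose_mat S * S) * R"
    using Sc(1) Rc by (simp add: assoc_mult_mat[of _ "2 * n" "2 * n" _ "2 * n" _ "2 * n"])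
  finally have "R = transpose_mat S" using Sc Rc by simp
  then show ?thesis using implements_adjoint[OF S(2,1)] by blast
qed

lemma implements_majorana_unitary:
  assumes R: "R \<in> orthogonal_group (2 * n)"
  shows "implements n (majorana_unitary n R) R"
  using someI_ex[OF implements_exists[OF R]]
  unfolding majorana_unitary_def implements_def majorana_sum_def .


section \<open>Second moments of Haar-random orthogonal matrices\<close>

lemma mat_borel_entry_measurable:
  assumes "i < r" "j < c"
  shows "(\<lambda>A. A $$ (i, j)) \<in> borel_measurable (mat_borel r c :: 'a::topological_space mat measure)"
proof -
  let ?f = "\<lambda>A :: 'a mat. \<lambda>ij \<in> {..<r} \<times> {..<c}. A $$ ij"
  have f: "?f \<in> measurable (mat_borel r c) (\<Pi>\<^sub>M ij \<in> {..<r} \<times> {..<c}. borel)"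
    unfolding mat_borel_def by (rule measurable_vimage_algebra1) (auto simp: space_PiM)
  have "(i, j) \<in> {..<r} \<times> {..<c}" using assms by simp
  from measurable_compose[OF f measurable_component_singleton[OF this]] show ?thesis
    using assms by simp
qed

lemma measurable_mat_borelI:
  assumes "\<And>w. w \<in> space M \<Longrightarrow> f w \<in> carrier_mat r c"
    and "\<And>i j. i < r \<Longrightarrow> j < c \<Longrightarrow> (\<lambda>w. f w $$ (i, j)) \<in> borel_measurable M"
  shows "f \<in> measurable M (mat_borel r c)"
  unfolding mat_borel_def
proof (rule measurable_vimage_algebra2)
  show "(\<lambda>w. \<lambda>ij \<in> {..<r} \<times> {..<c}. f w $$ ij) \<in> measurable M (\<Pi>\<^sub>M ij \<in> {..<r} \<times> {..<c}. borel)"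
    by (rule measurable_restrict) (use assms(2) in auto)
qed (use assms(1) in auto)

lemma haar_entry_measurable:
  assumes "haar_orthogonal m \<mu>" "i < m" "j < m"
  shows "(\<lambda>R. R $$ (i, j)) \<in> borel_measurable \<mu>"
proof -
  have "(\<lambda>R. R $$ (i, j)) \<in> borel_measurable (restrict_space (mat_borel m m) (orthogonal_group m))"
    using mat_borel_entry_measurable[OF assms(2,3)] by (rule measurable_restrict_space1)
  then show ?thesis
    using assms(1) measurable_cong_sets[of \<mu> "restrict_space (mat_borel m m) (orthogonal_group m)" borel borel]
    by (auto simp: haar_orthogonal_def)
qed

text \<open>Invariance is stated through \<open>distr\<close>; turning it into a change of variables
  under the integral takes this measurability, which holds because the entries of
  \<open>Q * R\<close> are linear in those of \<open>R\<close>.\<close>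

lemma haar_left_mult_measurable:
  assumes \<mu>: "haar_orthogonal m \<mu>" and Q: "Q \<in> orthogonal_group m"
  shows "(\<lambda>R. Q * R) \<in> measurable \<mu> \<mu>"
proof -
  have sp: "space \<mu> = orthogonal_group m"
    and st: "sets \<mu> = sets (restrict_space (mat_borel m m) (orthogonal_group m))"
    using \<mu> by (auto simp: haar_orthogonal_def)
  note Qc = orthogonal_groupD(1)[OF Q]
  have "(\<lambda>R. Q * R) \<in> measurable \<mu> (mat_borel m m)"
  proof (rule measurable_mat_borelI)
    fix i j assume ij: "i < m" "j < m"
    have "(\<lambda>R. \<Sum>k<m. Q $$ (i, k) * R $$ (k, j)) \<in> borel_measurable \<mu>"
      using haar_entry_measurable[OF \<mu>] ij by measurable
    moreover have "(Q * R) $$ (i, j) = (\<Sum>k<m. Q $$ (i, k) * R $$ (k, j))" if "R \<in> space \<mu>" for R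
      using that ij Qc orthogonal_groupD(1)[of R m] unfolding sp by (simp add: scalar_prod_def lessThan_atLeast0)
    ultimately show "(\<lambda>R. (Q * R) $$ (i, j)) \<in> borel_measurable \<mu>"
      by (subst measurable_cong) auto
  qed (use Qc in \<open>auto simp: sp dest: orthogonal_groupD(1)\<close>)
  then have "(\<lambda>R. Q * R) \<in> measurable \<mu> (restrict_space (mat_borel m m) (orthogonal_group m))"
    using Q by (intro measurable_restrict_space2) (auto simp: sp orthogonal_group_mult)
  then show ?thesis using measurable_cong_sets[OF refl st, of \<mu>] by simp
qed

lemma haar_integral_left_mult:
  fixes f :: "real mat \<Rightarrow> real"
  assumes \<mu>: "haar_orthogonal m \<mu>" and Q: "Q \<in> orthogonal_group m" and f: "f \<in> borel_measurable \<mu>"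
  shows "(\<integral>R. f (Q * R) \<partial>\<mu>) = (\<integral>R. f R \<partial>\<mu>)"
proof -
  have "distr \<mu> \<mu> (\<lambda>R. Q * R) = \<mu>" using \<mu> Q by (auto simp: haar_orthogonal_def)
  then show ?thesis using integral_distr[OF haar_left_mult_measurable[OF \<mu> Q] f] by simp
qed

lemma orthogonal_entry_bound:
  assumes "R \<in> orthogonal_group m" "i < m" "j < m"
  shows "\<bar>R $$ (i, j)\<bar> \<le> 1"
proof -
  have "R $$ (i, j) * R $$ (i, j) \<le> (\<Sum>k<m. R $$ (i, k) * R $$ (i, k))"
    using assms by (intro member_le_sum[of j "{..<m}" "\<lambda>k. R $$ (i, k) * R $$ (i, k)"]) auto
  then have "(R $$ (i, j))\<^sup>2 \<le> 1" using orthogonal_group_row[OF assms(1,2,2)] by (simp add: power2_eq_square)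
  then show ?thesis by (simp add: abs_square_le_1)
qed

lemma integral_double_sum:
  fixes f :: "'i \<Rightarrow> 'j \<Rightarrow> 'w \<Rightarrow> 'b::{banach, second_countable_topology}"
  assumes "\<And>i j. i \<in> I \<Longrightarrow> j \<in> J \<Longrightarrow> integrable M (f i j)"
  shows "(\<integral>x. (\<Sum>i\<in>I. \<Sum>j\<in>J. f i j x) \<partial>M) = (\<Sum>i\<in>I. \<Sum>j\<in>J. \<integral>x. f i j x \<partial>M)"
proof -
  have "(\<integral>x. (\<Sum>i\<in>I. \<Sum>j\<in>J. f i j x) \<partial>M) = (\<Sum>i\<in>I. \<integral>x. (\<Sum>j\<in>J. f i j x) \<partial>M)"
    by (rule Bochner_Integration.integral_sum)
      (use assms in \<open>auto intro: Bochner_Integration.integrable_sum\<close>)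
  also have "\<dots> = (\<Sum>i\<in>I. \<Sum>j\<in>J. \<integral>x. f i j x \<partial>M)"
    using assms by (intro sum.cong refl Bochner_Integration.integral_sum)
  finally show ?thesis .
qed

section \<open>Second moments of two-by-two minors\<close>

definition minor :: "nat \<Rightarrow> nat \<Rightarrow> nat \<Rightarrow> nat \<Rightarrow> real mat \<Rightarrow> real" where
  "minor a b i j R = R $$ (i, a) * R $$ (j, b) - R $$ (j, a) * R $$ (i, b)"

lemma minor_bound:
  assumes "R \<in> orthogonal_group m" "a < m" "b < m" "i < m" "j < m"
  shows "\<bar>minor a b i j R\<bar> \<le> 2"
proof -
  have "\<bar>R $$ (i, a) * R $$ (j, b)\<bar> \<le> 1" "\<bar>R $$ (j, a) * R $$ (i, b)\<bar> \<le> 1"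
    unfolding abs_mult using assms by (auto intro!: mult_le_one orthogonal_entry_bound)
  then show ?thesis unfolding minor_def by linarith
qed

lemma minor_measurable:
  assumes "haar_orthogonal m \<mu>" "a < m" "b < m" "i < m" "j < m"
  shows "minor a b i j \<in> borel_measurable \<mu>"
  unfolding minor_def[abs_def] using haar_entry_measurable[OF assms(1)] assms(2-) by measurable

lemma minor_mult_integrable:
  assumes \<mu>: "haar_orthogonal m \<mu>" and "a < m" "b < m" "i < m" "j < m" "k < m" "l < m"
  shows "integrable \<mu> (\<lambda>R. minor a b i j R * minor a b k l R)"
proof -
  interpret prob_space \<mu> using \<mu> by (simp add: haar_orthogonal_def)
  have "space \<mu> = orthogonal_group m" using \<mu> by (simp add: haar_orthogonal_def)
  then have "norm (minor a b i j R * minor a b k l R) \<le> 2 * 2" if "R \<in> space \<mu>" for R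
    unfolding real_norm_def abs_mult using that assms by (intro mult_mono minor_bound[of _ m]) auto
  then have "AE R in \<mu>. norm (minor a b i j R * minor a b k l R) \<le> 2 * 2" by (rule AE_I2)
  moreover have "(\<lambda>R. minor a b i j R * minor a b k l R) \<in> borel_measurable \<mu>"
    using minor_measurable[OF \<mu>] assms by (intro borel_measurable_times) auto
  ultimately show ?thesis by (rule integrable_const_bound)
qed

definition sign_flip :: "nat \<Rightarrow> nat \<Rightarrow> real mat" where
  "sign_flip m s = mat m m (\<lambda>(i, j). if i = j then if i = s then - 1 else 1 else 0)"

lemma sign_flip_mult_index:
  assumes "R \<in> carrier_mat m k" "i < m" "j < k"
  shows "(sign_flip m s * R) $$ (i, j) = (if i = s then - 1 else 1) * R $$ (i, j)"
proof -
  have "(sign_flip m s * R) $$ (i, j) = (\<Sum>l<m. (if i = l then if i = s then - 1 else 1 else 0) * R $$ (l, j))"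
    using assms by (simp add: sign_flip_def scalar_prod_def lessThan_atLeast0)
  also have "\<dots> = (\<Sum>l<m. if i = l then (if i = s then - 1 else 1) * R $$ (l, j) else 0)"
    by (intro sum.cong) auto
  finally show ?thesis using assms by simp
qed

lemma sign_flip_orthogonal: "sign_flip m s \<in> orthogonal_group m"
proof -
  have "sign_flip m s * transpose_mat (sign_flip m s) = 1\<^sub>m m"
  proof (rule eq_matI)
    fix i j assume "i < dim_row (1\<^sub>m m :: real mat)" "j < dim_col (1\<^sub>m m :: real mat)"
    then show "(sign_flip m s * transpose_mat (sign_flip m s)) $$ (i, j) = 1\<^sub>m m $$ (i, j)"
      by (subst sign_flip_mult_index[of _ m m]) (auto simp: sign_flip_def)
  qed (auto simp: sign_flip_def)
  then show ?thesis by (simp add: orthogonal_group_def sign_flip_def)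
qed

definition perm_mat :: "nat \<Rightarrow> (nat \<Rightarrow> nat) \<Rightarrow> real mat" where
  "perm_mat m \<pi> = mat m m (\<lambda>(i, j). if j = \<pi> i then 1 else 0)"

lemma perm_mat_mult_index:
  assumes "R \<in> carrier_mat m k" "i < m" "j < k" "\<pi> i < m"
  shows "(perm_mat m \<pi> * R) $$ (i, j) = R $$ (\<pi> i, j)"
proof -
  have "(perm_mat m \<pi> * R) $$ (i, j) = (\<Sum>l<m. (if l = \<pi> i then 1 else 0) * R $$ (l, j))"
    using assms by (simp add: perm_mat_def scalar_prod_def lessThan_atLeast0)
  also have "\<dots> = (\<Sum>l<m. if l = \<pi> i then R $$ (l, j) else 0)"
    by (intro sum.cong) auto
  finally show ?thesis using assms by simp
qed

lemma perm_mat_orthogonal: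
  assumes "\<pi> permutes {..<m}"
  shows "perm_mat m \<pi> \<in> orthogonal_group m"
proof -
  have lt: "\<pi> i < m \<longleftrightarrow> i < m" for i using permutes_in_image[OF assms, of i] by simp
  have inj: "\<pi> i = \<pi> j \<longleftrightarrow> i = j" for i j using permutes_inj[OF assms] by (auto dest: injD)
  have "perm_mat m \<pi> * transpose_mat (perm_mat m \<pi>) = 1\<^sub>m m"
  proof (rule eq_matI)
    fix i j assume "i < dim_row (1\<^sub>m m :: real mat)" "j < dim_col (1\<^sub>m m :: real mat)"
    then show "(perm_mat m \<pi> * transpose_mat (perm_mat m \<pi>)) $$ (i, j) = 1\<^sub>m m $$ (i, j)"
      by (subst perm_mat_mult_index[of _ m m]) (auto simp: perm_mat_def lt inj)
  qed (auto simp: perm_mat_def)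
  then show ?thesis by (simp add: orthogonal_group_def perm_mat_def)
qed

text \<open>Changing the sign of row \<open>i\<close> negates the first minor and leaves the second
  alone, as row \<open>i\<close> does not occur there. By invariance the integral equals its own
  negative.\<close>

lemma minor_cross_zero:
  assumes \<mu>: "haar_orthogonal m \<mu>" and lt: "a < m" "b < m" "i < m" "j < m" "k < m" "l < m"
    and ne: "i \<noteq> j" "i \<noteq> k" "i \<noteq> l"
  shows "(\<integral>R. minor a b i j R * minor a b k l R \<partial>\<mu>) = 0"
proof -
  let ?f = "\<lambda>R. minor a b i j R * minor a b k l R"
  have sp: "space \<mu> = orthogonal_group m" using \<mu> by (simp add: haar_orthogonal_def)
  have "(\<integral>R. ?f R \<partial>\<mu>) = (\<integral>R. ?f (sign_flip m i * R) \<partial>\<mu>)"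
    using haar_integral_left_mult[OF \<mu> sign_flip_orthogonal, of ?f i] minor_measurable[OF \<mu>] lt by simp
  also have "\<dots> = (\<integral>R. - ?f R \<partial>\<mu>)"
  proof (rule Bochner_Integration.integral_cong)
    fix R assume "R \<in> space \<mu>"
    then have "R \<in> carrier_mat m m" by (simp add: sp orthogonal_groupD(1))
    then show "?f (sign_flip m i * R) = - ?f R"
      using lt ne unfolding minor_def by (simp add: sign_flip_mult_index algebra_simps del: index_mult_mat(1))
  qed simp
  also have "\<dots> = - (\<integral>R. ?f R \<partial>\<mu>)" by simp
  finally show ?thesis by simp
qed

lemma minor_square_const:
  assumes \<mu>: "haar_orthogonal m \<mu>" and lt: "a < m" "b < m" "i < m" "j < m" "k < m" "l < m"
    and ne: "i \<noteq> j" "k \<noteq> l"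
  shows "(\<integral>R. (minor a b i j R)\<^sup>2 \<partial>\<mu>) = (\<integral>R. (minor a b k l R)\<^sup>2 \<partial>\<mu>)"
proof -
  \<comment> \<open>The permutation has to send \<open>i\<close> to \<open>k\<close> and
    \<open>j\<close> to \<open>l\<close> at once. The first transposition moves \<open>i\<close> to
    \<open>k\<close> and \<open>j\<close> to \<open>j'\<close>; the second moves \<open>j'\<close>
    to \<open>l\<close> and fixes \<open>k\<close>, which differs from both.\<close>
  define j' where "j' = Transposition.transpose i k j"
  define \<pi> where "\<pi> = Transposition.transpose j' l \<circ> Transposition.transpose i k"
  have sp: "space \<mu> = orthogonal_group m" using \<mu> by (simp add: haar_orthogonal_def)
  have j': "j' < m" "j' \<noteq> k" using lt ne by (auto simp: j'_def Transposition.transpose_def)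
  have \<pi>: "\<pi> permutes {..<m}"
    unfolding \<pi>_def using lt j' by (auto intro: permutes_compose permutes_swap_id)
  have \<pi>ij: "\<pi> i = k" "\<pi> j = l"
    using j' ne by (auto simp: \<pi>_def j'_def[symmetric])
  have "(\<integral>R. (minor a b i j R)\<^sup>2 \<partial>\<mu>) = (\<integral>R. (minor a b i j (perm_mat m \<pi> * R))\<^sup>2 \<partial>\<mu>)"
    using haar_integral_left_mult[OF \<mu> perm_mat_orthogonal[OF \<pi>], of "\<lambda>R. (minor a b i j R)\<^sup>2"]
      minor_measurable[OF \<mu>] lt by simp
  also have "\<dots> = (\<integral>R. (minor a b k l R)\<^sup>2 \<partial>\<mu>)"
  proof (rule Bochner_Integration.integral_cong)
    fix R assume "R \<in> space \<mu>"
    then have "R \<in> carrier_mat m m" by (simp add: sp orthogonal_groupD(1))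
    then show "(minor a b i j (perm_mat m \<pi> * R))\<^sup>2 = (minor a b k l R)\<^sup>2"
      using lt \<pi>ij unfolding minor_def by (simp add: perm_mat_mult_index del: index_mult_mat(1))
  qed simp
  finally show ?thesis .
qed

text \<open>Lagrange's identity: for columns x and y the sum is 2(|x|^2 |y|^2 - (x.y)^2), and here x
  and y are orthonormal.\<close>

lemma minor_square_sum:
  assumes R: "R \<in> orthogonal_group m" and ab: "a < m" "b < m" "a \<noteq> b"
  shows "(\<Sum>i<m. \<Sum>j<m. (minor a b i j R)\<^sup>2) = 2"
proof -
  let ?x = "\<lambda>i. R $$ (i, a)" and ?y = "\<lambda>i. R $$ (i, b)"
  have "(\<Sum>i<m. \<Sum>j<m. (minor a b i j R)\<^sup>2) =
      (\<Sum>i<m. \<Sum>j<m. (?x i * ?x i) * (?y j * ?y j) + (?y i * ?y i) * (?x j * ?x j) - 2 * ((?x i * ?y i) * (?x j * ?y j)))"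
    unfolding minor_def by (intro sum.cong refl) (simp add: power2_eq_square algebra_simps)
  also have "\<dots> = (\<Sum>i<m. ?x i * ?x i) * (\<Sum>j<m. ?y j * ?y j) + (\<Sum>i<m. ?y i * ?y i) * (\<Sum>j<m. ?x j * ?x j)
      - 2 * ((\<Sum>i<m. ?x i * ?y i) * (\<Sum>j<m. ?x j * ?y j))"
    by (simp only: sum_product sum.distrib sum_subtractf sum_distrib_left[of 2])
  also have "\<dots> = 2"
    using orthogonal_group_col[OF R] ab by simp
  finally show ?thesis .
qed

text \<open>Left invariance under signed permutation matrices suffices: sign flips kill the mixed
  moments of the minors, and permutations make their second moments equal.\<close>

lemma haar_minor_sum_square:
  assumes \<mu>: "haar_orthogonal (2 * n) \<mu>" and ab: "a < 2 * n" "b < 2 * n" "a \<noteq> b"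
  shows "(\<integral>R. (\<Sum>k<n. minor a b (2 * k) (2 * k + 1) R)\<^sup>2 \<partial>\<mu>) = 1 / (2 * real n - 1)"
proof -
  let ?m = "2 * n"
  have n: "n > 0" using ab by simp
  interpret prob_space \<mu> using \<mu> by (simp add: haar_orthogonal_def)
  have sp: "space \<mu> = orthogonal_group ?m" using \<mu> by (simp add: haar_orthogonal_def)
  note int = minor_mult_integrable[OF \<mu> ab(1,2)]
  define q where "q = (\<integral>R. (minor a b 0 1 R)\<^sup>2 \<partial>\<mu>)"
  have qq: "(\<integral>R. (minor a b i j R)\<^sup>2 \<partial>\<mu>) = (if i = j then 0 else q)" if "i < ?m" "j < ?m" for i j
    using minor_square_const[OF \<mu> ab(1,2) that, of 0 1] n by (auto simp: q_def minor_def)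
  have "2 = (\<integral>R. (\<Sum>i<?m. \<Sum>j<?m. (minor a b i j R)\<^sup>2) \<partial>\<mu>)"
  proof -
    have "(\<integral>R. (\<Sum>i<?m. \<Sum>j<?m. (minor a b i j R)\<^sup>2) \<partial>\<mu>) = (\<integral>R. 2 \<partial>\<mu>)"
      using minor_square_sum[OF _ ab] by (intro Bochner_Integration.integral_cong) (auto simp: sp)
    then show ?thesis by (simp add: prob_space)
  qed
  also have "\<dots> = (\<Sum>i<?m. \<Sum>j<?m. (\<integral>R. (minor a b i j R)\<^sup>2 \<partial>\<mu>))"
    using int unfolding power2_eq_square by (intro integral_double_sum) auto
  also have "\<dots> = (\<Sum>i<?m. \<Sum>j<?m. q - (if i = j then q else 0))"
    using qq by (intro sum.cong refl) auto
  \<comment> \<open>The diagonal minors vanish, which leaves one copy of \<open>q\<close> for each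
    ordered pair of distinct rows.\<close>
  also have "\<dots> = real ?m * (real ?m - 1) * q"
    by (simp add: sum_subtractf algebra_simps)
  finally have q: "real n * (2 * real n - 1) * q = 1" by (simp add: algebra_simps)
  have "(\<integral>R. (\<Sum>k<n. minor a b (2 * k) (2 * k + 1) R)\<^sup>2 \<partial>\<mu>) =
      (\<integral>R. (\<Sum>k<n. \<Sum>l<n. minor a b (2 * k) (2 * k + 1) R * minor a b (2 * l) (2 * l + 1) R) \<partial>\<mu>)"
    by (simp add: power2_eq_square sum_product)
  also have "\<dots> = (\<Sum>k<n. \<Sum>l<n. (\<integral>R. minor a b (2 * k) (2 * k + 1) R * minor a b (2 * l) (2 * l + 1) R \<partial>\<mu>))"
    using int by (intro integral_double_sum) auto
  also have "\<dots> = (\<Sum>k<n. \<Sum>l<n. if k = l then q else 0)"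
  proof (intro sum.cong refl)
    fix k l assume kl: "k \<in> {..<n}" "l \<in> {..<n}"
    show "(\<integral>R. minor a b (2 * k) (2 * k + 1) R * minor a b (2 * l) (2 * l + 1) R \<partial>\<mu>) = (if k = l then q else 0)"
    proof (cases "k = l")
      case True
      then show ?thesis using qq[of "2 * k" "2 * k + 1"] kl by (simp add: power2_eq_square)
    next
      case False
      \<comment> \<open>Row \<open>2 * k\<close> is missing from the other minor, so the sign flip
        of this row applies.\<close>
      then have "2 * k \<noteq> 2 * l + 1" by presburger
      then show ?thesis using False kl by (simp add: minor_cross_zero[OF \<mu> ab(1,2)])
    qed
  qed
  also have "\<dots> = real n * q" by simp
  also have "\<dots> = 1 / (2 * real n - 1)"
    using q n by (simp add: field_simps)
  finally show ?thesis .
qed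


section \<open>Second moments of random states\<close>

definition mat_trace :: "complex mat \<Rightarrow> complex" where
  "mat_trace A = (\<Sum>i<dim_row A. A $$ (i, i))"

lemma mat_trace_mult:
  assumes "A \<in> carrier_mat n m" "B \<in> carrier_mat m n"
  shows "mat_trace (A * B) = (\<Sum>i<n. \<Sum>k<m. A $$ (i, k) * B $$ (k, i))"
  using assms by (auto simp: mat_trace_def scalar_prod_def lessThan_atLeast0 intro!: sum.cong)

lemma mat_trace_comm:
  assumes "A \<in> carrier_mat n m" "B \<in> carrier_mat m n"
  shows "mat_trace (A * B) = mat_trace (B * A)"
  unfolding mat_trace_mult[OF assms] mat_trace_mult[OF assms(2,1)]
  by (subst sum.swap) (simp add: mult.commute)

lemma mat_trace_add:
  "A \<in> carrier_mat n n \<Longrightarrow> B \<in> carrier_mat n n \<Longrightarrow> mat_trace (A + B) = mat_trace A + mat_trace B"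
  by (simp add: mat_trace_def sum.distrib)

lemma mat_trace_minus:
  "A \<in> carrier_mat n n \<Longrightarrow> B \<in> carrier_mat n n \<Longrightarrow> mat_trace (A - B) = mat_trace A - mat_trace B"
  by (simp add: mat_trace_def sum_subtractf)

lemma mat_trace_smult: "A \<in> carrier_mat n n \<Longrightarrow> mat_trace (c \<cdot>\<^sub>m A) = c * mat_trace A"
  by (simp add: mat_trace_def sum_distrib_left)

lemma mat_trace_kron:
  assumes "A \<in> carrier_mat a a" "B \<in> carrier_mat b b"
  shows "mat_trace (kron A B) = mat_trace A * mat_trace B"
proof -
  have "mat_trace (kron A B) = (\<Sum>i<a. \<Sum>j<b. kron A B $$ (i * b + j, i * b + j))"
    using assms by (simp add: mat_trace_def sum_lessThan_mult del: index_kron)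
  also have "\<dots> = (\<Sum>i<a. \<Sum>j<b. A $$ (i, i) * B $$ (j, j))"
    using assms by (intro sum.cong refl index_kron_split) auto
  finally show ?thesis using assms by (simp add: mat_trace_def sum_product)
qed

lemma zero_state_carrier [simp]: "zero_state n \<in> carrier_mat (2 ^ n) (2 ^ n)"
  by (simp add: zero_state_def)

lemma dim_zero_state [simp]: "dim_row (zero_state n) = 2 ^ n" "dim_col (zero_state n) = 2 ^ n"
  by (simp_all add: zero_state_def)

definition pure_state :: "nat \<Rightarrow> complex mat \<Rightarrow> complex mat" where
  "pure_state n U = U * zero_state n * mat_adjoint U"

lemma pure_state_carrier [simp]: "U \<in> carrier_mat (2 ^ n) (2 ^ n) \<Longrightarrow> pure_state n U \<in> carrier_mat (2 ^ n) (2 ^ n)"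
  by (simp add: pure_state_def)

lemma dim_pure_state [simp]: "dim_row (pure_state n U) = dim_row U" "dim_col (pure_state n U) = dim_row U"
  by (simp_all add: pure_state_def)

lemma pure_state_index:
  assumes "U \<in> carrier_mat (2 ^ n) (2 ^ n)" "a < 2 ^ n" "b < 2 ^ n"
  shows "pure_state n U $$ (a, b) = U $$ (a, 0) * cnj (U $$ (b, 0))"
proof -
  have 1: "(U * zero_state n) $$ (a, c) = (if c = 0 then U $$ (a, 0) else 0)" if c: "c < 2 ^ n" for c
  proof -
    have "(U * zero_state n) $$ (a, c) = (\<Sum>k<2 ^ n. U $$ (a, k) * zero_state n $$ (k, c))"
      using assms c by (intro index_mult_sum) auto
    also have "\<dots> = (\<Sum>k<2 ^ n. if k = 0 then (if c = 0 then U $$ (a, k) else 0) else 0)"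
      using c by (intro sum.cong) (auto simp: zero_state_def)
    finally show ?thesis by simp
  qed
  have "pure_state n U $$ (a, b) = (\<Sum>c<2 ^ n. (U * zero_state n) $$ (a, c) * mat_adjoint U $$ (c, b))"
    unfolding pure_state_def using assms by (intro index_mult_sum) auto
  also have "\<dots> = (\<Sum>c<(2::nat) ^ n. if c = 0 then U $$ (a, 0) * cnj (U $$ (b, 0)) else 0)"
    using assms by (intro sum.cong refl) (auto simp: 1 simp del: index_mult_mat(1))
  finally show ?thesis by simp
qed

text \<open>The passage from the Schroedinger to the Heisenberg picture: expectations in the evolved
  state become the top left entry of the evolved observable.\<close>

lemma mat_trace_pure_state:
  assumes U: "U \<in> carrier_mat (2 ^ n) (2 ^ n)" and C: "C \<in> carrier_mat (2 ^ n) (2 ^ n)"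
  shows "mat_trace (C * pure_state n U) = (mat_adjoint U * C * U) $$ (0, 0)"
proof -
  have entry: "(mat_adjoint U * C * U) $$ (0, 0) = (\<Sum>i<2 ^ n. \<Sum>k<2 ^ n. cnj (U $$ (i, 0)) * (C $$ (i, k) * U $$ (k, 0)))"
  proof -
    have "(mat_adjoint U * C * U) $$ (0, 0) = (mat_adjoint U * (C * U)) $$ (0, 0)"
      using assms by (simp add: assoc_mult_mat[of _ "2 ^ n" "2 ^ n" _ "2 ^ n" _ "2 ^ n"])
    also have "\<dots> = (\<Sum>i<2 ^ n. mat_adjoint U $$ (0, i) * (C * U) $$ (i, 0))"
      using assms by (intro index_mult_sum) auto
    also have "\<dots> = (\<Sum>i<2 ^ n. \<Sum>k<2 ^ n. cnj (U $$ (i, 0)) * (C $$ (i, k) * U $$ (k, 0)))"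
      using assms by (intro sum.cong refl) (simp add: index_mult_sum[of C "2 ^ n" "2 ^ n"] sum_distrib_left del: index_mult_mat(1))
    finally show ?thesis .
  qed
  have "mat_trace (C * pure_state n U) = (\<Sum>i<2 ^ n. \<Sum>k<2 ^ n. C $$ (i, k) * pure_state n U $$ (k, i))"
    using assms by (intro mat_trace_mult) auto
  also have "\<dots> = (\<Sum>i<2 ^ n. \<Sum>k<2 ^ n. cnj (U $$ (i, 0)) * (C $$ (i, k) * U $$ (k, 0)))"
    using U by (intro sum.cong refl) (simp add: pure_state_index)
  finally show ?thesis unfolding entry .
qed

lemma mat_trace_expectation:
  assumes A: "A \<in> carrier_mat N N" and F: "\<And>w. w \<in> space M \<Longrightarrow> F w \<in> carrier_mat N N"
    and int: "\<And>i j. i < N \<Longrightarrow> j < N \<Longrightarrow> integrable M (\<lambda>w. F w $$ (i, j))"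
  shows "mat_trace (A * mat_expectation N M F) = (\<integral>w. mat_trace (A * F w) \<partial>M)"
proof -
  have "mat_trace (A * mat_expectation N M F) = (\<Sum>i<N. \<Sum>k<N. A $$ (i, k) * (\<integral>w. F w $$ (k, i) \<partial>M))"
    using A by (subst mat_trace_mult[of _ N N]) (auto simp: mat_expectation_def)
  also have "\<dots> = (\<Sum>i<N. \<Sum>k<N. \<integral>w. A $$ (i, k) * F w $$ (k, i) \<partial>M)"
    by simp
  also have "\<dots> = (\<integral>w. (\<Sum>i<N. \<Sum>k<N. A $$ (i, k) * F w $$ (k, i)) \<partial>M)"
    using int by (intro integral_double_sum[symmetric]) auto
  also have "\<dots> = (\<integral>w. mat_trace (A * F w) \<partial>M)"
    using A F by (intro Bochner_Integration.integral_cong refl) (simp add: mat_trace_mult)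
  finally show ?thesis .
qed

text \<open>The common form of \<sigma> and \<tau>: the former arises with
  \<open>V = majorana_unitary n\<close>, the latter with \<open>V\<close> the identity map on the
  ensemble.\<close>

definition state_moment :: "nat \<Rightarrow> 'w measure \<Rightarrow> ('w \<Rightarrow> complex mat) \<Rightarrow> complex mat" where
  "state_moment n M V = mat_expectation (2 ^ n * 2 ^ n) M (\<lambda>w. kron (pure_state n (V w)) (pure_state n (V w)))"

lemma state_moment_carrier [simp]: "state_moment n M V \<in> carrier_mat (2 ^ n * 2 ^ n) (2 ^ n * 2 ^ n)"
  by (simp add: state_moment_def mat_expectation_def)

text \<open>The trace of a product observable against two copies of one state factors into a square.
  Unitarity is assumed almost everywhere only, to cover ensembles; measurability is asked of the
  state and not of \<open>V\<close>, to cover the choice in \<open>majorana_unitary\<close>.\<close>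

lemma state_moment_trace:
  assumes M: "prob_space M" and V: "\<And>w. w \<in> space M \<Longrightarrow> V w \<in> carrier_mat (2 ^ n) (2 ^ n)"
    and unit: "AE w in M. unitary (2 ^ n) (V w)"
    and meas: "\<And>a b. a < 2 ^ n \<Longrightarrow> b < 2 ^ n \<Longrightarrow> (\<lambda>w. pure_state n (V w) $$ (a, b)) \<in> borel_measurable M"
    and C: "C \<in> carrier_mat (2 ^ n) (2 ^ n)"
  shows "mat_trace (kron C C * state_moment n M V) = (\<integral>w. ((mat_adjoint (V w) * C * V w) $$ (0, 0))\<^sup>2 \<partial>M)"
proof -
  interpret prob_space M by (rule M)
  let ?N = "2 ^ n :: nat"
  have int: "integrable M (\<lambda>w. kron (pure_state n (V w)) (pure_state n (V w)) $$ (i, j))"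
    if ij: "i < ?N * ?N" "j < ?N * ?N" for i j
  proof -
    note s = mult_bound_split[OF ij(1)] mult_bound_split[OF ij(2)]
    let ?g = "\<lambda>w. pure_state n (V w) $$ (i div ?N, j div ?N) * pure_state n (V w) $$ (i mod ?N, j mod ?N)"
    have eq: "kron (pure_state n (V w)) (pure_state n (V w)) $$ (i, j) = ?g w" if "w \<in> space M" for w
      using carrier_matD[OF V[OF that]] ij by simp
    have "AE w in M. norm (?g w) \<le> 1"
      using unit
    proof eventually_elim
      case (elim w)
      have "cmod (pure_state n (V w) $$ (a, b)) \<le> 1" if "a < ?N" "b < ?N" for a b
        using that unitary_carrier[OF elim]
        by (auto simp: pure_state_index norm_mult intro!: mult_le_one unitary_entry_bound[OF elim])
      then show ?case unfolding norm_mult using s by (intro mult_le_one) auto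
    qed
    moreover have "?g \<in> borel_measurable M" using meas s by (intro borel_measurable_times) auto
    ultimately have "integrable M ?g" by (rule integrable_const_bound)
    then show ?thesis using eq by (subst Bochner_Integration.integrable_cong[OF refl eq]) auto
  qed
  have "mat_trace (kron C C * state_moment n M V) =
      (\<integral>w. mat_trace (kron C C * kron (pure_state n (V w)) (pure_state n (V w))) \<partial>M)"
    unfolding state_moment_def using C V int
    by (intro mat_trace_expectation kron_carrier pure_state_carrier) auto
  also have "\<dots> = (\<integral>w. ((mat_adjoint (V w) * C * V w) $$ (0, 0))\<^sup>2 \<partial>M)"
  proof (intro Bochner_Integration.integral_cong refl)
    fix w assume "w \<in> space M"
    note Vw = V[OF this]
    have "kron C C * kron (pure_state n (V w)) (pure_state n (V w)) = kron (C * pure_state n (V w)) (C * pure_state n (V w))"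
      using C pure_state_carrier[OF Vw] by (intro kron_mult) auto
    then show "mat_trace (kron C C * kron (pure_state n (V w)) (pure_state n (V w))) =
        ((mat_adjoint (V w) * C * V w) $$ (0, 0))\<^sup>2"
      using C pure_state_carrier[OF Vw]
      by (simp add: mat_trace_kron[of _ ?N _ ?N] mat_trace_pure_state[OF Vw C] power2_eq_square del: index_mult_mat(1))
  qed
  finally show ?thesis .
qed

lemma state_moment_trace_one:
  assumes M: "prob_space M" and V: "\<And>w. w \<in> space M \<Longrightarrow> V w \<in> carrier_mat (2 ^ n) (2 ^ n)"
    and unit: "AE w in M. unitary (2 ^ n) (V w)"
    and meas: "\<And>a b. a < 2 ^ n \<Longrightarrow> b < 2 ^ n \<Longrightarrow> (\<lambda>w. pure_state n (V w) $$ (a, b)) \<in> borel_measurable M"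
  shows "mat_trace (state_moment n M V) = 1"
proof -
  interpret prob_space M by (rule M)
  let ?N = "2 ^ n :: nat"
  let ?g = "\<lambda>w. ((mat_adjoint (V w) * 1\<^sub>m ?N * V w) $$ (0, 0))\<^sup>2"
  have eq: "?g w = (\<Sum>i<?N. pure_state n (V w) $$ (i, i))\<^sup>2" if "w \<in> space M" for w
    using V[OF that] unfolding mat_trace_pure_state[OF V[OF that] one_carrier_mat, symmetric]
    by (simp add: left_mult_one_mat[OF pure_state_carrier[OF V[OF that]]] mat_trace_def del: index_mult_mat(1))
  have "?g \<in> borel_measurable M"
    by (subst measurable_cong[OF eq]) (use meas in \<open>auto intro!: borel_measurable_power borel_measurable_sum\<close>)
  moreover have "AE w in M. ?g w = 1"
    using unit by eventually_elim
      (auto simp: unitary_def right_mult_one_mat[of _ ?N ?N] simp del: index_mult_mat(1))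
  ultimately have "(\<integral>w. ?g w \<partial>M) = (\<integral>w. 1 \<partial>M)" by (intro integral_cong_AE) auto
  then have "mat_trace (kron (1\<^sub>m ?N) (1\<^sub>m ?N) * state_moment n M V) = 1"
    by (subst state_moment_trace[OF M V unit meas one_carrier_mat]) (auto simp: prob_space simp del: index_mult_mat(1))
  then show ?thesis
    by (simp add: kron_one_one left_mult_one_mat[OF state_moment_carrier])
qed

subsection \<open>The Haar-random state\<close>

text \<open>A detour around the choice operator: the entries of \<open>majorana_unitary n R\<close>
  are not known to be measurable in \<open>R\<close>, but conjugation by it acts on this algebra
  through polynomials in the entries of \<open>R\<close>.\<close>

inductive_set majorana_algebra :: "nat \<Rightarrow> complex mat set" for n where
  one: "1\<^sub>m (2 ^ n) \<in> majorana_algebra n"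
| gen: "majorana n k \<in> majorana_algebra n" if "k < 2 * n"
| add: "A + B \<in> majorana_algebra n" if "A \<in> majorana_algebra n" "B \<in> majorana_algebra n"
| smult: "c \<cdot>\<^sub>m A \<in> majorana_algebra n" if "A \<in> majorana_algebra n"
| mult: "A * B \<in> majorana_algebra n" if "A \<in> majorana_algebra n" "B \<in> majorana_algebra n"

lemma majorana_algebra_carrier: "A \<in> majorana_algebra n \<Longrightarrow> A \<in> carrier_mat (2 ^ n) (2 ^ n)"
  by (induction rule: majorana_algebra.induct) auto

lemma majorana_algebra_kron:
  assumes "A \<in> majorana_algebra n"
  shows "kron (1\<^sub>m 2) A \<in> majorana_algebra (Suc n)"
  using assms
proof induction
  case one
  then show ?case using majorana_algebra.one[of "Suc n"] by (simp add: kron_one_one)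
next
  case (gen k)
  \<comment> \<open>The first two Majorana operators multiply to \<open>\<i>\<close> times Z on the
    first qubit, which cancels the Z in front of the shifted operator; the scalar cancels
    \<open>\<i>\<close>.\<close>
  have "kron (1\<^sub>m 2) (majorana n k) = (- \<i>) \<cdot>\<^sub>m (majorana (Suc n) 0 * majorana (Suc n) (Suc 0) * majorana (Suc n) (Suc (Suc k)))"
    by (simp add: majorana_rec kron_mult_dim pauli_mult smult_mult_left kron_smult_left smult_smult_mat)
  then show ?case using gen by (auto intro!: majorana_algebra.intros)
next
  case (add A B)
  then show ?case
    using majorana_algebra_carrier[of A n] majorana_algebra_carrier[of B n]
    by (simp add: kron_add_right[of _ 2 2 _ "2 ^ n" "2 ^ n"] majorana_algebra.add)
next
  case (smult A c)
  then show ?case by (simp add: kron_smult_right majorana_algebra.smult)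
next
  case (mult A B)
  then have "kron (1\<^sub>m 2) (A * B) = kron (1\<^sub>m 2) A * kron (1\<^sub>m 2) B"
    using majorana_algebra_carrier[of A n] majorana_algebra_carrier[of B n] by (simp add: kron_mult_dim)
  then show ?case using mult by (simp add: majorana_algebra.mult)
qed

lemma zero_state_Suc: "zero_state (Suc n) = kron (zero_state 1) (zero_state n)"
proof (rule eq_mat_kronI[of _ 2 "2 ^ n" 2 "2 ^ n"])
  fix i j k l :: nat assume "i < 2" "j < 2 ^ n" "k < 2" "l < 2 ^ n"
  then show "zero_state (Suc n) $$ (i * 2 ^ n + j, k * 2 ^ n + l) =
      kron (zero_state 1) (zero_state n) $$ (i * 2 ^ n + j, k * 2 ^ n + l)"
    using mult_add_bound[of i 2 j "2 ^ n"] mult_add_bound[of k 2 l "2 ^ n"]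
    by (subst index_kron_split[of _ 2 2 _ "2 ^ n" "2 ^ n"]) (auto simp: zero_state_def)
qed (auto simp: zero_state_def)

lemma zero_state_in_majorana_algebra: "zero_state n \<in> majorana_algebra n"
proof (induction n)
  case 0
  have "zero_state 0 = 1\<^sub>m (2 ^ 0)" by (rule eq_matI) (auto simp: zero_state_def)
  then show ?case using majorana_algebra.one[of 0] by simp
next
  case (Suc n)
  let ?P = "kron (zero_state 1) (1\<^sub>m (2 ^ n))"
  \<comment> \<open>The projector on one qubit is (1 + Z)/2, and Z there is \<open>- \<i>\<close>
    times the product of the first two Majorana operators.\<close>
  have "zero_state 1 = (1 / 2) \<cdot>\<^sub>m (1\<^sub>m 2 + pauli_Z)"
    by (rule eq_mat2I) (auto simp: zero_state_def index_pauli)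
  then have "?P = (1 / 2) \<cdot>\<^sub>m (1\<^sub>m (2 ^ Suc n) + (- \<i>) \<cdot>\<^sub>m (majorana (Suc n) 0 * majorana (Suc n) (Suc 0)))"
    by (simp add: majorana_rec kron_mult_dim pauli_mult kron_smult_left smult_smult_mat kron_one_one[symmetric]
        kron_add_left[of _ 2 2 _ _ "2 ^ n" "2 ^ n"])
  moreover have "1\<^sub>m (2 ^ Suc n) + (- \<i>) \<cdot>\<^sub>m (majorana (Suc n) 0 * majorana (Suc n) (Suc 0)) \<in> majorana_algebra (Suc n)"
    by (intro majorana_algebra.intros) auto
  ultimately have "?P \<in> majorana_algebra (Suc n)" by (simp only: majorana_algebra.smult)
  moreover have "zero_state (Suc n) = ?P * kron (1\<^sub>m 2) (zero_state n)"
    unfolding zero_state_Suc[of n] by (subst kron_mult_dim) (simp_all add: right_mult_one_mat[of _ 2 2]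
        left_mult_one_mat[of _ "2 ^ n" "2 ^ n"])
  ultimately show ?case using majorana_algebra_kron[OF Suc] by (simp add: majorana_algebra.mult)
qed

text \<open>A generator becomes a linear combination with coefficients from a row of
  \<open>R\<close>, whichever implementing unitary was chosen. In a product, inserting
  \<open>mat_adjoint U * U = 1\<close> splits the conjugate into a product of conjugates.\<close>

lemma majorana_algebra_conj_measurable:
  assumes \<mu>: "haar_orthogonal (2 * n) \<mu>" and A: "A \<in> majorana_algebra n" and ab: "a < 2 ^ n" "b < 2 ^ n"
  shows "(\<lambda>R. (majorana_unitary n R * A * mat_adjoint (majorana_unitary n R)) $$ (a, b)) \<in> borel_measurable \<mu>"
  using A ab
proof (induction arbitrary: a b)
  let ?N = "2 ^ n :: nat" and ?U = "majorana_unitary n"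
  have sp: "space \<mu> = orthogonal_group (2 * n)" using \<mu> by (simp add: haar_orthogonal_def)
  have imp: "implements n (?U R) R" if "R \<in> space \<mu>" for R
    using that sp implements_majorana_unitary by simp
  have U: "?U R \<in> carrier_mat ?N ?N" "?U R * mat_adjoint (?U R) = 1\<^sub>m ?N" "unitary ?N (mat_adjoint (?U R))"
    if "R \<in> space \<mu>" for R
    using imp[OF that] by (auto simp: implements_def unitary_def)
  {
    case one
    have eq: "(?U R * 1\<^sub>m ?N * mat_adjoint (?U R)) $$ (a, b) = 1\<^sub>m ?N $$ (a, b)" if "R \<in> space \<mu>" for R
      using U(1,2)[OF that] by (simp only: right_mult_one_mat)
    show ?case by (subst measurable_cong[OF eq]) auto
  next
    case (gen k)
    have "(\<lambda>R. \<Sum>j<2 * n. complex_of_real (R $$ (k, j)) * majorana n j $$ (a, b)) \<in> borel_measurable \<mu>"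
      using gen haar_entry_measurable[OF \<mu>]
      by (intro borel_measurable_sum borel_measurable_times borel_measurable_const) auto
    then show ?case using gen imp
      by (subst measurable_cong[where g = "\<lambda>R. \<Sum>j<2 * n. complex_of_real (R $$ (k, j)) * majorana n j $$ (a, b)"])
        (auto simp: implements_def majorana_sum_def simp del: index_mult_mat(1))
  next
    case (add A B)
    note c = majorana_algebra_carrier[OF add(1)] majorana_algebra_carrier[OF add(2)]
    have eq: "(?U R * (A + B) * mat_adjoint (?U R)) $$ (a, b) =
        (?U R * A * mat_adjoint (?U R)) $$ (a, b) + (?U R * B * mat_adjoint (?U R)) $$ (a, b)" if "R \<in> space \<mu>" for R
      using U(1)[OF that] c add(5,6)
      by (simp add: mult_add_distrib_mat[of _ ?N ?N _ ?N] add_mult_distrib_mat[of _ ?N ?N _ _ ?N] del: index_mult_mat(1))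
    show ?case
      by (subst measurable_cong[OF eq]) (auto intro!: borel_measurable_add add(3)[OF add(5,6)] add(4)[OF add(5,6)])
  next
    case (smult A x)
    note c = majorana_algebra_carrier[OF smult(1)]
    have eq: "(?U R * (x \<cdot>\<^sub>m A) * mat_adjoint (?U R)) $$ (a, b) =
        x * (?U R * A * mat_adjoint (?U R)) $$ (a, b)" if "R \<in> space \<mu>" for R
      using U(1)[OF that] c smult(3,4) by (simp add: smult_mult_left smult_mult_right del: index_mult_mat(1))
    show ?case
      by (subst measurable_cong[OF eq]) (auto intro!: borel_measurable_times smult(2)[OF smult(3,4)])
  next
    case (mult A B)
    note c = majorana_algebra_carrier[OF mult(1)] majorana_algebra_carrier[OF mult(2)]
    have eq: "(?U R * (A * B) * mat_adjoint (?U R)) $$ (a, b) =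
        (\<Sum>k<?N. (?U R * A * mat_adjoint (?U R)) $$ (a, k) * (?U R * B * mat_adjoint (?U R)) $$ (k, b))"
      if "R \<in> space \<mu>" for R
    proof -
      have "?U R * (A * B) * mat_adjoint (?U R) = (?U R * A * mat_adjoint (?U R)) * (?U R * B * mat_adjoint (?U R))"
        using conj_mult_inner[OF U(3)[OF that] c] by simp
      moreover have "(X * Y) $$ (a, b) = (\<Sum>k<?N. X $$ (a, k) * Y $$ (k, b))"
        if "X \<in> carrier_mat ?N ?N" "Y \<in> carrier_mat ?N ?N" for X Y :: "complex mat"
        using that mult(5,6) by (simp add: scalar_prod_def lessThan_atLeast0)
      ultimately show ?thesis using U(1)[OF that] c by (simp del: index_mult_mat(1))
    qed
    have "(\<lambda>R. \<Sum>k<?N. (?U R * A * mat_adjoint (?U R)) $$ (a, k) * (?U R * B * mat_adjoint (?U R)) $$ (k, b))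
        \<in> borel_measurable \<mu>"
      using mult(3)[OF mult(5)] mult(4)[OF _ mult(6)] by (intro borel_measurable_sum borel_measurable_times) auto
    then show ?case by (subst measurable_cong[OF eq])
  }
qed


section \<open>The observable on the two ends of the line and its two expectations\<close>

definition edge_correlator :: "nat \<Rightarrow> complex mat" where
  "edge_correlator n = (- \<i>) \<cdot>\<^sub>m (majorana n 0 * majorana n (2 * n - 1))"

lemma edge_correlator_carrier [simp]: "edge_correlator n \<in> carrier_mat (2 ^ n) (2 ^ n)"
  by (simp add: edge_correlator_def)

lemma mat_adjoint_edge_correlator:
  assumes "n > 0"
  shows "mat_adjoint (edge_correlator n) = edge_correlator n"
proof -
  have "mat_adjoint (edge_correlator n) = \<i> \<cdot>\<^sub>m (majorana n (2 * n - 1) * majorana n 0)"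
    by (simp add: edge_correlator_def mat_adjoint_smult mat_adjoint_mult[of _ "2 ^ n" "2 ^ n" _ "2 ^ n"])
  also have "majorana n (2 * n - 1) * majorana n 0 = (- 1) \<cdot>\<^sub>m (majorana n 0 * majorana n (2 * n - 1))"
    using assms by (intro majorana_anticommute) auto
  finally show ?thesis by (simp add: edge_correlator_def smult_smult_mat)
qed

lemma edge_correlator_square:
  assumes "n > 0"
  shows "edge_correlator n * edge_correlator n = 1\<^sub>m (2 ^ n)"
proof -
  let ?a = "majorana n 0" and ?b = "majorana n (2 * n - 1)" and ?N = "2 ^ n :: nat"
  have ba: "?b * ?a = (- 1) \<cdot>\<^sub>m (?a * ?b)"
    using assms by (intro majorana_anticommute) auto
  have "?a * ?b * (?a * ?b) = ?a * (?b * ?a) * ?b"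
    by (simp add: assoc_mult_mat[of _ ?N ?N _ ?N _ ?N])
  also have "\<dots> = (- 1) \<cdot>\<^sub>m ((?a * ?a) * (?b * ?b))"
    unfolding ba by (simp add: smult_mult_left smult_mult_right assoc_mult_mat[of _ ?N ?N _ ?N _ ?N])
  also have "\<dots> = (- 1) \<cdot>\<^sub>m 1\<^sub>m ?N" using assms by (simp add: majorana_square)
  finally show ?thesis by (simp add: edge_correlator_def smult_mult_left smult_mult_right smult_smult_mat)
qed

lemma conj_edge_correlator_00:
  assumes "U \<in> carrier_mat (2 ^ n) (2 ^ n)"
  shows "(mat_adjoint U * edge_correlator n * U) $$ (0, 0) =
    - \<i> * (mat_adjoint U * (majorana n 0 * majorana n (2 * n - 1)) * U) $$ (0, 0)"
  using assms by (simp add: edge_correlator_def smult_mult_left smult_mult_right del: index_mult_mat(1))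

lemma sum_lessThan_double: "sum h {..<2 * n} = (\<Sum>k<n. h (2 * k) + h (2 * k + 1))" for h :: "nat \<Rightarrow> complex"
  by (induction n) (auto simp: algebra_simps)

text \<open>The two-point function extended bilinearly: the Euclidean product plus
  \<open>\<i>\<close> times the symplectic form that pairs the two Majorana operators of each
  qubit.\<close>

lemma majorana_sum_mult_00:
  "(majorana_sum n f * majorana_sum n g) $$ (0, 0) =
    (\<Sum>i<2 * n. f i * g i) + \<i> * (\<Sum>k<n. f (2 * k) * g (2 * k + 1) - f (2 * k + 1) * g (2 * k))"
proof -
  define c :: "nat \<Rightarrow> nat \<Rightarrow> complex" where
    "c i j = (if i = j then 1 else if i div 2 = j div 2 then if even i then \<i> else - \<i> else 0)" for i j
  have inner: "(\<Sum>j<2 * n. g j * c i j) = g i + (if even i then \<i> * g (i + 1) else - \<i> * g (i - 1))"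
    if i: "i < 2 * n" for i
  proof -
    \<comment> \<open>The index of the other Majorana operator on the same qubit.\<close>
    define p where "p = (if even i then i + 1 else i - 1)"
    have p: "p < 2 * n" "p \<noteq> i" and iff: "\<And>j. i div 2 = j div 2 \<longleftrightarrow> j = i \<or> j = p"
      using i by (auto simp: p_def elim!: evenE oddE)
    have "(\<Sum>j<2 * n. g j * c i j) =
        (\<Sum>j<2 * n. (if j = i then g i else 0) + (if j = p then g p * (if even i then \<i> else - \<i>) else 0))"
      using p by (intro sum.cong refl) (auto simp: c_def iff)
    then show ?thesis using i p by (simp add: sum.distrib p_def)
  qed
  have "(majorana_sum n f * majorana_sum n g) $$ (0, 0) = (\<Sum>i<2 * n. f i * (\<Sum>j<2 * n. g j * c i j))"
  proof -
    have "(majorana_sum n f * majorana_sum n g) $$ (0, 0) = (\<Sum>i<2 * n. f i * (majorana n i * majorana_sum n g) $$ (0, 0))"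
      by (simp add: majorana_sum_mult_right del: index_mult_mat(1))
    also have "\<dots> = (\<Sum>i<2 * n. f i * (\<Sum>j<2 * n. g j * (majorana n i * majorana n j) $$ (0, 0)))"
      by (simp add: majorana_sum_mult_left del: index_mult_mat(1))
    also have "\<dots> = (\<Sum>i<2 * n. f i * (\<Sum>j<2 * n. g j * c i j))"
      by (intro sum.cong refl arg_cong2[where f = "(*)"]) (auto simp: majorana_mult_00 c_def simp del: index_mult_mat(1))
    finally show ?thesis .
  qed
  also have "\<dots> = (\<Sum>i<2 * n. f i * g i) + (\<Sum>i<2 * n. f i * (if even i then \<i> * g (i + 1) else - \<i> * g (i - 1)))"
    unfolding sum.distrib[symmetric] by (intro sum.cong refl) (simp add: inner distrib_left)
  also have "(\<Sum>i<2 * n. f i * (if even i then \<i> * g (i + 1) else - \<i> * g (i - 1))) =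
      (\<Sum>k<n. \<i> * (f (2 * k) * g (2 * k + 1) - f (2 * k + 1) * g (2 * k)))"
    unfolding sum_lessThan_double by (intro sum.cong refl) (simp add: algebra_simps)
  finally show ?thesis by (simp add: sum_distrib_left)
qed

text \<open>In the Heisenberg picture the two Majorana operators become the first and last columns
  of \<open>R\<close>. Their Euclidean product vanishes by orthogonality, and their symplectic
  product is the sum of the minors on the rows of each qubit. The phase \<open>- \<i>\<close> of the
  observable cancels \<open>\<i>\<close>.\<close>

lemma haar_edge_correlator:
  assumes R: "R \<in> orthogonal_group (2 * n)" and n: "n > 0"
  shows "(mat_adjoint (majorana_unitary n R) * edge_correlator n * majorana_unitary n R) $$ (0, 0) =
    complex_of_real (\<Sum>k<n. minor 0 (2 * n - 1) (2 * k) (2 * k + 1) R)"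
proof -
  let ?U = "majorana_unitary n R" and ?b = "2 * n - 1"
  note U = implements_majorana_unitary[OF R]
  note Rc = orthogonal_groupD(1)[OF R]
  have u: "unitary (2 ^ n) ?U" and c: "?U \<in> carrier_mat (2 ^ n) (2 ^ n)"
    using U by (auto simp: implements_def unitary_def)
  have g: "mat_adjoint ?U * majorana n a * ?U = majorana_sum n (\<lambda>j. complex_of_real (R $$ (j, a)))" if "a < 2 * n" for a
    using implements_adjoint[OF U R] that Rc unfolding implements_def
    by (auto intro!: majorana_sum_cong)
  have "(\<Sum>i<2 * n. complex_of_real (R $$ (i, 0)) * complex_of_real (R $$ (i, ?b))) =
      complex_of_real (\<Sum>i<2 * n. R $$ (i, 0) * R $$ (i, ?b))" by simp
  also have "\<dots> = 0" using orthogonal_group_col[OF R, of 0 ?b] n by simp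
  finally have "(mat_adjoint ?U * (majorana n 0 * majorana n ?b) * ?U) $$ (0, 0) =
      \<i> * complex_of_real (\<Sum>k<n. minor 0 ?b (2 * k) (2 * k + 1) R)"
    using n by (simp add: conj_mult_inner[OF u] g majorana_sum_mult_00 minor_def del: index_mult_mat(1))
  then show ?thesis unfolding conj_edge_correlator_00[OF c] by (simp del: index_mult_mat(1))
qed

lemma haar_state_moment_traces:
  assumes \<mu>: "haar_orthogonal (2 * n) \<mu>" and n: "n > 0"
  shows "mat_trace (kron (edge_correlator n) (edge_correlator n) * haar_state_moment n \<mu>) = 1 / (2 * real n - 1)"
    and "mat_trace (haar_state_moment n \<mu>) = 1"
    and "haar_state_moment n \<mu> \<in> carrier_mat (2 ^ n * 2 ^ n) (2 ^ n * 2 ^ n)"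
proof -
  have sp: "space \<mu> = orthogonal_group (2 * n)" and pr: "prob_space \<mu>" using \<mu> by (auto simp: haar_orthogonal_def)
  interpret prob_space \<mu> by (rule pr)
  have eq: "haar_state_moment n \<mu> = state_moment n \<mu> (majorana_unitary n)"
    by (simp add: haar_state_moment_def state_moment_def pure_state_def Let_def)
  then show "haar_state_moment n \<mu> \<in> carrier_mat (2 ^ n * 2 ^ n) (2 ^ n * 2 ^ n)" by simp
  have u: "unitary (2 ^ n) (majorana_unitary n R)" if "R \<in> space \<mu>" for R
    using that sp implements_majorana_unitary by (auto simp: implements_def)
  have V: "R \<in> space \<mu> \<Longrightarrow> majorana_unitary n R \<in> carrier_mat (2 ^ n) (2 ^ n)" for R
    using u unitary_carrier by blast
  have ae: "AE R in \<mu>. unitary (2 ^ n) (majorana_unitary n R)" using u by (rule AE_I2)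
  have meas: "a < 2 ^ n \<Longrightarrow> b < 2 ^ n \<Longrightarrow> (\<lambda>R. pure_state n (majorana_unitary n R) $$ (a, b)) \<in> borel_measurable \<mu>" for a b
    unfolding pure_state_def by (rule majorana_algebra_conj_measurable[OF \<mu> zero_state_in_majorana_algebra])
  have tr: "mat_trace (kron C C * state_moment n \<mu> (majorana_unitary n)) =
      (\<integral>R. ((mat_adjoint (majorana_unitary n R) * C * majorana_unitary n R) $$ (0, 0))\<^sup>2 \<partial>\<mu>)"
    if "C \<in> carrier_mat (2 ^ n) (2 ^ n)" for C
    by (rule state_moment_trace[OF pr V ae meas that])
  have "mat_trace (kron (edge_correlator n) (edge_correlator n) * haar_state_moment n \<mu>) =
      (\<integral>R. complex_of_real ((\<Sum>k<n. minor 0 (2 * n - 1) (2 * k) (2 * k + 1) R)\<^sup>2) \<partial>\<mu>)"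
    unfolding eq tr[OF edge_correlator_carrier]
    by (intro Bochner_Integration.integral_cong refl) (simp add: sp haar_edge_correlator[OF _ n] del: index_mult_mat(1))
  also have "\<dots> = complex_of_real (1 / (2 * real n - 1))"
    using haar_minor_sum_square[OF \<mu>, of 0 "2 * n - 1"] n by (subst integral_complex_of_real) simp
  finally show "mat_trace (kron (edge_correlator n) (edge_correlator n) * haar_state_moment n \<mu>) = 1 / (2 * real n - 1)"
    by simp
  show "mat_trace (haar_state_moment n \<mu>) = 1"
    unfolding eq by (rule state_moment_trace_one[OF pr V ae meas])
qed

text \<open>The sample space of \<open>E\<close> consists of all matrices, and only almost every one
  is a circuit; unitarity and the vanishing of the correlation therefore enter as almost-everywhere
  facts.\<close>

lemma ensemble_state_moment_traces:
  assumes E: "matchgate_ensemble n d E" and d: "2 * d + 1 < n"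
  shows "mat_trace (kron (edge_correlator n) (edge_correlator n) * ensemble_state_moment n E) = 0"
    and "mat_trace (ensemble_state_moment n E) = 1"
    and "ensemble_state_moment n E \<in> carrier_mat (2 ^ n * 2 ^ n) (2 ^ n * 2 ^ n)"
proof -
  let ?N = "2 ^ n :: nat"
  have pr: "prob_space E" and st: "sets E = sets (mat_borel ?N ?N)" and ae: "AE U in E. matchgate_circuit n d U"
    using E by (auto simp: matchgate_ensemble_def)
  interpret prob_space E by (rule pr)
  have sp: "space E = carrier_mat ?N ?N"
    using sets_eq_imp_space_eq[OF st] by (simp add: mat_borel_def)
  have meas: "(\<lambda>U. U $$ (i, j)) \<in> borel_measurable E" if "i < ?N" "j < ?N" for i j
    using mat_borel_entry_measurable[OF that] measurable_cong_sets[OF st refl, of borel] by auto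
  have eq: "ensemble_state_moment n E = state_moment n E (\<lambda>U. U)"
    unfolding ensemble_state_moment_def twirl_def state_moment_def mat_expectation_def
  proof (intro cong_mat refl Bochner_Integration.integral_cong)
    fix i j U assume "U \<in> space E"
    then have U: "U \<in> carrier_mat ?N ?N" by (simp add: sp)
    have "kron U U * kron (zero_state n) (zero_state n) * kron (mat_adjoint U) (mat_adjoint U) =
        kron (pure_state n U) (pure_state n U)"
      using carrier_matD[OF U] by (simp add: kron_mult_dim pure_state_def)
    then show "(kron U U * kron (zero_state n) (zero_state n) * kron (mat_adjoint U) (mat_adjoint U)) $$ (i, j) =
        kron (pure_state n U) (pure_state n U) $$ (i, j)" by simp
  qed
  then show "ensemble_state_moment n E \<in> carrier_mat (2 ^ n * 2 ^ n) (2 ^ n * 2 ^ n)" by simp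
  have u: "AE U in E. unitary ?N U"
    using ae by eventually_elim (use matchgate_circuit_local in blast)
  have meas_pure: "(\<lambda>U. pure_state n U $$ (a, b)) \<in> borel_measurable E" if "a < ?N" "b < ?N" for a b
  proof -
    have eq: "pure_state n U $$ (a, b) = U $$ (a, 0) * cnj (U $$ (b, 0))" if "U \<in> space E" for U
      using that \<open>a < ?N\<close> \<open>b < ?N\<close> by (simp add: sp pure_state_index)
    have "cnj \<in> borel_measurable borel"
      by (intro borel_measurable_continuous_onI continuous_intros)
    then have "(\<lambda>U. cnj (U $$ (b, 0))) \<in> borel_measurable E"
      using meas[of b 0] that by (intro measurable_compose[of _ E borel cnj]) auto
    then show ?thesis using meas[of a 0] that by (subst measurable_cong[OF eq]) auto
  qed
  have tr: "mat_trace (kron C C * state_moment n E (\<lambda>U. U)) = (\<integral>U. ((mat_adjoint U * C * U) $$ (0, 0))\<^sup>2 \<partial>E)"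
    if "C \<in> carrier_mat ?N ?N" for C
    using that sp u meas_pure by (intro state_moment_trace[OF pr]) auto
  have "(\<integral>U. ((mat_adjoint U * edge_correlator n * U) $$ (0, 0))\<^sup>2 \<partial>E) = 0"
  proof (rule integral_eq_zero_AE)
    show "AE U in E. ((mat_adjoint U * edge_correlator n * U) $$ (0, 0))\<^sup>2 = 0"
      using ae u
    proof eventually_elim
      case (elim U)
      then show ?case
        using conj_edge_correlator_00[OF unitary_carrier[OF elim(2)]] shallow_correlation_zero[OF elim(1) d]
        by (simp del: index_mult_mat(1))
    qed
  qed
  then show "mat_trace (kron (edge_correlator n) (edge_correlator n) * ensemble_state_moment n E) = 0"
    unfolding eq tr[OF edge_correlator_carrier] .
  show "mat_trace (ensemble_state_moment n E) = 1"
    unfolding eq using sp by (intro state_moment_trace_one[OF pr _ u meas_pure]) auto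
qed


section \<open>Trace norm and positive semidefinite order\<close>

lemma vec_extends_to_unitary:
  fixes v :: "complex vec"
  assumes v: "v \<in> carrier_vec n" "v \<noteq> 0\<^sub>v n"
  shows "\<exists>W c. unitary n W \<and> (\<forall>i<n. W $$ (i, 0) = c * v $ i)"
proof -
  have n: "n > 0" using v by (cases n) auto
  interpret cof_vec_space n "TYPE(complex)" .
  define b where "b = basis_completion v"
  from basis_completion[OF v, folded b_def]
  have dist_b: "distinct b" and indep: "\<not> lin_dep (set b)" and b: "set b \<subseteq> carrier_vec n"
    and hdb: "hd b = v" and len_b: "length b = n" by auto
  from hdb len_b n obtain vs where bv: "b = v # vs" by (cases b) auto
  define ws where "ws = gram_schmidt n b"
  from gram_schmidt_result[OF b dist_b indep refl, folded ws_def]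
  have ws: "set ws \<subseteq> carrier_vec n" "corthogonal ws" "length ws = n" by (auto simp: len_b)
  have hdws: "ws ! 0 = v"
    using gram_schmidt_hd[OF v(1), of vs, folded bv] ws(3) n unfolding ws_def by (metis hd_conv_nth length_0_conv less_irrefl)
  define q where "q j = (\<Sum>k<n. (cmod (ws ! j $ k))\<^sup>2)" for j
  have car: "ws ! j \<in> carrier_vec n" if "j < n" for j using ws that by auto
  have ip: "ws ! j \<bullet>c ws ! i = (\<Sum>k<n. ws ! j $ k * cnj (ws ! i $ k))" if "i < n" "j < n" for i j
    using car[OF that(1)] car[OF that(2)] by (simp add: scalar_prod_def lessThan_atLeast0)
  have ip_self: "ws ! j \<bullet>c ws ! j = complex_of_real (q j)" if "j < n" for j
    unfolding ip[OF that that] q_def by (simp add: complex_norm_square del: of_real_power)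
  have q: "q j > 0" if "j < n" for j
  proof -
    have "q j \<noteq> 0" using ip_self[OF that] corthogonalD[OF ws(2), of j j] that ws(3) by auto
    moreover have "q j \<ge> 0" unfolding q_def by (intro sum_nonneg) simp
    ultimately show ?thesis by simp
  qed
  \<comment> \<open>Gram--Schmidt yields orthogonal vectors, which still have to be scaled to unit
    length; the scaling of the first one, which is \<open>v\<close>, becomes the constant
    \<open>c\<close>.\<close>
  define W where "W = mat n n (\<lambda>(i, j). ws ! j $ i / complex_of_real (sqrt (q j)))"
  have W: "W \<in> carrier_mat n n" by (simp add: W_def)
  have "mat_adjoint W * W = 1\<^sub>m n"
  proof (rule eq_matI)
    fix i j assume "i < dim_row (1\<^sub>m n :: complex mat)" "j < dim_col (1\<^sub>m n :: complex mat)"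
    then have ij: "i < n" "j < n" by auto
    have "(mat_adjoint W * W) $$ (i, j) = (\<Sum>k<n. mat_adjoint W $$ (i, k) * W $$ (k, j))"
      using W ij by (intro index_mult_sum) auto
    also have "\<dots> = (\<Sum>k<n. ws ! j $ k * cnj (ws ! i $ k)) / (complex_of_real (sqrt (q i)) * complex_of_real (sqrt (q j)))"
      unfolding sum_divide_distrib using ij by (intro sum.cong refl) (simp add: W_def)
    also have "\<dots> = (ws ! j \<bullet>c ws ! i) / complex_of_real (sqrt (q i) * sqrt (q j))"
      using ip[OF ij] by simp
    also have "\<dots> = 1\<^sub>m n $$ (i, j)"
    proof (cases "i = j")
      case True
      then show ?thesis using ip_self[OF ij(1)] q[OF ij(1)] ij by simp
    next
      case False
      then show ?thesis using corthogonalD[OF ws(2), of j i] ij ws(3) by simp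
    qed
    finally show "(mat_adjoint W * W) $$ (i, j) = 1\<^sub>m n $$ (i, j)" .
  qed (use W in auto)
  then have "unitary n W"
    using W mat_mult_left_right_inverse[of "mat_adjoint W" n W] by (simp add: unitary_def)
  moreover have "W $$ (i, 0) = (1 / complex_of_real (sqrt (q 0))) * v $ i" if "i < n" for i
    using that n hdws by (simp add: W_def)
  ultimately show ?thesis by blast
qed

lemma index_conj_sum:
  assumes "U \<in> carrier_mat N N" "B \<in> carrier_mat N N" "i < N" "j < N"
  shows "(mat_adjoint U * B * U) $$ (i, j) = (\<Sum>k<N. \<Sum>l<N. cnj (U $$ (k, i)) * (B $$ (k, l) * U $$ (l, j)))"
proof -
  have "(mat_adjoint U * B * U) $$ (i, j) = (mat_adjoint U * (B * U)) $$ (i, j)"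
    using assms by (simp add: assoc_mult_mat[of _ N N _ N _ N])
  also have "\<dots> = (\<Sum>k<N. mat_adjoint U $$ (i, k) * (B * U) $$ (k, j))"
    using assms by (intro index_mult_sum) auto
  also have "\<dots> = (\<Sum>k<N. \<Sum>l<N. cnj (U $$ (k, i)) * (B $$ (k, l) * U $$ (l, j)))"
    using assms by (intro sum.cong refl) (simp add: index_mult_sum[of B N N U N] sum_distrib_left del: index_mult_mat(1))
  finally show ?thesis .
qed

text \<open>Schur's theorem by deflation: an eigenvector, scaled and completed to a unitary, clears
  the first column below the diagonal, and the induction hypothesis handles the trailing
  block.\<close>

lemma unitary_triangularization:
  fixes A :: "complex mat"
  assumes "A \<in> carrier_mat N N"
  shows "\<exists>U. unitary N U \<and> upper_triangular (mat_adjoint U * A * U)"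
  using assms
proof (induction N arbitrary: A)
  case 0
  then show ?case by (intro exI[of _ "1\<^sub>m 0"]) (auto simp: unitary_def)
next
  case (Suc n)
  let ?N = "Suc n"
  have "\<not> constant (poly (char_poly A))"
    using degree_monic_char_poly[OF Suc.prems] by (simp add: constant_degree)
  then obtain e where "poly (char_poly A) e = 0" using fundamental_theorem_of_algebra by blast
  then obtain v where v: "v \<in> carrier_vec ?N" "v \<noteq> 0\<^sub>v ?N" "A *\<^sub>v v = e \<cdot>\<^sub>v v"
    using eigenvalue_root_char_poly[OF Suc.prems] Suc.prems by (auto simp: eigenvalue_def eigenvector_def)
  obtain W c where W: "unitary ?N W" and col: "\<And>i. i < ?N \<Longrightarrow> W $$ (i, 0) = c * v $ i"
    using vec_extends_to_unitary[OF v(1,2)] by blast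
  have Wc: "W \<in> carrier_mat ?N ?N" "mat_adjoint W * W = 1\<^sub>m ?N" using W by (auto simp: unitary_def)
  define B where "B = mat_adjoint W * A * W"
  have B: "B \<in> carrier_mat ?N ?N" unfolding B_def using Wc Suc.prems by auto
  \<comment> \<open>The first column of \<open>W\<close> is an eigenvector, so the first column of
    \<open>A * W\<close> is \<open>e\<close> times it, and it is orthogonal to the other columns of
    \<open>W\<close>.\<close>
  have B0: "B $$ (i, 0) = 0" if i: "0 < i" "i < ?N" for i
  proof -
    have Av: "(\<Sum>l<?N. A $$ (k, l) * v $ l) = e * v $ k" if "k < ?N" for k
      using arg_cong[OF v(3), of "\<lambda>x. x $ k"] that v(1) Suc.prems
      by (simp add: scalar_prod_def lessThan_atLeast0 del: sum.lessThan_Suc sum.op_ivl_Suc)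
    have "B $$ (i, 0) = (\<Sum>k<?N. cnj (W $$ (k, i)) * (\<Sum>l<?N. A $$ (k, l) * W $$ (l, 0)))"
      unfolding B_def sum_distrib_left using i Wc Suc.prems by (intro index_conj_sum) auto
    also have "\<dots> = (\<Sum>k<?N. cnj (W $$ (k, i)) * (e * W $$ (k, 0)))"
    proof (intro sum.cong refl arg_cong2[where f = "(*)"])
      fix k assume k: "k \<in> {..<?N}"
      have "(\<Sum>l<?N. A $$ (k, l) * W $$ (l, 0)) = c * (\<Sum>l<?N. A $$ (k, l) * v $ l)"
        unfolding sum_distrib_left by (intro sum.cong refl) (simp add: col)
      also have "\<dots> = e * W $$ (k, 0)" using k by (simp add: Av col del: sum.lessThan_Suc)
      finally show "(\<Sum>l<?N. A $$ (k, l) * W $$ (l, 0)) = e * W $$ (k, 0)" .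
    qed
    also have "\<dots> = e * (\<Sum>k<?N. mat_adjoint W $$ (i, k) * W $$ (k, 0))"
      unfolding sum_distrib_left using i Wc by (intro sum.cong refl) simp
    also have "\<dots> = e * (mat_adjoint W * W) $$ (i, 0)"
      using i Wc(1) by (subst index_mult_sum[of _ ?N ?N _ ?N]) auto
    finally show ?thesis using i by (simp add: Wc(2) del: index_mult_mat(1))
  qed
  define A3 where "A3 = mat n n (\<lambda>(i, j). B $$ (Suc i, Suc j))"
  have A3: "A3 \<in> carrier_mat n n" by (simp add: A3_def)
  obtain U3 where U3: "unitary n U3" "upper_triangular (mat_adjoint U3 * A3 * U3)" using Suc.IH[OF A3] by blast
  have U3c: "U3 \<in> carrier_mat n n" "mat_adjoint U3 * U3 = 1\<^sub>m n" using U3 by (auto simp: unitary_def)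
  \<comment> \<open>The block sum of the scalar 1 and \<open>U3\<close>, which leaves the cleared
    column alone.\<close>
  define V where "V = mat ?N ?N (\<lambda>(i, j). if i = 0 \<and> j = 0 then 1 else if i = 0 \<or> j = 0 then 0 else U3 $$ (i - 1, j - 1))"
  have V: "V \<in> carrier_mat ?N ?N" by (simp add: V_def)
  have V_simps: "V $$ (0, 0) = 1" "\<And>i. i < n \<Longrightarrow> V $$ (Suc i, 0) = 0" "\<And>j. j < n \<Longrightarrow> V $$ (0, Suc j) = 0"
    "\<And>i j. i < n \<Longrightarrow> j < n \<Longrightarrow> V $$ (Suc i, Suc j) = U3 $$ (i, j)"
    by (auto simp: V_def)
  have "mat_adjoint V * V = 1\<^sub>m ?N"
  proof (rule eq_matI)
    fix i j assume "i < dim_row (1\<^sub>m ?N :: complex mat)" "j < dim_col (1\<^sub>m ?N :: complex mat)"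
    then have ij: "i < ?N" "j < ?N" by auto
    have "(mat_adjoint V * V) $$ (i, j) = (\<Sum>k<?N. cnj (V $$ (k, i)) * V $$ (k, j))"
      using V ij by (subst index_mult_sum[of _ ?N ?N _ ?N]) (auto simp del: sum.lessThan_Suc)
    also have "\<dots> = cnj (V $$ (0, i)) * V $$ (0, j) + (\<Sum>k<n. cnj (V $$ (Suc k, i)) * V $$ (Suc k, j))"
      by (rule sum.lessThan_Suc_shift)
    also have "\<dots> = 1\<^sub>m ?N $$ (i, j)"
    proof (cases i; cases j)
      fix i' j' assume eq: "i = Suc i'" "j = Suc j'"
      then have lt: "i' < n" "j' < n" using ij by auto
      have "(\<Sum>k<n. cnj (U3 $$ (k, i')) * U3 $$ (k, j')) = (mat_adjoint U3 * U3) $$ (i', j')"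
        using U3c(1) lt by (subst index_mult_sum[of _ n n _ n]) auto
      then show ?thesis using lt unfolding eq U3c(2) by (simp add: V_simps)
    qed (use ij in \<open>auto simp: V_simps\<close>)
    finally show "(mat_adjoint V * V) $$ (i, j) = 1\<^sub>m ?N $$ (i, j)" .
  qed (use V in auto)
  then have Vu: "unitary ?N V"
    using V mat_mult_left_right_inverse[of "mat_adjoint V" ?N V] by (simp add: unitary_def)
  have "upper_triangular (mat_adjoint V * B * V)"
  proof (rule upper_triangularI)
    fix i j assume ji: "j < i" and "i < dim_row (mat_adjoint V * B * V)"
    then have i: "i < ?N" "j < ?N" using V by auto
    obtain i' where i': "i = Suc i'" "i' < n" using i ji by (cases i) auto
    have "(mat_adjoint V * B * V) $$ (i, j) = (\<Sum>k<?N. \<Sum>l<?N. cnj (V $$ (k, i)) * (B $$ (k, l) * V $$ (l, j)))"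
      using V B i by (intro index_conj_sum) auto
    also have "\<dots> = (\<Sum>k<n. cnj (U3 $$ (k, i')) * (B $$ (Suc k, 0) * V $$ (0, j)) +
        (\<Sum>l<n. cnj (U3 $$ (k, i')) * (B $$ (Suc k, Suc l) * V $$ (Suc l, j))))"
      unfolding sum.lessThan_Suc_shift using i' by (simp add: V_simps)
    also have "\<dots> = (\<Sum>k<n. \<Sum>l<n. cnj (U3 $$ (k, i')) * (A3 $$ (k, l) * V $$ (Suc l, j)))"
      by (intro sum.cong refl) (simp add: B0 A3_def)
    also have "\<dots> = 0"
    proof (cases j)
      case 0
      then show ?thesis by (simp add: V_simps)
    next
      case (Suc j')
      then have j': "j' < n" "j' < i'" using ji i' by auto
      have "(mat_adjoint U3 * A3 * U3) $$ (i', j') = 0"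
        using U3(2) j' i' U3c A3 by (intro upper_triangularD) auto
      then show ?thesis
        unfolding index_conj_sum[OF U3c(1) A3 i'(2) j'(1)] using j' Suc by (simp add: V_simps)
    qed
    finally show "(mat_adjoint V * B * V) $$ (i, j) = 0" .
  qed
  also have "mat_adjoint V * B * V = mat_adjoint (W * V) * A * (W * V)"
    unfolding B_def using conj_mult[OF Wc(1) V Suc.prems] by simp
  finally show ?case using unitary_mult[OF W Vu] by blast
qed

text \<open>Triangularizing \<open>mat_adjoint X * X\<close> by a unitary \<open>U\<close> puts its
  eigenvalues, with multiplicity, on the diagonal; there they are the squared norms of the columns
  of \<open>X * U\<close>.\<close>

lemma trace_norm_singular_values:
  assumes X: "X \<in> carrier_mat N N"
  obtains U where "unitary N U" "trace_norm X = (\<Sum>i<N. sqrt (\<Sum>k<N. (cmod ((X * U) $$ (k, i)))\<^sup>2))"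
proof -
  let ?H = "mat_adjoint X * X"
  have H: "?H \<in> carrier_mat N N" using X by auto
  obtain U where U: "unitary N U" and T: "upper_triangular (mat_adjoint U * ?H * U)"
    using unitary_triangularization[OF H] by blast
  define T where "T = mat_adjoint U * ?H * U"
  have Uc: "U \<in> carrier_mat N N" "U * mat_adjoint U = 1\<^sub>m N" "mat_adjoint U * U = 1\<^sub>m N"
    using U by (auto simp: unitary_def)
  have Tc: "T \<in> carrier_mat N N" unfolding T_def using Uc H by auto
  have "similar_mat T ?H"
    using Uc H Tc unfolding similar_mat_def
    by (intro exI[of _ "mat_adjoint U"] exI[of _ U] similar_mat_witI[of _ _ N]) (auto simp: T_def)
  then have "char_poly ?H = (\<Prod>a\<leftarrow>diag_mat T. [:- a, 1:])"
    using char_poly_similar char_poly_upper_triangular[OF Tc] T unfolding T_def by metis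
  moreover have "proots (\<Prod>a\<leftarrow>xs. [:- a, 1:]) = mset xs" for xs :: "complex list"
  proof (induction xs)
    case (Cons a xs)
    have "(\<Prod>a\<leftarrow>xs. [:- a, 1:]) \<noteq> 0" by (auto simp: prod_list_zero_iff)
    then have "proots ([:- a, 1:] * (\<Prod>a\<leftarrow>xs. [:- a, 1:])) = proots [:- a, 1:] + proots (\<Prod>a\<leftarrow>xs. [:- a, 1:])"
      by (intro proots_mult) simp_all
    then show ?case using Cons by (simp del: mult_pCons_left)
  qed simp
  ultimately have "proots (char_poly ?H) = mset (diag_mat T)" by simp
  then have "trace_norm X = (\<Sum>x\<leftarrow>diag_mat T. sqrt (Re x))"
    unfolding trace_norm_def by (simp flip: sum_mset_sum_list)
  also have "\<dots> = (\<Sum>i<N. sqrt (Re (T $$ (i, i))))"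
    using Tc by (simp add: diag_mat_def interv_sum_list_conv_sum_set_nat lessThan_atLeast0 comp_def)
  also have "\<dots> = (\<Sum>i<N. sqrt (\<Sum>k<N. (cmod ((X * U) $$ (k, i)))\<^sup>2))"
  proof (intro sum.cong refl arg_cong[where f = sqrt])
    fix i assume "i \<in> {..<N}"
    then have i: "i < N" by simp
    have "T = mat_adjoint (X * U) * (X * U)"
      unfolding T_def using X Uc by (simp add: mat_adjoint_mult[of _ N N _ N] assoc_mult_mat[of _ N N _ N _ N])
    then have "T $$ (i, i) = (\<Sum>k<N. mat_adjoint (X * U) $$ (i, k) * (X * U) $$ (k, i))"
      using X Uc(1) i by (simp only:, intro index_mult_sum) auto
    also have "\<dots> = (\<Sum>k<N. complex_of_real ((cmod ((X * U) $$ (k, i)))\<^sup>2))"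
      unfolding complex_norm_square using X Uc(1) i
      by (intro sum.cong refl) (simp add: mult.commute del: index_mult_mat(1))
    finally show "Re (T $$ (i, i)) = (\<Sum>k<N. (cmod ((X * U) $$ (k, i)))\<^sup>2)" by simp
  qed
  finally show ?thesis using that U by blast
qed

text \<open>By cyclicity the trace is that of \<open>(mat_adjoint U * A) * (X * U)\<close>. Each of
  its diagonal entries is bounded by Cauchy--Schwarz: the rows of the unitary on the left have norm
  one, and the column norms on the right add up to the trace norm.\<close>

lemma trace_norm_ge_trace:
  assumes X: "X \<in> carrier_mat N N" and A: "unitary N A"
  shows "cmod (mat_trace (A * X)) \<le> trace_norm X"
proof -
  obtain U where U: "unitary N U"
    and tn: "trace_norm X = (\<Sum>i<N. sqrt (\<Sum>k<N. (cmod ((X * U) $$ (k, i)))\<^sup>2))"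
    using trace_norm_singular_values[OF X] by blast
  have c: "U \<in> carrier_mat N N" "A \<in> carrier_mat N N" "U * mat_adjoint U = 1\<^sub>m N"
    using U A by (auto simp: unitary_def)
  define V Y where "V = mat_adjoint U * A" and "Y = X * U"
  have VY: "V \<in> carrier_mat N N" "Y \<in> carrier_mat N N" using c X by (auto simp: V_def Y_def)
  have V: "unitary N V" unfolding V_def using U A by (intro unitary_mult unitary_mat_adjoint)
  have "A * X = A * X * (U * mat_adjoint U)" using c X by (simp add: right_mult_one_mat[of _ N N])
  also have "\<dots> = (A * Y) * mat_adjoint U"
    unfolding Y_def using c(1,2) X by (simp add: assoc_mult_mat[of _ N N _ N _ N])
  finally have "mat_trace (A * X) = mat_trace (mat_adjoint U * (A * Y))"
    using c VY mat_trace_comm[of "A * Y" N N "mat_adjoint U"] by simp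
  also have "mat_adjoint U * (A * Y) = V * Y"
    unfolding V_def using c VY by (simp add: assoc_mult_mat[of _ N N _ N _ N])
  also have "mat_trace (V * Y) = (\<Sum>i<N. \<Sum>k<N. V $$ (i, k) * Y $$ (k, i))"
    using VY by (rule mat_trace_mult)
  also have "cmod \<dots> \<le> (\<Sum>i<N. sqrt (\<Sum>k<N. (cmod (Y $$ (k, i)))\<^sup>2))"
  proof (rule sum_norm_le)
    fix i assume "i \<in> {..<N}"
    then have i: "i < N" by simp
    have "cmod (\<Sum>k<N. V $$ (i, k) * Y $$ (k, i)) \<le> (\<Sum>k<N. \<bar>cmod (V $$ (i, k))\<bar> * \<bar>cmod (Y $$ (k, i))\<bar>)"
      by (rule order.trans[OF norm_sum]) (simp add: norm_mult)
    also have "\<dots> \<le> L2_set (\<lambda>k. cmod (V $$ (i, k))) {..<N} * L2_set (\<lambda>k. cmod (Y $$ (k, i))) {..<N}"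
      by (rule L2_set_mult_ineq)
    also have "\<dots> = sqrt (\<Sum>k<N. (cmod (Y $$ (k, i)))\<^sup>2)"
      unfolding L2_set_def unitary_row_norm[OF V i] by simp
    finally show "cmod (\<Sum>k<N. V $$ (i, k) * Y $$ (k, i)) \<le> sqrt (\<Sum>k<N. (cmod (Y $$ (k, i)))\<^sup>2)" .
  qed
  finally show ?thesis unfolding tn Y_def .
qed

text \<open>The diagonal entries are the values of the quadratic form of \<open>B\<close> at the
  columns of \<open>P\<close>.\<close>

lemma psd_conj_trace_nonneg:
  assumes B: "psd N B" and P: "P \<in> carrier_mat N N"
  shows "0 \<le> Re (mat_trace (mat_adjoint P * B * P))"
proof -
  have Bc: "B \<in> carrier_mat N N" using B by (simp add: psd_def)
  have "0 \<le> Re ((mat_adjoint P * B * P) $$ (i, i))" if i: "i < N" for i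
  proof -
    have "(mat_adjoint P * B * P) $$ (i, i) = scalar_prod (B *\<^sub>v col P i) (conjugate (col P i))"
      unfolding index_conj_sum[OF P Bc i i] using P Bc i
      by (simp add: scalar_prod_def lessThan_atLeast0 sum_distrib_left mult_ac)
    then show ?thesis using B P i unfolding psd_def by auto
  qed
  then show ?thesis using P Bc by (auto simp: mat_trace_def simp del: index_mult_mat(1) intro!: sum_nonneg)
qed

text \<open>For a sign \<open>s\<close> the matrix \<open>P = 1 + s A\<close> is twice a projection,
  so the trace of \<open>P * B * P\<close> is twice that of \<open>P * B\<close>, which is the
  claimed expression.\<close>

lemma psd_involution_trace:
  assumes B: "psd N B" and A: "A \<in> carrier_mat N N" "mat_adjoint A = A" "A * A = 1\<^sub>m N" and s: "s * s = (1 :: real)"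
  shows "0 \<le> Re (mat_trace B) + s * Re (mat_trace (A * B))"
proof -
  define P where "P = 1\<^sub>m N + complex_of_real s \<cdot>\<^sub>m A"
  have Bc: "B \<in> carrier_mat N N" using B by (simp add: psd_def)
  have P: "P \<in> carrier_mat N N" "mat_adjoint P = P"
    using A by (auto simp: P_def mat_adjoint_add[of _ N N] mat_adjoint_smult)
  have ss: "complex_of_real s * complex_of_real s = 1" using s by (metis of_real_1 of_real_mult)
  have "P * P = 2 \<cdot>\<^sub>m 1\<^sub>m N + (2 * complex_of_real s) \<cdot>\<^sub>m A"
    using rotation_mult[OF A(1,3), of 1 "complex_of_real s" 1 "complex_of_real s"] by (simp add: P_def ss)
  moreover have "mat_trace (mat_adjoint P * B * P) = mat_trace (P * P * B)"
    using P Bc mat_trace_comm[of "P * B" N N P] by (simp add: assoc_mult_mat[of _ N N _ N _ N])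
  ultimately have "mat_trace (mat_adjoint P * B * P) = 2 * mat_trace B + 2 * complex_of_real s * mat_trace (A * B)"
    using A Bc by (simp add: add_mult_distrib_mat[of _ N N _ _ N] smult_mult_left mat_trace_add[of _ N]
        mat_trace_smult[of _ N] left_mult_one_mat[of _ N N])
  then show ?thesis using psd_conj_trace_nonneg[OF B P(1)] by simp
qed

section \<open>The depth bound\<close>

lemma design_error_bound:
  assumes \<mu>: "haar_orthogonal (2 * n) \<mu>" and E: "matchgate_ensemble n d E" and d: "2 * d + 1 < n"
  shows "additive_state_design n \<mu> \<epsilon> E \<Longrightarrow> 1 / (2 * real n - 1) \<le> \<epsilon>"
    and "relative_state_design n \<mu> \<epsilon> E \<Longrightarrow> 1 / (2 * real n - 1) \<le> \<epsilon>"
proof -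
  let ?N = "2 ^ n * 2 ^ n :: nat" and ?C = "edge_correlator n"
  define A where "A = kron ?C ?C"
  define \<sigma> where "\<sigma> = haar_state_moment n \<mu>"
  define \<tau> where "\<tau> = ensemble_state_moment n E"
  have n: "n > 0" using d by simp
  define a where "a = 1 / (2 * real n - 1)"
  have \<sigma>: "mat_trace (A * \<sigma>) = complex_of_real a" "mat_trace \<sigma> = 1" "\<sigma> \<in> carrier_mat ?N ?N"
    using haar_state_moment_traces[OF \<mu> n, folded \<sigma>_def A_def] by (simp_all add: a_def)
  note \<tau> = ensemble_state_moment_traces[OF E d, folded \<tau>_def A_def]
  have A: "A \<in> carrier_mat ?N ?N" "mat_adjoint A = A" "A * A = 1\<^sub>m ?N"
    using carrier_matD[OF edge_correlator_carrier[of n]]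
    by (auto simp: A_def kron_carrier mat_adjoint_kron mat_adjoint_edge_correlator[OF n] kron_mult_dim
        edge_correlator_square[OF n] kron_one_one)
  then have Au: "unitary ?N A" by (simp add: unitary_def)
  have lin: "mat_trace (A * (X - Y)) = mat_trace (A * X) - mat_trace (A * Y)"
    "mat_trace (A * (c \<cdot>\<^sub>m X)) = c * mat_trace (A * X)"
    if "X \<in> carrier_mat ?N ?N" "Y \<in> carrier_mat ?N ?N" for X Y c
    using that A(1) carrier_matD[OF A(1)] by (simp_all add: mult_minus_distrib_mat[of _ ?N ?N _ ?N]
        mat_trace_minus[of _ ?N] smult_mult_right mat_trace_smult[of _ ?N])
  {
    assume "additive_state_design n \<mu> \<epsilon> E"
    then have "trace_norm (\<sigma> - \<tau>) \<le> \<epsilon>" by (simp add: additive_state_design_def \<sigma>_def \<tau>_def)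
    moreover have "cmod (mat_trace (A * (\<sigma> - \<tau>))) \<le> trace_norm (\<sigma> - \<tau>)"
      using \<sigma>(3) \<tau>(3) by (intro trace_norm_ge_trace[OF _ Au]) auto
    moreover have "mat_trace (A * (\<sigma> - \<tau>)) = complex_of_real a"
      using \<sigma> \<tau> by (simp add: lin)
    ultimately show "1 / (2 * real n - 1) \<le> \<epsilon>"
      unfolding a_def[symmetric] by (metis abs_ge_self norm_of_real order.trans)
  next
    assume "relative_state_design n \<mu> \<epsilon> E"
    then have lo: "psd ?N (\<tau> - complex_of_real (1 - \<epsilon>) \<cdot>\<^sub>m \<sigma>)" and hi: "psd ?N (complex_of_real (1 + \<epsilon>) \<cdot>\<^sub>m \<sigma> - \<tau>)"
      by (simp_all add: relative_state_design_def loewner_le_def \<sigma>_def \<tau>_def)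
    \<comment> \<open>The lower bound on \<tau> is tested with \<open>1 + A\<close> and the upper
      one with \<open>1 - A\<close>. In the sum of the two inequalities the products of \<epsilon>
      and \<open>a\<close> cancel, which leaves \<open>a\<close> below \<epsilon>.\<close>
    have "0 \<le> 1 - (1 - \<epsilon>) + (0 - (1 - \<epsilon>) * a)"
      using psd_involution_trace[OF lo A, of 1] \<sigma> \<tau>
      by (simp add: lin mat_trace_minus[of _ ?N] mat_trace_smult[of _ ?N])
    moreover have "0 \<le> (1 + \<epsilon>) - 1 - ((1 + \<epsilon>) * a - 0)"
      using psd_involution_trace[OF hi A, of "- 1"] \<sigma> \<tau>
      by (simp add: lin mat_trace_minus[of _ ?N] mat_trace_smult[of _ ?N])
    ultimately show "1 / (2 * real n - 1) \<le> \<epsilon>"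
      unfolding a_def[symmetric] by (simp add: algebra_simps)
  }
qed

theorem theoremS29:
  shows "(\<exists>c::real. c > 0 \<and> (\<exists>N::nat. \<forall>n\<ge>N. \<forall>(d::nat) (E::complex mat measure) (\<mu>::real mat measure) (\<epsilon>::real).
            haar_orthogonal (2 * n) \<mu> \<and> matchgate_ensemble n d E \<and>
            additive_state_design n \<mu> \<epsilon> E \<and> \<epsilon> < 1 / (2 * real n - 1)
            \<longrightarrow> real d \<ge> c * real n)) \<and>
         (\<exists>c::real. c > 0 \<and> (\<exists>N::nat. \<forall>n\<ge>N. \<forall>(d::nat) (E::complex mat measure) (\<mu>::real mat measure) (\<epsilon>::real).
            haar_orthogonal (2 * n) \<mu> \<and> matchgate_ensemble n d E \<and>
            relative_state_design n \<mu> \<epsilon> E \<and> \<epsilon> < 1 / (4 * real n - 2)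
            \<longrightarrow> real d \<ge> c * real n))"
proof -
  \<comment> \<open>From 4d < n follows 2d + 1 < n/2 + 1, which is at most n once n is at least 2;
    hence the constant 1/4 and the threshold 2.\<close>
  have shallow: "2 * d + 1 < n" if "n \<ge> 2" "\<not> real d \<ge> 1 / 4 * real n" for n d :: nat
    using that by linarith
  \<comment> \<open>The relative threshold is half the value in \<open>design_error_bound\<close>,
    so an error below it contradicts that bound as well.\<close>
  have half: "1 / (4 * real n - 2) \<le> 1 / (2 * real n - 1)" if "n \<ge> 2" for n :: nat
    using that by (intro divide_left_mono mult_pos_pos) auto
  show ?thesis
  proof (intro conjI exI[of _ "1 / 4 :: real"] exI[of _ "2 :: nat"] allI impI; (elim conjE)?)
    fix n d :: nat and E \<mu> \<epsilon>
    assume asm: "n \<ge> 2" "haar_orthogonal (2 * n) \<mu>" "matchgate_ensemble n d E"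
    {
      assume "additive_state_design n \<mu> \<epsilon> E" "\<epsilon> < 1 / (2 * real n - 1)"
      then show "real d \<ge> 1 / 4 * real n"
        using design_error_bound(1)[OF asm(2,3)] shallow[OF asm(1), of d] by fastforce
    next
      assume "relative_state_design n \<mu> \<epsilon> E" "\<epsilon> < 1 / (4 * real n - 2)"
      then show "real d \<ge> 1 / 4 * real n"
        using design_error_bound(2)[OF asm(2,3)] shallow[OF asm(1), of d] half[OF asm(1)] by fastforce
    }
  qed simp_all
qed

end
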